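(* Let $T>0$ and let $H_1,H_2\colon[0,T]\to(1/2,1)$ be continuous functions. Put $\check H_i=\max_{t\in[0,T]}H_i(t)$ for $i=1,2$ and $\check H=(\check H_1+\check H_2)/2$. Assume that there exists $\gamma>\check H$ such that $|H_i(t)-H_i(s)|\le|t-s|^\gamma$ for $i=1,2$ and all $t,s\in[0,T]$. Then the multifractional generalized Rosenblatt process $X=\{X_t,\ t\in[0,T]\}$, $X_t=Y_t^{H_1(t),H_2(t)}$, has a square integrable local time on $[0,T]$, i.e. almost surely the occupation measure $\mu([0,T],\cdot)$ of $X$ is absolutely continuous with respect to Lebesgue measure on $\mathbb{R}$, and its density $L([0,T],x)$ belongs to $L^2(\mathbb{R}\times\Omega)$.
   Context: $W$ is the standard Wiener (Gaussian white noise) measure on $\mathbb{R}$: a random measure with independent values on disjoint sets such that, for every Borel set $A$ of finite Lebesgue measure $\lambda(A)$, $W(A)$ is centered Gaussian with variance $\lambda(A)$. For a symmetric $f\in L^2(\mathbb{R}^2)$, the double Itô–Wiener integral $I_2(f)=\iint_{\mathbb{R}^2}f(x,y)\,W(dx)W(dy)$ is defined as follows. For simple $f(x,y)=\sum_{k,j=1}^n a_{kj}\mathbf{1}_{A_k}(x)\mathbf{1}_{A_j}(y)$, with $A_1,\dots,A_n$ disjoint of finite Lebesgue measure, $a_{kj}=a_{jk}$ and $a_{kk}=0$, set $I_2(f)=\sum_{k,j}a_{kj}W(A_k)W(A_j)$. Then extend to all symmetric $f\in L^2(\mathbb{R}^2)$ by linearity and continuity into $L^2(\Omega)$ (one has $\mathsf{E}[I_2(f)^2]=2\|f\|^2_{L^2(\mathbb{R}^2)}$).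 For $a\in\mathbb{R}$, $u_+^{a}=u^a$ if $u>0$ and $u_+^a=0$ if $u\le0$. For $h_1,h_2\in(1/2,1)$ define $$K_{h_1,h_2}(s,x,y)=(s-x)_+^{h_1/2-1}(s-y)_+^{h_2/2-1}+(s-x)_+^{h_2/2-1}(s-y)_+^{h_1/2-1},$$ and the generalized Rosenblatt process $$Y_t^{h_1,h_2}=\iint_{\mathbb{R}^2}\int_0^tK_{h_1,h_2}(s,x,y)\,ds\,W(dx)W(dy),\quad t\ge0.$$ The multifractional generalized Rosenblatt process is $$X_t=Y_t^{H_1(t),H_2(t)}=\iint_{\mathbb{R}^2}\int_0^tK_{H_1(t),H_2(t)}(s,x,y)\,ds\,W(dx)W(dy),\quad t\in[0,T],$$ with the same $W$ for all $t$. For a process $Z$ (taken in a separable, jointly measurable version), the occupation measure is $\mu(A,B)=\lambda(\{s\in A: Z_s\in B\})$ for Borel $A\subset[0,\infty)$ (contained in the time domain) and Borel $B\subset\mathbb{R}$, where $\lambda$ is Lebesgue measure; the local time is the Radon–Nikodym derivative $L(A,x)=\frac{d\mu(A,\cdot)}{d\lambda}(x)$. *)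

theory Defs
  imports "HOL-Probability.Probability"
begin

definition fin_borel :: "real set set"
  where "fin_borel = {A \<in> sets borel. emeasure lborel A < \<infinity>}"

text \<open>The degenerate case is separate because \<^term>\<open>normal_density 0 0\<close> is the zero function.\<close>

definition centered_gaussian :: "'w measure \<Rightarrow> ('w \<Rightarrow> real) \<Rightarrow> real \<Rightarrow> bool"
  where "centered_gaussian M Z v \<longleftrightarrow> Z \<in> borel_measurable M \<and>
    (if v = 0 then AE \<omega> in M. Z \<omega> = 0
     else distributed M lborel Z (\<lambda>x. ennreal (normal_density 0 (sqrt v) x)))"

text \<open>Countable additivity of the random measure is almost sure, with an exceptional null set
  that may depend on the sequence of sets. Finite disjoint families are covered by sequences
  that are eventually empty.\<close>

locale white_noise = prob_space M for M :: "'w measure" +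
  fixes W :: "real set \<Rightarrow> 'w \<Rightarrow> real"
  assumes gaussian:
      "A \<in> fin_borel \<Longrightarrow> centered_gaussian M (W A) (measure lborel A)"
    and independent:
      "range B \<subseteq> fin_borel \<Longrightarrow> disjoint_family B \<Longrightarrow>
        indep_vars (\<lambda>_. borel) (\<lambda>i::nat. W (B i)) UNIV"
    and additive:
      "range B \<subseteq> fin_borel \<Longrightarrow> disjoint_family B \<Longrightarrow> (\<Union>i. B i) \<in> fin_borel \<Longrightarrow>
        AE \<omega> in M. (\<lambda>i::nat. W (B i) \<omega>) sums W (\<Union>i. B i) \<omega>"

definition simple_data :: "nat \<Rightarrow> (nat \<Rightarrow> real set) \<Rightarrow> (nat \<Rightarrow> nat \<Rightarrow> real) \<Rightarrow> bool"
  where "simple_data n A a \<longleftrightarrow>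
    (\<forall>k<n. A k \<in> fin_borel) \<and> disjoint_family_on A {..<n} \<and>
    (\<forall>k<n. \<forall>j<n. a k j = a j k) \<and> (\<forall>k<n. a k k = 0)"

definition simple_fun2 ::
    "nat \<Rightarrow> (nat \<Rightarrow> real set) \<Rightarrow> (nat \<Rightarrow> nat \<Rightarrow> real) \<Rightarrow> real \<times> real \<Rightarrow> real"
  where "simple_fun2 n A a = (\<lambda>(x, y).
    \<Sum>k<n. \<Sum>j<n. a k j * indicator (A k) x * indicator (A j) y)"

definition simple_I2 ::
    "(real set \<Rightarrow> 'w \<Rightarrow> real) \<Rightarrow> nat \<Rightarrow> (nat \<Rightarrow> real set) \<Rightarrow> (nat \<Rightarrow> nat \<Rightarrow> real) \<Rightarrow> 'w \<Rightarrow> real"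
  where "simple_I2 W n A a \<omega> = (\<Sum>k<n. \<Sum>j<n. a k j * W (A k) \<omega> * W (A j) \<omega>)"

definition square_integrable :: "'a measure \<Rightarrow> ('a \<Rightarrow> real) \<Rightarrow> bool"
  where "square_integrable N f \<longleftrightarrow> f \<in> borel_measurable N \<and> integrable N (\<lambda>p. (f p)\<^sup>2)"

text \<open>Extension by continuity: \<open>Z\<close> is the \<open>L\<^sup>2\<close> limit of the integrals of simple functions that
  converge to \<open>f\<close> in \<open>L\<^sup>2\<close>. This determines \<open>Z\<close> up to almost sure equality.\<close>

definition has_I2 ::
    "'w measure \<Rightarrow> (real set \<Rightarrow> 'w \<Rightarrow> real) \<Rightarrow> (real \<times> real \<Rightarrow> real) \<Rightarrow> ('w \<Rightarrow> real) \<Rightarrow> bool"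
  where "has_I2 M W f Z \<longleftrightarrow>
    square_integrable (lborel \<Otimes>\<^sub>M lborel) f \<and> (\<forall>x y. f (x, y) = f (y, x)) \<and>
    square_integrable M Z \<and>
    (\<exists>n A a. (\<forall>m::nat. simple_data (n m) (A m) (a m)) \<and>
      (\<lambda>m. \<integral>\<^sup>+p. ennreal ((simple_fun2 (n m) (A m) (a m) p - f p)\<^sup>2) \<partial>(lborel \<Otimes>\<^sub>M lborel))
        \<longlonglongrightarrow> 0 \<and>
      (\<lambda>m. \<integral>\<^sup>+\<omega>. ennreal ((simple_I2 W (n m) (A m) (a m) \<omega> - Z \<omega>)\<^sup>2) \<partial>M) \<longlonglongrightarrow> 0)"

definition I2 ::
    "'w measure \<Rightarrow> (real set \<Rightarrow> 'w \<Rightarrow> real) \<Rightarrow> (real \<times> real \<Rightarrow> real) \<Rightarrow> 'w \<Rightarrow> real"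
  where "I2 M W f = (SOME Z. has_I2 M W f Z)"

definition pos_powr :: "real \<Rightarrow> real \<Rightarrow> real"
  where "pos_powr u a = (if u > 0 then u powr a else 0)"

definition rosenblatt_kernel :: "real \<Rightarrow> real \<Rightarrow> real \<Rightarrow> real \<Rightarrow> real \<Rightarrow> real"
  where "rosenblatt_kernel h1 h2 s x y =
    pos_powr (s - x) (h1 / 2 - 1) * pos_powr (s - y) (h2 / 2 - 1) +
    pos_powr (s - x) (h2 / 2 - 1) * pos_powr (s - y) (h1 / 2 - 1)"

text \<open>For \<open>h1, h2\<close> in \<open>(1/2, 1)\<close> the inner integral converges off the diagonal; on the diagonal,
  a null set, a divergent integral has the value 0 by the convention of the library.\<close>

definition gen_rosenblatt ::
    "'w measure \<Rightarrow> (real set \<Rightarrow> 'w \<Rightarrow> real) \<Rightarrow> real \<Rightarrow> real \<Rightarrow> real \<Rightarrow> 'w \<Rightarrow> real"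
  where "gen_rosenblatt M W h1 h2 t =
    I2 M W (\<lambda>(x, y). LBINT s:{0..t}. rosenblatt_kernel h1 h2 s x y)"

definition multifractional_rosenblatt ::
    "'w measure \<Rightarrow> (real set \<Rightarrow> 'w \<Rightarrow> real) \<Rightarrow> (real \<Rightarrow> real) \<Rightarrow> (real \<Rightarrow> real) \<Rightarrow> real \<Rightarrow> 'w \<Rightarrow> real"
  where "multifractional_rosenblatt M W H1 H2 t = gen_rosenblatt M W (H1 t) (H2 t) t"

definition version_on ::
    "'w measure \<Rightarrow> real set \<Rightarrow> (real \<Rightarrow> 'w \<Rightarrow> real) \<Rightarrow> (real \<Rightarrow> 'w \<Rightarrow> real) \<Rightarrow> bool"
  where "version_on M S Z X \<longleftrightarrow> (\<forall>t\<in>S. AE \<omega> in M. Z t \<omega> = X t \<omega>)"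

definition jointly_measurable_on :: "'w measure \<Rightarrow> real set \<Rightarrow> (real \<Rightarrow> 'w \<Rightarrow> real) \<Rightarrow> bool"
  where "jointly_measurable_on M S Z \<longleftrightarrow>
    (\<lambda>(t, \<omega>). Z t \<omega>) \<in> borel_measurable (restrict_space borel S \<Otimes>\<^sub>M M)"

text \<open>Separability in the sense of Doob.\<close>

definition separable_on :: "'w measure \<Rightarrow> real set \<Rightarrow> (real \<Rightarrow> 'w \<Rightarrow> real) \<Rightarrow> bool"
  where "separable_on M S Z \<longleftrightarrow>
    (\<exists>D. countable D \<and> D \<subseteq> S \<and> S \<subseteq> closure D \<and>
      (AE \<omega> in M. \<forall>a b F. closed F \<longrightarrow>
        (\<forall>t\<in>D \<inter> {a<..<b}. Z t \<omega> \<in> F) \<longrightarrow> (\<forall>t\<in>S \<inter> {a<..<b}. Z t \<omega> \<in> F)))"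

text \<open>For a path \<open>z\<close> that is Borel measurable on the Borel set \<open>A\<close>, the value at a Borel set \<open>B\<close>
  is the Lebesgue measure of the set of all \<open>s \<in> A\<close> with \<open>z s \<in> B\<close>.\<close>

definition occupation_measure :: "real set \<Rightarrow> (real \<Rightarrow> real) \<Rightarrow> real measure"
  where "occupation_measure A z = distr (restrict_space lborel A) borel z"

definition local_time :: "real set \<Rightarrow> (real \<Rightarrow> real) \<Rightarrow> real \<Rightarrow> ennreal"
  where "local_time A z = RN_deriv lborel (occupation_measure A z)"

text \<open>The derivative is determined, for each \<open>\<omega>\<close>, only up to a Lebesgue null set; membership in
  \<open>L\<^sup>2\<close> of the product refers to a jointly measurable choice of the densities.\<close>

definition has_square_integrable_local_time ::
    "'w measure \<Rightarrow> real set \<Rightarrow> (real \<Rightarrow> 'w \<Rightarrow> real) \<Rightarrow> bool"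
  where "has_square_integrable_local_time M A Z \<longleftrightarrow>
    (AE \<omega> in M. absolutely_continuous lborel (occupation_measure A (\<lambda>s. Z s \<omega>))) \<and>
    (\<exists>L. square_integrable (lborel \<Otimes>\<^sub>M M) L \<and> (\<forall>p. 0 \<le> L p) \<and>
      (AE \<omega> in M. AE x in lborel. local_time A (\<lambda>s. Z s \<omega>) x = ennreal (L (x, \<omega>))))"

end

theory Submission
  imports Defs
begin

text \<open>
  The local time is obtained by smoothing. Let \<open>p\<^sub>v\<close> be the centered Gaussian density of variance
  \<open>v\<close>. The convolution \<open>L\<^sub>e(x)\<close> of the occupation measure with \<open>p\<^sub>e\<close> is the integral of
  \<open>p\<^sub>e(x - X\<^sub>t)\<close> over \<open>t\<close> in \<open>[0,T]\<close>. Since \<open>p\<^sub>e\<close> and \<open>p\<^sub>d\<close> convolve to \<open>p\<^bsub>e+d\<^esub>\<close>, the inner product of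
  \<open>L\<^sub>e\<close> and \<open>L\<^sub>d\<close> in \<open>L\<^sup>2(\<real> \<times> \<Omega>)\<close> is \<open>\<Phi>(e + d)\<close>, where \<open>\<Phi>(v)\<close> integrates \<open>E p\<^sub>v(X\<^sub>t - X\<^sub>s)\<close> over
  \<open>[0,T]\<^sup>2\<close>. If \<open>\<Phi>\<close> has a finite limit at zero, then
  \<open>\<Phi>(2e) + \<Phi>(2d) - 2\<Phi>(e + d)\<close> tends to zero, so that \<open>L\<^sub>e\<close> converges in \<open>L\<^sup>2\<close>; along a subsequence
  the limit is, for almost every path, a density of the occupation measure
  (\<open>occupation_density\<close>). By Fourier inversion \<open>E p\<^sub>v(Y)\<close> is the integral of
  \<open>exp(-v z\<^sup>2/2) E exp(izY)\<close> over \<open>z\<close>, divided by \<open>2\<pi>\<close>. The limit of \<open>\<Phi>\<close> therefore exists as soon as the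
  characteristic function of \<open>X\<^sub>t - X\<^sub>s\<close> is at most \<open>(1 + (\<kappa> z (t-s)\<^sup>h)\<^sup>2)\<close> to the power \<open>-3/4\<close> with
  \<open>h < 1\<close>: the integral of this bound over \<open>z\<close> is of order \<open>(t-s)\<close> to the power \<open>-h\<close>, which is integrable
  on the square (\<open>local_time_of_char_decay\<close>).

  The decay comes from the noise in the interval \<open>(s,t)\<close>. For \<open>x, y\<close> in this interval the kernel of
  \<open>X\<^sub>s\<close> vanishes, because \<open>(u - x)\<^sub>+ = 0\<close> for \<open>u \<le> s\<close>, so that \<open>X\<^sub>t - X\<^sub>s\<close> has the kernel of \<open>X\<^sub>t\<close> there, with
  the parameters at the single time \<open>t\<close>. With \<open>H = (H\<^sub>1(t) + H\<^sub>2(t))/2\<close> this kernel blows up near the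
  diagonal like \<open>\<bar>x - y\<bar>\<close> to the power \<open>H - 1\<close>, while for \<open>\<bar>x - y\<bar> \<ge> (t-s)/8\<close> it is at most a
  multiple of \<open>(t-s)\<close> to the power \<open>H - 1\<close>. Take three pairs \<open>U\<^sub>r, V\<^sub>r\<close> of adjacent intervals of
  length \<open>\<theta>(t-s)\<close> with a small constant \<open>\<theta>\<close>, the pairs far from each other. The 3 by 3 matrix of the
  normalized integrals of the kernel over \<open>U\<^sub>r \<times> V\<^sub>q\<close> is then diagonally dominant, and it expands every vector by
  at least \<open>\<sigma> = \<theta>(t-s)\<^sup>H\<close> (\<open>rosenblatt_increment_char_bound\<close>).

  It remains to pass from such a matrix to the characteristic function. For a simple kernel the
  double integral is a quadratic form in independent Gaussian variables. Split them into a group \<open>x\<close>,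
  which contains the noise of the sets \<open>U\<^sub>r\<close>, and a group \<open>y\<close>, which contains the noise of the sets
  \<open>V\<^sub>r\<close>. By the Cauchy-Schwarz inequality,
  \<open>\<bar>E exp(izq(x,y))\<bar>\<^sup>2 \<le> E \<bar>E\<^sub>y exp(iz(q(x,y) - q(x',y)))\<bar>\<close> with an independent copy \<open>x'\<close> of \<open>x\<close>, and the
  exponent on the right is linear in \<open>y\<close> up to a term that is free of \<open>y\<close>. Two Gaussian integrations
  bound the right-hand side by \<open>(1 + 8z\<^sup>2\<sigma>\<^sup>2)\<close> to the power \<open>-3/2\<close>
  (\<open>quadratic_chaos_char_bound\<close>). The bound passes to \<open>L\<^sup>2\<close> limits of simple kernels
  (\<open>has_I2_diff_char_bound\<close>). Three pairs are the least number for which the resulting bound on the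
  characteristic function is integrable in \<open>z\<close>.

  Finally the double integrals have to exist. The kernel is the limit of its infima over the cells
  of finer and finer grids, taken away from the diagonal, because it is lower semicontinuous by Fatou's
  lemma. The limit holds in \<open>L\<^sup>2\<close> because the kernel is square integrable: by Tonelli's theorem its
  squared norm is controlled by the integral of \<open>\<bar>s - s'\<bar>\<close> to the power \<open>2H - 2\<close> over a square. The isometry
  and the completeness of \<open>L\<^sup>2\<close> then give the integral (\<open>has_I2_exists\<close>).
\<close>

section \<open>Centered Gaussian laws and their finite products\<close>

text \<open>As an image of the standard normal law this is meaningful for variance zero, where it is the
  point mass at the origin. Null sets carry this degenerate noise.\<close>

definition gauss :: "real \<Rightarrow> real measure"
  where "gauss v = distr std_normal_distribution borel (\<lambda>x. sqrt v * x)"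

lemma sets_gauss [simp, measurable_cong]: "sets (gauss v) = sets borel"
  by (simp add: gauss_def)

lemma space_gauss [simp]: "space (gauss v) = UNIV"
  by (simp add: gauss_def)

lemma prob_space_gauss: "prob_space (gauss v)"
  unfolding gauss_def by (intro prob_space.prob_space_distr prob_space_normal_density) auto

lemma gauss_char: "v \<ge> 0 \<Longrightarrow> (\<integral>x. iexp (c * x) \<partial>gauss v) = exp (- (v * c\<^sup>2 / 2))"
proof -
  assume v: "v \<ge> 0"
  have "(\<integral>x. iexp (c * x) \<partial>gauss v) = (\<integral>x. iexp (c * (sqrt v * x)) \<partial>std_normal_distribution)"
    unfolding gauss_def by (subst integral_distr) auto
  also have "\<dots> = char std_normal_distribution (c * sqrt v)"
    unfolding char_def by (simp add: ac_simps)
  also have "\<dots> = exp (- (v * c\<^sup>2 / 2))"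
    using v by (simp add: char_std_normal_distribution power_mult_distrib mult.commute[of v])
  finally show ?thesis .
qed

lemma integrable_gauss_power: "integrable (gauss v) (\<lambda>x. x ^ k)"
  unfolding gauss_def
  by (subst integrable_distr_eq)
     (auto simp: power_mult_distrib intro!: integrable_mult_right integrable_std_normal_distribution_moment)

lemma gauss_mean: "(\<integral>x. x \<partial>gauss v) = 0"
proof -
  have "(\<integral>x. x \<partial>gauss v) = (\<integral>x. sqrt v * x \<partial>std_normal_distribution)"
    unfolding gauss_def by (subst integral_distr) auto
  also have "\<dots> = 0"
    using integral_std_normal_distribution_moment_odd[of 1] by simp
  finally show ?thesis .
qed

lemma gauss_variance: "v \<ge> 0 \<Longrightarrow> (\<integral>x. x\<^sup>2 \<partial>gauss v) = v"
proof -
  assume v: "v \<ge> 0"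
  have "(\<integral>x. x\<^sup>2 \<partial>gauss v) = (\<integral>x. v * x\<^sup>2 \<partial>std_normal_distribution)"
    unfolding gauss_def using v by (subst integral_distr) (auto simp: power_mult_distrib)
  also have "\<dots> = v"
    using std_normal_distribution_even_moments[of 1] by (simp add: fact_numeral)
  finally show ?thesis .
qed

text \<open>The integrand times the standard normal density is a multiple of the normal density of variance
  \<open>1 / (1 + 2c)\<close>.\<close>

lemma gauss_exp_neg_square:
  assumes "c \<ge> 0"
  shows "(\<integral>x. exp (- (c * x\<^sup>2)) \<partial>gauss 1) = (1 + 2 * c) powr (- (1 / 2))"
proof -
  define s where "s = 1 / sqrt (1 + 2 * c)"
  have s: "s > 0" "s\<^sup>2 = 1 / (1 + 2 * c)" using assms by (auto simp: s_def power_divide)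
  have "(\<integral>x. exp (- (c * x\<^sup>2)) \<partial>gauss 1) = (\<integral>x. exp (- (c * x\<^sup>2)) \<partial>std_normal_distribution)"
    unfolding gauss_def by (subst integral_distr) auto
  also have "\<dots> = (\<integral>x. std_normal_density x * exp (- (c * x\<^sup>2)) \<partial>lborel)"
    by (subst integral_density) auto
  also have "\<dots> = (\<integral>x. s * normal_density 0 s x \<partial>lborel)"
  proof (rule Bochner_Integration.integral_cong[OF refl])
    fix x :: real
    have "sqrt (2 * pi * s\<^sup>2) = sqrt (2 * pi) * s" using s(1) by (simp add: real_sqrt_mult)
    moreover have "x\<^sup>2 / (2 * s\<^sup>2) = x\<^sup>2 / 2 + c * x\<^sup>2" using assms by (simp add: s(2) field_simps)
    ultimately show "std_normal_density x * exp (- (c * x\<^sup>2)) = s * normal_density 0 s x"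
      using s(1) by (simp add: normal_density_def mult_exp_exp)
  qed
  also have "\<dots> = s" using s(1) integral_normal_density[of s 0] by simp
  also have "\<dots> = (1 + 2 * c) powr (- (1 / 2))"
    unfolding s_def powr_minus_divide using assms by (simp add: powr_half_sqrt)
  finally show ?thesis .
qed

lemma gauss_density: "v > 0 \<Longrightarrow> gauss v = density lborel (normal_density 0 (sqrt v))"
proof -
  assume v: "v > 0"
  interpret S: prob_space std_normal_distribution by (rule prob_space_normal_density) simp
  have "distributed std_normal_distribution lborel (\<lambda>x. x) std_normal_density"
    unfolding distributed_def by (auto intro!: measure_eqI simp: emeasure_distr)
  from S.normal_density_affine[OF this, of "sqrt v" 0] v
  have "distributed std_normal_distribution lborel (\<lambda>x. sqrt v * x) (normal_density 0 (sqrt v))" by simp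
  then have "distr std_normal_distribution lborel (\<lambda>x. sqrt v * x) = density lborel (normal_density 0 (sqrt v))"
    by (simp add: distributed_def)
  moreover have "gauss v = distr std_normal_distribution lborel (\<lambda>x. sqrt v * x)"
    unfolding gauss_def by (intro distr_cong) auto
  ultimately show ?thesis by simp
qed

abbreviation gaussP :: "('i \<Rightarrow> real) \<Rightarrow> 'i set \<Rightarrow> ('i \<Rightarrow> real) measure"
  where "gaussP v I \<equiv> Pi\<^sub>M I (\<lambda>i. gauss (v i))"

lemma product_prob_space_gauss: "product_prob_space (\<lambda>i. gauss (v i))"
  by (intro product_prob_space.intro product_prob_space_axioms.intro product_sigma_finite.intro
       prob_space_imp_sigma_finite prob_space_gauss)

lemma prob_space_gaussP: "prob_space (gaussP v I)"
  by (intro prob_space_PiM prob_space_gauss)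

lemma gaussP_char:
  assumes "finite I" "\<And>i. i \<in> I \<Longrightarrow> v i \<ge> 0"
  shows "(\<integral>x. iexp (\<Sum>i\<in>I. c i * x i) \<partial>gaussP v I) = exp (- ((\<Sum>i\<in>I. v i * (c i)\<^sup>2) / 2))"
proof -
  interpret product_prob_space "\<lambda>i. gauss (v i)" by (rule product_prob_space_gauss)
  have "(\<integral>x. iexp (\<Sum>i\<in>I. c i * x i) \<partial>gaussP v I) = (\<integral>x. (\<Prod>i\<in>I. iexp (c i * x i)) \<partial>gaussP v I)"
    using assms(1) by (simp add: sum_distrib_left exp_sum)
  also have "\<dots> = (\<Prod>i\<in>I. \<integral>x. iexp (c i * x) \<partial>gauss (v i))"
    using prob_space_gauss by (intro product_integral_prod assms(1))
      (auto intro!: finite_measure.integrable_const_bound[where B=1] prob_space.finite_measure)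
  also have "\<dots> = (\<Prod>i\<in>I. complex_of_real (exp (- (v i * (c i)\<^sup>2 / 2))))"
    by (intro prod.cong refl gauss_char assms)
  also have "\<dots> = exp (- ((\<Sum>i\<in>I. v i * (c i)\<^sup>2) / 2))"
    using assms(1) by (simp add: exp_sum[symmetric] sum_negf sum_divide_distrib flip: of_real_prod)
  finally show ?thesis .
qed

lemma gaussP_exp_neg_square:
  assumes "finite I" "c \<ge> 0"
  shows "(\<integral>x. exp (- (c * (\<Sum>i\<in>I. (x i)\<^sup>2))) \<partial>gaussP (\<lambda>_. 1) I) = (1 + 2 * c) powr (- (real (card I) / 2))"
proof -
  interpret product_prob_space "\<lambda>i::'a. gauss 1" by (rule product_prob_space_gauss)
  have "(\<integral>x. exp (- (c * (\<Sum>i\<in>I. (x i)\<^sup>2))) \<partial>gaussP (\<lambda>_. 1) I)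
      = (\<integral>x. (\<Prod>i\<in>I. exp (- (c * (x i)\<^sup>2))) \<partial>gaussP (\<lambda>_. 1) I)"
    using assms(1) by (simp add: sum_distrib_left exp_sum[symmetric] sum_negf)
  also have "\<dots> = (\<Prod>i\<in>I. \<integral>x. exp (- (c * x\<^sup>2)) \<partial>gauss 1)"
    using prob_space_gauss assms(2) by (intro product_integral_prod assms(1))
      (auto intro!: finite_measure.integrable_const_bound[where B=1] prob_space.finite_measure)
  also have "\<dots> = (1 + 2 * c) powr (- (real (card I) / 2))"
  proof -
    have "(\<Prod>i\<in>I. \<integral>x. exp (- (c * x\<^sup>2)) \<partial>gauss 1) = ((1 + 2 * c) powr (- (1 / 2))) ^ card I"
      using assms(2) by (simp add: gauss_exp_neg_square)
    also have "\<dots> = ((1 + 2 * c) powr (- (1 / 2))) powr real (card I)"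
      using assms(2) by (subst powr_realpow) auto
    finally show ?thesis by (simp add: powr_powr)
  qed
  finally show ?thesis .
qed

text \<open>The monomial has exponent at most two in each coordinate, because \<open>i \<noteq> j\<close> and \<open>k \<noteq> l\<close>. If the two
  pairs differ as sets, then some coordinate has exponent one and its mean kills the product.\<close>

lemma gaussP_fourth_moment:
  assumes I: "finite I" "i \<in> I" "j \<in> I" "k \<in> I" "l \<in> I" "i \<noteq> j" "k \<noteq> l"
    and v: "\<And>i. i \<in> I \<Longrightarrow> v i \<ge> 0"
  shows "integrable (gaussP v I) (\<lambda>x. x i * x j * x k * x l)" (is ?int)
    and "(\<integral>x. x i * x j * x k * x l \<partial>gaussP v I) =
      v i * v j * (of_bool (k = i \<and> l = j) + of_bool (k = j \<and> l = i))" (is ?eq)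
proof -
  interpret product_prob_space "\<lambda>i. gauss (v i)" by (rule product_prob_space_gauss)
  \<comment> \<open>the exponents of the monomial\<close>
  define e :: "'a \<Rightarrow> nat" where
    "e m = of_bool (m = i) + of_bool (m = j) + of_bool (m = k) + of_bool (m = l)" for m
  have delta: "(\<Prod>m\<in>I. x m ^ of_bool (m = a)) = x a" if "a \<in> I" for a and x :: "'a \<Rightarrow> real"
  proof -
    have "(\<Prod>m\<in>I. x m ^ of_bool (m = a)) = (\<Prod>m\<in>I. if m = a then x m else 1)"
      by (intro prod.cong) auto
    also have "\<dots> = x a" using that I(1) by simp
    finally show ?thesis .
  qed
  have mon: "x i * x j * x k * x l = (\<Prod>m\<in>I. x m ^ e m)" for x :: "'a \<Rightarrow> real"
    unfolding e_def power_add prod.distrib using I by (simp add: delta)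
  show ?int unfolding mon by (intro product_integrable_prod I(1) integrable_gauss_power)
  have "(\<integral>x. x i * x j * x k * x l \<partial>gaussP v I) = (\<Prod>m\<in>I. \<integral>x. x ^ e m \<partial>gauss (v m))"
    unfolding mon by (intro product_integral_prod I(1) integrable_gauss_power)
  also have "\<dots> = v i * v j * (of_bool (k = i \<and> l = j) + of_bool (k = j \<and> l = i))"
  proof (cases "(k = i \<and> l = j) \<or> (k = j \<and> l = i)")
    case True
    then have e: "e m = (if m = i then 2 else if m = j then 2 else 0)" for m
      using I(6,7) by (auto simp: e_def)
    have "(\<integral>x. x ^ e m \<partial>gauss (v m)) = (if m = i then v i else 1) * (if m = j then v j else 1)"
      if "m \<in> I" for m
      using v[OF that] I(6) prob_space.prob_space[OF prob_space_gauss[of "v m"]]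
      by (auto simp: e gauss_variance)
    then have "(\<Prod>m\<in>I. \<integral>x. x ^ e m \<partial>gauss (v m)) = v i * v j"
      using I by (simp add: prod.distrib)
    moreover have "of_bool (k = i \<and> l = j) + of_bool (k = j \<and> l = i) = (1::real)"
      using True I(6) by (cases "k = i") simp_all
    ultimately show ?thesis by simp
  next
    case False
    then have "(i \<noteq> k \<and> i \<noteq> l) \<or> (j \<noteq> k \<and> j \<noteq> l)" using I(6,7) by metis
    then have "e i = 1 \<or> e j = 1" using I(6) by (auto simp: e_def)
    then obtain m where "m \<in> I" "(\<integral>x. x ^ e m \<partial>gauss (v m)) = 0"
      using I(2,3) by (auto simp: gauss_mean)
    then have zero: "(\<Prod>m\<in>I. \<integral>x. x ^ e m \<partial>gauss (v m)) = 0"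
      using I(1) by (intro prod_zero) auto
    have "of_bool (k = i \<and> l = j) = (0::real)" "of_bool (k = j \<and> l = i) = (0::real)"
      using False unfolding of_bool_eq_0_iff by blast+
    then have "of_bool (k = i \<and> l = j) + of_bool (k = j \<and> l = i) = (0::real)" by linarith
    then show ?thesis unfolding zero by (simp only: mult_zero_right)
  qed
  finally show ?eq .
qed

text \<open>Without diagonal the monomials \<open>x\<^sub>i x\<^sub>j\<close> are orthogonal, and each of them occurs twice by symmetry;
  this gives the factor two of the isometry.\<close>

lemma quadratic_second_moment:
  assumes I: "finite I" and v: "\<And>i. i \<in> I \<Longrightarrow> v i \<ge> 0"
    and diag: "\<And>i. i \<in> I \<Longrightarrow> b i i = 0"
    and sym: "\<And>i j. i \<in> I \<Longrightarrow> j \<in> I \<Longrightarrow> b i j = b j i"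
  shows "integrable (gaussP v I) (\<lambda>x. (\<Sum>i\<in>I. \<Sum>j\<in>I. b i j * x i * x j)\<^sup>2)"
    and "(\<integral>x. (\<Sum>i\<in>I. \<Sum>j\<in>I. b i j * x i * x j)\<^sup>2 \<partial>gaussP v I) =
      2 * (\<Sum>i\<in>I. \<Sum>j\<in>I. (b i j)\<^sup>2 * v i * v j)"
proof -
  have ex: "(\<Sum>i\<in>I. \<Sum>j\<in>I. b i j * x i * x j)\<^sup>2 =
      (\<Sum>i\<in>I. \<Sum>j\<in>I. \<Sum>k\<in>I. \<Sum>l\<in>I. (b i j * b k l) * (x i * x j * x k * x l))" for x :: "'a \<Rightarrow> real"
    by (simp only: power2_eq_square sum_distrib_right) (simp only: sum_distrib_left ac_simps)
  have int: "integrable (gaussP v I) (\<lambda>x. (b i j * b k l) * (x i * x j * x k * x l))"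
    if "i \<in> I" "j \<in> I" "k \<in> I" "l \<in> I" for i j k l
  proof (cases "i = j \<or> k = l")
    case True then show ?thesis using diag that by auto
  next
    case False then show ?thesis using that I v by (intro integrable_mult_right gaussP_fourth_moment) auto
  qed
  show "integrable (gaussP v I) (\<lambda>x. (\<Sum>i\<in>I. \<Sum>j\<in>I. b i j * x i * x j)\<^sup>2)"
    unfolding ex by (intro Bochner_Integration.integrable_sum int)
  have val: "(\<integral>x. (b i j * b k l) * (x i * x j * x k * x l) \<partial>gaussP v I) =
      (if l = j then if k = i then (b i j)\<^sup>2 * v i * v j else 0 else 0) +
      (if l = i then if k = j then (b i j)\<^sup>2 * v i * v j else 0 else 0)"
    if "i \<in> I" "j \<in> I" "k \<in> I" "l \<in> I" for i j k l
  proof (cases "i = j \<or> k = l")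
    case True then show ?thesis using diag that by auto
  next
    case False then show ?thesis using that I v sym[of j i]
      by (auto simp: gaussP_fourth_moment power2_eq_square)
  qed
  have "(\<integral>x. (\<Sum>i\<in>I. \<Sum>j\<in>I. b i j * x i * x j)\<^sup>2 \<partial>gaussP v I) =
    (\<Sum>i\<in>I. \<Sum>j\<in>I. \<Sum>k\<in>I. \<Sum>l\<in>I. \<integral>x. (b i j * b k l) * (x i * x j * x k * x l) \<partial>gaussP v I)"
    unfolding ex
    by (intro has_bochner_integral_integral_eq has_bochner_integral_sum has_bochner_integral_integrable int)
  also have "\<dots> = (\<Sum>i\<in>I. \<Sum>j\<in>I. 2 * ((b i j)\<^sup>2 * v i * v j))"
    by (intro sum.cong refl) (simp add: val sum.distrib I del: integral_mult_right_zero)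
  also have "\<dots> = 2 * (\<Sum>i\<in>I. \<Sum>j\<in>I. (b i j)\<^sup>2 * v i * v j)"
    by (simp add: sum_distrib_left)
  finally show "(\<integral>x. (\<Sum>i\<in>I. \<Sum>j\<in>I. b i j * x i * x j)\<^sup>2 \<partial>gaussP v I) =
      2 * (\<Sum>i\<in>I. \<Sum>j\<in>I. (b i j)\<^sup>2 * v i * v j)" .
qed

section \<open>Decoupling\<close>

lemma (in prob_space) integrable_cmod_le_1:
  fixes f :: "'a \<Rightarrow> complex"
  assumes "f \<in> borel_measurable M" "\<And>x. x \<in> space M \<Longrightarrow> cmod (f x) \<le> 1"
  shows "integrable M f"
  using assms by (intro integrable_const_bound[where B=1]) auto

lemma (in prob_space) cmod_integral_le_1:
  fixes f :: "'a \<Rightarrow> complex"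
  assumes "\<And>x. x \<in> space M \<Longrightarrow> cmod (f x) \<le> 1"
  shows "cmod (\<integral>x. f x \<partial>M) \<le> 1"
proof (cases "integrable M f")
  case True
  have "cmod (\<integral>x. f x \<partial>M) \<le> (\<integral>x. cmod (f x) \<partial>M)" by simp
  also have "\<dots> \<le> (\<integral>x. 1 \<partial>M)" using True assms by (intro integral_mono) auto
  finally show ?thesis by (simp add: prob_space)
qed (simp add: not_integrable_integral_eq)

text \<open>The factors \<open>\<alpha>\<close> and \<open>\<beta>\<close> depend on one variable only and are arbitrary. The factor \<open>\<beta>\<close> disappears when the
  Cauchy-Schwarz inequality is applied in \<open>y\<close>; the square of the inner integral is then written with two
  copies of \<open>x\<close>, and \<open>\<alpha>\<close> disappears when the order of integration is exchanged. In the application they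
  carry the quadratic terms within each group, and \<open>k\<close> carries the mixed terms.\<close>

lemma decoupling:
  fixes A :: "'a measure" and B :: "'b measure" and k :: "'a \<times> 'b \<Rightarrow> complex"
  assumes "prob_space A" "prob_space B"
    and [measurable]: "\<alpha> \<in> borel_measurable A" "\<beta> \<in> borel_measurable B" "k \<in> borel_measurable (A \<Otimes>\<^sub>M B)"
    and bd: "\<And>x. cmod (\<alpha> x) \<le> 1" "\<And>y. cmod (\<beta> y) \<le> 1" "\<And>p. cmod (k p) \<le> 1"
  shows "(cmod (\<integral>x. \<integral>y. \<alpha> x * \<beta> y * k (x, y) \<partial>B \<partial>A))\<^sup>2
    \<le> (\<integral>p. cmod (\<integral>y. k (fst p, y) * cnj (k (snd p, y)) \<partial>B) \<partial>(A \<Otimes>\<^sub>M A))"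
proof -
  interpret A: prob_space A by fact
  interpret B: prob_space B by fact
  interpret AB: pair_prob_space A B ..
  interpret AA: pair_prob_space A A ..
  interpret AAB: pair_prob_space "A \<Otimes>\<^sub>M A" B ..
  have [measurable]: "cnj \<in> borel_measurable borel"
    by (intro borel_measurable_continuous_onI continuous_intros)
  define g where "g y = (\<integral>x. \<alpha> x * k (x, y) \<partial>A)" for y
  have [measurable]: "g \<in> borel_measurable B" unfolding g_def by measurable
  have m1: "cmod (a * b) \<le> 1" if "cmod a \<le> 1" "cmod b \<le> 1" for a b
    using that by (simp add: norm_mult mult_le_one)
  have g1: "cmod (g y) \<le> 1" for y
    unfolding g_def by (intro A.cmod_integral_le_1 m1 bd)
  define h where "h y = cmod (g y)" for y
  have [measurable]: "h \<in> borel_measurable B" unfolding h_def by measurable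
  have h1: "\<bar>h y\<bar> \<le> 1" for y using g1 by (simp add: h_def)
  have "(\<integral>x. \<integral>y. \<alpha> x * \<beta> y * k (x, y) \<partial>B \<partial>A) = (\<integral>y. \<integral>x. \<alpha> x * \<beta> y * k (x, y) \<partial>A \<partial>B)"
    by (intro AB.Fubini_integral[symmetric] AB.P.integrable_cmod_le_1)
       (auto simp: case_prod_beta intro!: m1 bd)
  also have "\<dots> = (\<integral>y. \<beta> y * g y \<partial>B)"
  proof (intro Bochner_Integration.integral_cong refl)
    fix y
    have "(\<integral>x. \<alpha> x * \<beta> y * k (x, y) \<partial>A) = (\<integral>x. \<beta> y * (\<alpha> x * k (x, y)) \<partial>A)"
      by (intro Bochner_Integration.integral_cong refl) (simp add: ac_simps)
    then show "(\<integral>x. \<alpha> x * \<beta> y * k (x, y) \<partial>A) = \<beta> y * g y" by (simp add: g_def)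
  qed
  finally have "cmod (\<integral>x. \<integral>y. \<alpha> x * \<beta> y * k (x, y) \<partial>B \<partial>A) \<le> (\<integral>y. cmod (\<beta> y * g y) \<partial>B)"
    by simp
  also have "\<dots> \<le> (\<integral>y. h y \<partial>B)"
  proof (intro integral_mono)
    show "integrable B (\<lambda>y. cmod (\<beta> y * g y))"
      by (intro integrable_norm B.integrable_cmod_le_1 m1 bd g1) measurable
    show "integrable B h"
      unfolding h_def by (intro integrable_norm B.integrable_cmod_le_1 g1) measurable
    show "cmod (\<beta> y * g y) \<le> h y" for y
      using bd(2)[of y] by (simp add: norm_mult h_def mult_left_le_one_le)
  qed
  finally have "(cmod (\<integral>x. \<integral>y. \<alpha> x * \<beta> y * k (x, y) \<partial>B \<partial>A))\<^sup>2 \<le> (\<integral>y. h y \<partial>B)\<^sup>2"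
    by (intro power_mono) auto
  also have "\<dots> \<le> (\<integral>y. (h y)\<^sup>2 \<partial>B)"
  proof -
    have i: "integrable B h" "integrable B (\<lambda>y. (h y)\<^sup>2)"
      using h1 by (auto intro!: B.integrable_const_bound[where B=1] simp: abs_square_le_1)
    show ?thesis using B.variance_eq[OF i] B.variance_positive[of h] by simp
  qed
  also have "\<dots> = Re (\<integral>y. g y * cnj (g y) \<partial>B)"
  proof -
    have "(\<integral>y. g y * cnj (g y) \<partial>B) = (\<integral>y. complex_of_real ((h y)\<^sup>2) \<partial>B)"
      by (simp only: h_def complex_norm_square)
    then show ?thesis by (simp del: of_real_power)
  qed
  also have "(\<integral>y. g y * cnj (g y) \<partial>B) =
    (\<integral>y. (\<integral>p. \<alpha> (fst p) * cnj (\<alpha> (snd p)) * (k (fst p, y) * cnj (k (snd p, y))) \<partial>(A \<Otimes>\<^sub>M A)) \<partial>B)"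
  proof (intro Bochner_Integration.integral_cong refl)
    fix y assume [measurable]: "y \<in> space B"
    have "(\<integral>p. \<alpha> (fst p) * cnj (\<alpha> (snd p)) * (k (fst p, y) * cnj (k (snd p, y))) \<partial>(A \<Otimes>\<^sub>M A))
       = (\<integral>x. \<integral>x'. \<alpha> x * cnj (\<alpha> x') * (k (x, y) * cnj (k (x', y))) \<partial>A \<partial>A)"
      by (subst AA.integral_fst'[symmetric])
        (auto intro!: AA.P.integrable_cmod_le_1 m1 bd simp: complex_mod_cnj bd)
    also have "\<dots> = (\<integral>x. \<integral>x'. (\<alpha> x * k (x, y)) * cnj (\<alpha> x' * k (x', y)) \<partial>A \<partial>A)"
      by (intro Bochner_Integration.integral_cong refl) (simp add: ac_simps)
    also have "\<dots> = g y * cnj (g y)"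
      unfolding g_def by (simp del: complex_cnj_mult)
    finally show "g y * cnj (g y) =
      (\<integral>p. \<alpha> (fst p) * cnj (\<alpha> (snd p)) * (k (fst p, y) * cnj (k (snd p, y))) \<partial>(A \<Otimes>\<^sub>M A))" by simp
  qed
  also have "\<dots> = (\<integral>p. (\<integral>y. \<alpha> (fst p) * cnj (\<alpha> (snd p)) * (k (fst p, y) * cnj (k (snd p, y))) \<partial>B) \<partial>(A \<Otimes>\<^sub>M A))"
    by (intro AAB.Fubini_integral AAB.P.integrable_cmod_le_1)
       (auto simp: case_prod_beta complex_mod_cnj intro!: m1 bd)
  also have "Re \<dots> \<le> cmod \<dots>" by (rule complex_Re_le_cmod)
  also have "\<dots> \<le> (\<integral>p. cmod (\<integral>y. \<alpha> (fst p) * cnj (\<alpha> (snd p)) * (k (fst p, y) * cnj (k (snd p, y))) \<partial>B) \<partial>(A \<Otimes>\<^sub>M A))"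
    by simp
  also have "\<dots> \<le> (\<integral>p. cmod (\<integral>y. k (fst p, y) * cnj (k (snd p, y)) \<partial>B) \<partial>(A \<Otimes>\<^sub>M A))"
  proof (intro integral_mono integrable_norm AA.P.integrable_cmod_le_1)
    fix p
    show "cmod (\<integral>y. \<alpha> (fst p) * cnj (\<alpha> (snd p)) * (k (fst p, y) * cnj (k (snd p, y))) \<partial>B)
       \<le> cmod (\<integral>y. k (fst p, y) * cnj (k (snd p, y)) \<partial>B)"
      using m1[OF bd(1)[of "fst p"], of "cnj (\<alpha> (snd p))"] bd(1)[of "snd p"]
      by (simp add: norm_mult mult_left_le_one_le)
  qed (auto intro!: B.cmod_integral_le_1 m1 bd simp: complex_mod_cnj bd)
  finally show ?thesis .
qed

section \<open>The characteristic function of a quadratic chaos\<close>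

lemma sum_square_le_weighted:
  fixes v h :: "'i \<Rightarrow> real"
  assumes "\<And>j. j \<in> J \<Longrightarrow> v j \<ge> 0"
  shows "(\<Sum>j\<in>J. v j * h j)\<^sup>2 \<le> (\<Sum>j\<in>J. v j) * (\<Sum>j\<in>J. v j * (h j)\<^sup>2)"
proof -
  have "(\<Sum>j\<in>J. v j * h j) = (\<Sum>j\<in>J. sqrt (v j) * (sqrt (v j) * h j))"
    using assms by (intro sum.cong) (auto simp: mult.assoc[symmetric])
  also have "\<dots>\<^sup>2 \<le> (\<Sum>j\<in>J. (sqrt (v j))\<^sup>2) * (\<Sum>j\<in>J. (sqrt (v j) * h j)\<^sup>2)"
    by (rule Cauchy_Schwarz_ineq_sum)
  also have "\<dots> = (\<Sum>j\<in>J. v j) * (\<Sum>j\<in>J. v j * (h j)\<^sup>2)"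
    using assms by (intro arg_cong2[where f="(*)"] sum.cong) (auto simp: power_mult_distrib)
  finally show ?thesis .
qed

text \<open>Bessel's inequality for the orthogonal family of indicators of the blocks \<open>S r\<close>: the projection to
  the functions that are constant on blocks does not increase the weighted norm.\<close>

lemma sum_blocks_square_le:
  fixes v h :: "'i \<Rightarrow> real"
  assumes "finite J" "finite R" and v: "\<And>j. j \<in> J \<Longrightarrow> v j \<ge> 0"
    and S: "\<And>r. r \<in> R \<Longrightarrow> S r \<subseteq> J" "disjoint_family_on S R"
    and len: "\<And>r. r \<in> R \<Longrightarrow> (\<Sum>j\<in>S r. v j) = \<rho>" and \<rho>: "\<rho> > 0"
  shows "(\<Sum>r\<in>R. (\<Sum>j\<in>S r. v j * h j)\<^sup>2) / \<rho> \<le> (\<Sum>j\<in>J. v j * (h j)\<^sup>2)"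
proof -
  have "(\<Sum>j\<in>S r. v j * h j)\<^sup>2 / \<rho> \<le> (\<Sum>j\<in>S r. v j * (h j)\<^sup>2)" if "r \<in> R" for r
    using sum_square_le_weighted[of "S r" v h] v S(1)[OF that] len[OF that] \<rho>
    by (auto simp: field_simps subset_iff)
  then have "(\<Sum>r\<in>R. (\<Sum>j\<in>S r. v j * h j)\<^sup>2) / \<rho> \<le> (\<Sum>r\<in>R. \<Sum>j\<in>S r. v j * (h j)\<^sup>2)"
    unfolding sum_divide_distrib by (intro sum_mono) auto
  also have "\<dots> = (\<Sum>j\<in>(\<Union>r\<in>R. S r). v j * (h j)\<^sup>2)"
    using assms(1,2) S by (intro sum.UNION_disjoint[symmetric])
      (auto simp: disjoint_family_on_def intro: finite_subset)
  also have "\<dots> \<le> (\<Sum>j\<in>J. v j * (h j)\<^sup>2)"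
    using assms(1) S v by (intro sum_mono2) auto
  finally show ?thesis .
qed

text \<open>The variables are indexed by cells with measures \<open>v\<close>. After decoupling, the integral over \<open>y\<close> is the
  characteristic function of a linear form, and it leaves the Gaussian function of the vector
  \<open>h p\<close>, which is linear in \<open>x - x'\<close>. Its norm is bounded below by the projection to the
  blocks \<open>V q\<close>. An auxiliary Gaussian vector \<open>\<eta>\<close> turns the exponential of this square back into an
  exponential of a linear form in \<open>x - x'\<close>, whose integral is again explicit; the projection to the blocks
  \<open>U r\<close> produces the matrix, and the final integral over \<open>\<eta>\<close> produces the power.\<close>

lemma quadratic_chaos_char_bound:
  fixes b :: "'i \<Rightarrow> 'i \<Rightarrow> real" and U V :: "'r \<Rightarrow> 'i set"
  assumes P: "finite P" and Q: "finite Q" and PQ: "P \<inter> Q = {}" and R: "finite R"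
    and v: "\<And>i. i \<in> P \<union> Q \<Longrightarrow> v i \<ge> 0"
    and sym: "\<And>i j. i \<in> P \<union> Q \<Longrightarrow> j \<in> P \<union> Q \<Longrightarrow> b i j = b j i"
    and U: "\<And>r. r \<in> R \<Longrightarrow> U r \<subseteq> P" "disjoint_family_on U R"
      "\<And>r. r \<in> R \<Longrightarrow> (\<Sum>i\<in>U r. v i) = \<rho>"
    and V: "\<And>r. r \<in> R \<Longrightarrow> V r \<subseteq> Q" "disjoint_family_on V R"
      "\<And>r. r \<in> R \<Longrightarrow> (\<Sum>i\<in>V r. v i) = \<rho>"
    and \<rho>: "\<rho> > 0"
    and nondeg: "\<And>\<eta>. (\<Sum>r\<in>R. (\<Sum>q\<in>R. (\<Sum>i\<in>U r. \<Sum>j\<in>V q. b i j * v i * v j) / \<rho> * \<eta> q)\<^sup>2)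
        \<ge> \<sigma>\<^sup>2 * (\<Sum>q\<in>R. (\<eta> q)\<^sup>2)"
  shows "(cmod (\<integral>x. iexp (z * (\<Sum>i\<in>P\<union>Q. \<Sum>j\<in>P\<union>Q. b i j * x i * x j)) \<partial>gaussP v (P \<union> Q)))\<^sup>2
    \<le> (1 + 8 * z\<^sup>2 * \<sigma>\<^sup>2) powr (- (real (card R) / 2))"
proof -
  interpret G: product_prob_space "\<lambda>i. gauss (v i)" by (rule product_prob_space_gauss)
  let ?A = "gaussP v P" and ?B = "gaussP v Q" and ?N = "gaussP (\<lambda>_. 1) R"
  interpret PQ: prob_space "gaussP v (P \<union> Q)" by (rule prob_space_gaussP)
  interpret A: prob_space ?A by (rule prob_space_gaussP)
  interpret B: prob_space ?B by (rule prob_space_gaussP)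
  interpret N: prob_space ?N by (rule prob_space_gaussP)
  interpret AA: pair_prob_space ?A ?A ..
  interpret AN: pair_prob_space "?A \<Otimes>\<^sub>M ?A" ?N ..
  define q1 where "q1 x = (\<Sum>i\<in>P. \<Sum>j\<in>P. b i j * x i * x j)" for x :: "'i \<Rightarrow> real"
  define q2 where "q2 y = (\<Sum>i\<in>Q. \<Sum>j\<in>Q. b i j * y i * y j)" for y :: "'i \<Rightarrow> real"
  define h where "h p j = (\<Sum>i\<in>P. (fst p i - snd p i) * b i j)" for p :: "('i \<Rightarrow> real) \<times> ('i \<Rightarrow> real)" and j
  define k where "k p = iexp (2 * z * (\<Sum>i\<in>P. \<Sum>j\<in>Q. b i j * fst p i * snd p j))"
    for p :: "('i \<Rightarrow> real) \<times> ('i \<Rightarrow> real)"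
  have [measurable]: "q1 \<in> borel_measurable ?A" "q2 \<in> borel_measurable ?B"
    unfolding q1_def q2_def by measurable
  have [measurable]: "k \<in> borel_measurable (?A \<Otimes>\<^sub>M ?B)" unfolding k_def by measurable
  have split: "(\<Sum>i\<in>P\<union>Q. \<Sum>j\<in>P\<union>Q. b i j * merge P Q (x, y) i * merge P Q (x, y) j)
      = q1 x + q2 y + 2 * (\<Sum>i\<in>P. \<Sum>j\<in>Q. b i j * x i * y j)" for x y
  proof -
    have m: "merge P Q (x, y) i = x i" if "i \<in> P" for i using that by (simp add: merge_def)
    have m': "merge P Q (x, y) i = y i" if "i \<in> Q" for i using that PQ by (auto simp: merge_def)
    have "(\<Sum>i\<in>P\<union>Q. \<Sum>j\<in>P\<union>Q. b i j * merge P Q (x, y) i * merge P Q (x, y) j)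
      = q1 x + (\<Sum>i\<in>P. \<Sum>j\<in>Q. b i j * x i * y j) + ((\<Sum>i\<in>Q. \<Sum>j\<in>P. b i j * y i * x j) + q2 y)"
      using P Q PQ by (simp add: sum.union_disjoint sum.distrib q1_def q2_def m m' cong: sum.cong)
    also have "(\<Sum>i\<in>Q. \<Sum>j\<in>P. b i j * y i * x j) = (\<Sum>i\<in>P. \<Sum>j\<in>Q. b i j * x i * y j)"
      by (subst sum.swap) (auto intro!: sum.cong simp: sym)
    finally show ?thesis by simp
  qed
  have "(\<integral>x. iexp (z * (\<Sum>i\<in>P\<union>Q. \<Sum>j\<in>P\<union>Q. b i j * x i * x j)) \<partial>gaussP v (P \<union> Q))
     = (\<integral>x. \<integral>y. iexp (z * (q1 x + q2 y + 2 * (\<Sum>i\<in>P. \<Sum>j\<in>Q. b i j * x i * y j))) \<partial>?B \<partial>?A)"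
    by (subst G.product_integral_fold[OF PQ P Q], rule PQ.integrable_cmod_le_1, measurable)
      (simp_all only: split norm_exp_i_times order_refl)
  also have "\<dots> = (\<integral>x. \<integral>y. iexp (z * q1 x) * iexp (z * q2 y) * k (x, y) \<partial>?B \<partial>?A)"
    by (simp add: k_def exp_add[symmetric] algebra_simps)
  also have "(cmod \<dots>)\<^sup>2 \<le> (\<integral>p. cmod (\<integral>y. k (fst p, y) * cnj (k (snd p, y)) \<partial>?B) \<partial>(?A \<Otimes>\<^sub>M ?A))"
    by (intro decoupling A.prob_space_axioms B.prob_space_axioms) (auto simp: k_def)
  also have "\<dots> = (\<integral>p. exp (- (2 * z\<^sup>2 * (\<Sum>j\<in>Q. v j * (h p j)\<^sup>2))) \<partial>(?A \<Otimes>\<^sub>M ?A))"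
  proof (intro Bochner_Integration.integral_cong refl)
    fix p :: "('i \<Rightarrow> real) \<times> ('i \<Rightarrow> real)"
    have kk: "k (fst p, y) * cnj (k (snd p, y)) = iexp (\<Sum>j\<in>Q. (2 * z * h p j) * y j)" for y
    proof -
      have "(\<Sum>j\<in>Q. (2 * z * h p j) * y j) = 2 * z * (\<Sum>j\<in>Q. \<Sum>i\<in>P. (fst p i - snd p i) * b i j * y j)"
        by (simp add: h_def sum_distrib_left sum_distrib_right ac_simps)
      also have "(\<Sum>j\<in>Q. \<Sum>i\<in>P. (fst p i - snd p i) * b i j * y j)
         = (\<Sum>i\<in>P. \<Sum>j\<in>Q. b i j * fst p i * y j) - (\<Sum>i\<in>P. \<Sum>j\<in>Q. b i j * snd p i * y j)"
        by (subst sum.swap) (simp add: sum_subtractf[symmetric] algebra_simps)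
      finally have e: "(\<Sum>j\<in>Q. (2 * z * h p j) * y j) = 2 * z * (\<Sum>i\<in>P. \<Sum>j\<in>Q. b i j * fst p i * y j)
         + - (2 * z * (\<Sum>i\<in>P. \<Sum>j\<in>Q. b i j * snd p i * y j))" by (simp add: algebra_simps)
      have c: "cnj (iexp r) = iexp (- r)" for r :: real by (simp add: exp_cnj)
      show ?thesis unfolding e k_def fst_conv snd_conv c
        by (simp only: of_real_add distrib_left exp_add)
    qed
    have "(\<integral>y. k (fst p, y) * cnj (k (snd p, y)) \<partial>?B) =
      exp (- ((\<Sum>j\<in>Q. v j * (2 * z * h p j)\<^sup>2) / 2))"
      unfolding kk using v by (intro gaussP_char Q) auto
    also have "(\<Sum>j\<in>Q. v j * (2 * z * h p j)\<^sup>2) / 2 = 2 * z\<^sup>2 * (\<Sum>j\<in>Q. v j * (h p j)\<^sup>2)"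
      by (simp add: sum_distrib_left sum_divide_distrib power_mult_distrib algebra_simps)
    finally show "cmod (\<integral>y. k (fst p, y) * cnj (k (snd p, y)) \<partial>?B)
      = exp (- (2 * z\<^sup>2 * (\<Sum>j\<in>Q. v j * (h p j)\<^sup>2)))" by (simp only: norm_of_real abs_exp_cancel)
  qed
  also have "\<dots> \<le> (\<integral>p. exp (- (2 * z\<^sup>2 * ((\<Sum>q\<in>R. (\<Sum>j\<in>V q. v j * h p j)\<^sup>2) / \<rho>))) \<partial>(?A \<Otimes>\<^sub>M ?A))"
  proof (intro integral_mono AA.P.integrable_const_bound[where B=1] AE_I2)
    fix p
    have "(\<Sum>q\<in>R. (\<Sum>j\<in>V q. v j * h p j)\<^sup>2) / \<rho> \<le> (\<Sum>j\<in>Q. v j * (h p j)\<^sup>2)"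
      using Q R v V \<rho> by (intro sum_blocks_square_le) auto
    then show "exp (- (2 * z\<^sup>2 * (\<Sum>j\<in>Q. v j * (h p j)\<^sup>2)))
       \<le> exp (- (2 * z\<^sup>2 * ((\<Sum>q\<in>R. (\<Sum>j\<in>V q. v j * h p j)\<^sup>2) / \<rho>)))"
      by (simp add: mult_left_mono del: times_divide_eq_right)
  qed (use v V \<rho> in \<open>auto simp: h_def intro!: mult_nonneg_nonneg divide_nonneg_nonneg sum_nonneg\<close>)
  also have "\<dots> \<le> (1 + 8 * z\<^sup>2 * \<sigma>\<^sup>2) powr (- (real (card R) / 2))"
  proof -
    define \<beta> where "\<beta> q i = (\<Sum>j\<in>V q. b i j * v j)" for q i
    define c where "c \<eta> i = (2 * z / sqrt \<rho>) * (\<Sum>q\<in>R. \<eta> q * \<beta> q i)" for \<eta> :: "'r \<Rightarrow> real" and i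
    have G: "(\<Sum>j\<in>V q. v j * h p j) = (\<Sum>i\<in>P. (fst p i - snd p i) * \<beta> q i)" for p q
      unfolding h_def \<beta>_def sum_distrib_left by (subst sum.swap) (simp add: ac_simps)
    \<comment> \<open>The Gaussian function of the vector of block sums is the characteristic function, averaged over
      the auxiliary vector, of a linear form.\<close>
    have HS: "(\<integral>\<eta>. iexp (\<Sum>i\<in>P. c \<eta> i * (fst p i - snd p i)) \<partial>?N)
      = exp (- (2 * z\<^sup>2 * ((\<Sum>q\<in>R. (\<Sum>j\<in>V q. v j * h p j)\<^sup>2) / \<rho>)))" for p
    proof -
      have "(\<Sum>i\<in>P. c \<eta> i * (fst p i - snd p i)) =
         (\<Sum>q\<in>R. (2 * z / sqrt \<rho> * (\<Sum>j\<in>V q. v j * h p j)) * \<eta> q)" for \<eta>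
        unfolding c_def G sum_distrib_left sum_distrib_right
        by (subst sum.swap) (intro sum.cong refl, simp add: algebra_simps diff_divide_distrib)
      then have "(\<integral>\<eta>. iexp (\<Sum>i\<in>P. c \<eta> i * (fst p i - snd p i)) \<partial>?N) =
         exp (- ((\<Sum>q\<in>R. 1 * (2 * z / sqrt \<rho> * (\<Sum>j\<in>V q. v j * h p j))\<^sup>2) / 2))"
        by (simp only:) (intro gaussP_char R, auto)
      also have "(\<Sum>q\<in>R. 1 * (2 * z / sqrt \<rho> * (\<Sum>j\<in>V q. v j * h p j))\<^sup>2) / 2 =
         2 * z\<^sup>2 * ((\<Sum>q\<in>R. (\<Sum>j\<in>V q. v j * h p j)\<^sup>2) / \<rho>)"
      proof -
        have "1 * (2 * z / sqrt \<rho> * X)\<^sup>2 = (4 * z\<^sup>2 / \<rho>) * X\<^sup>2" for X :: real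
          using \<rho> by (simp add: power_mult_distrib power_divide)
        then show ?thesis by (simp only: sum_distrib_left[symmetric]) simp
      qed
      finally show ?thesis .
    qed
    have [measurable]: "(\<lambda>w. \<Sum>i\<in>P. c (snd w) i * (fst (fst w) i - snd (fst w) i))
        \<in> borel_measurable ((?A \<Otimes>\<^sub>M ?A) \<Otimes>\<^sub>M ?N)" unfolding c_def by measurable
    have "complex_of_real (\<integral>p. exp (- (2 * z\<^sup>2 * ((\<Sum>q\<in>R. (\<Sum>j\<in>V q. v j * h p j)\<^sup>2) / \<rho>))) \<partial>(?A \<Otimes>\<^sub>M ?A))
      = (\<integral>p. \<integral>\<eta>. iexp (\<Sum>i\<in>P. c \<eta> i * (fst p i - snd p i)) \<partial>?N \<partial>(?A \<Otimes>\<^sub>M ?A))"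
      unfolding HS by (rule integral_complex_of_real[symmetric])
    also have "\<dots> = (\<integral>\<eta>. \<integral>p. iexp (\<Sum>i\<in>P. c \<eta> i * (fst p i - snd p i)) \<partial>(?A \<Otimes>\<^sub>M ?A) \<partial>?N)"
    proof (rule AN.Fubini_integral[symmetric], unfold case_prod_beta, rule AN.P.integrable_cmod_le_1)
      show "(\<lambda>w. iexp (\<Sum>i\<in>P. c (snd w) i * (fst (fst w) i - snd (fst w) i)))
        \<in> borel_measurable ((?A \<Otimes>\<^sub>M ?A) \<Otimes>\<^sub>M ?N)" by measurable
    qed (simp only: norm_exp_i_times order_refl)
    also have "\<dots> = (\<integral>\<eta>. complex_of_real (exp (- (\<Sum>i\<in>P. v i * (c \<eta> i)\<^sup>2))) \<partial>?N)"
    proof (intro Bochner_Integration.integral_cong refl)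
      fix \<eta> :: "'r \<Rightarrow> real"
      have [measurable]: "(\<lambda>x. \<Sum>i\<in>P. d i * x i) \<in> borel_measurable ?A" for d by measurable
      have "(\<integral>p. iexp (\<Sum>i\<in>P. c \<eta> i * (fst p i - snd p i)) \<partial>(?A \<Otimes>\<^sub>M ?A))
        = (\<integral>p. iexp (\<Sum>i\<in>P. c \<eta> i * fst p i) * iexp (\<Sum>i\<in>P. - c \<eta> i * snd p i) \<partial>(?A \<Otimes>\<^sub>M ?A))"
        by (intro Bochner_Integration.integral_cong refl)
          (simp add: exp_add[symmetric] algebra_simps sum_subtractf sum_negf)
      also have "\<dots> = (\<integral>x. \<integral>x'. iexp (\<Sum>i\<in>P. c \<eta> i * x i) * iexp (\<Sum>i\<in>P. - c \<eta> i * x' i) \<partial>?A \<partial>?A)"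
        by (subst AA.integral_fst'[symmetric])
          (auto intro!: AA.P.integrable_cmod_le_1 simp: norm_mult)
      also have "\<dots> = (\<integral>x. iexp (\<Sum>i\<in>P. c \<eta> i * x i) \<partial>?A) * (\<integral>x. iexp (\<Sum>i\<in>P. - c \<eta> i * x i) \<partial>?A)"
        by simp
      also have "(\<integral>x. iexp (\<Sum>i\<in>P. c \<eta> i * x i) \<partial>?A) = exp (- ((\<Sum>i\<in>P. v i * (c \<eta> i)\<^sup>2) / 2))"
        using v by (intro gaussP_char P) auto
      also have "(\<integral>x. iexp (\<Sum>i\<in>P. - c \<eta> i * x i) \<partial>?A) = exp (- ((\<Sum>i\<in>P. v i * (- c \<eta> i)\<^sup>2) / 2))"
        using v by (intro gaussP_char P) auto
      finally show "(\<integral>p. iexp (\<Sum>i\<in>P. c \<eta> i * (fst p i - snd p i)) \<partial>(?A \<Otimes>\<^sub>M ?A))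
         = complex_of_real (exp (- (\<Sum>i\<in>P. v i * (c \<eta> i)\<^sup>2)))"
        by (simp only: of_real_mult[symmetric] exp_add[symmetric]) simp
    qed
    also have "\<dots> = complex_of_real (\<integral>\<eta>. exp (- (\<Sum>i\<in>P. v i * (c \<eta> i)\<^sup>2)) \<partial>?N)"
      by (rule integral_complex_of_real)
    finally have "(\<integral>p. exp (- (2 * z\<^sup>2 * ((\<Sum>q\<in>R. (\<Sum>j\<in>V q. v j * h p j)\<^sup>2) / \<rho>))) \<partial>(?A \<Otimes>\<^sub>M ?A))
      = (\<integral>\<eta>. exp (- (\<Sum>i\<in>P. v i * (c \<eta> i)\<^sup>2)) \<partial>?N)" by (simp only: of_real_eq_iff)
    also have "\<dots> \<le> (\<integral>\<eta>. exp (- (4 * z\<^sup>2 * \<sigma>\<^sup>2 * (\<Sum>q\<in>R. (\<eta> q)\<^sup>2))) \<partial>?N)"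
    proof (intro integral_mono N.integrable_const_bound[where B=1] AE_I2)
      fix \<eta> :: "'r \<Rightarrow> real"
      have row: "(\<Sum>i\<in>U r. v i * c \<eta> i) = (2 * z * sqrt \<rho>) *
          (\<Sum>q\<in>R. (\<Sum>i\<in>U r. \<Sum>j\<in>V q. b i j * v i * v j) / \<rho> * \<eta> q)" for r
      proof -
        have "(\<Sum>i\<in>U r. v i * c \<eta> i) = (2 * z / sqrt \<rho>) * (\<Sum>i\<in>U r. \<Sum>q\<in>R. v i * (\<eta> q * \<beta> q i))"
          by (simp add: c_def sum_distrib_left ac_simps)
        also have "(\<Sum>i\<in>U r. \<Sum>q\<in>R. v i * (\<eta> q * \<beta> q i)) =
           (\<Sum>q\<in>R. (\<Sum>i\<in>U r. \<Sum>j\<in>V q. b i j * v i * v j) * \<eta> q)"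
          unfolding \<beta>_def sum_distrib_left sum_distrib_right by (subst sum.swap) (simp add: ac_simps)
        also have "\<dots> = \<rho> * (\<Sum>q\<in>R. (\<Sum>i\<in>U r. \<Sum>j\<in>V q. b i j * v i * v j) / \<rho> * \<eta> q)"
          using \<rho> by (simp add: sum_distrib_left)
        also have "2 * z / sqrt \<rho> * (\<rho> * (\<Sum>q\<in>R. (\<Sum>i\<in>U r. \<Sum>j\<in>V q. b i j * v i * v j) / \<rho> * \<eta> q))
           = 2 * z * (\<rho> / sqrt \<rho>) * (\<Sum>q\<in>R. (\<Sum>i\<in>U r. \<Sum>j\<in>V q. b i j * v i * v j) / \<rho> * \<eta> q)" by simp
        also have "\<rho> / sqrt \<rho> = sqrt \<rho>" using \<rho> by (simp add: real_div_sqrt)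
        finally show ?thesis .
      qed
      have "4 * z\<^sup>2 * (\<sigma>\<^sup>2 * (\<Sum>q\<in>R. (\<eta> q)\<^sup>2)) \<le> 4 * z\<^sup>2 *
          (\<Sum>r\<in>R. (\<Sum>q\<in>R. (\<Sum>i\<in>U r. \<Sum>j\<in>V q. b i j * v i * v j) / \<rho> * \<eta> q)\<^sup>2)"
        by (intro mult_left_mono nondeg) auto
      also have "\<dots> = (\<Sum>r\<in>R. (\<Sum>i\<in>U r. v i * c \<eta> i)\<^sup>2) / \<rho>"
      proof -
        have "(2 * z * sqrt \<rho> * X)\<^sup>2 = (4 * z\<^sup>2 * \<rho>) * X\<^sup>2" for X :: real
          using \<rho> by (simp add: power_mult_distrib)
        then show ?thesis using \<rho> unfolding row by (simp only: sum_distrib_left[symmetric]) simp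
      qed
      also have "\<dots> \<le> (\<Sum>i\<in>P. v i * (c \<eta> i)\<^sup>2)"
        using P R v U \<rho> by (intro sum_blocks_square_le) auto
      finally show "exp (- (\<Sum>i\<in>P. v i * (c \<eta> i)\<^sup>2)) \<le> exp (- (4 * z\<^sup>2 * \<sigma>\<^sup>2 * (\<Sum>q\<in>R. (\<eta> q)\<^sup>2)))"
        by (simp add: mult.assoc)
    qed (use v in \<open>auto simp: c_def intro!: mult_nonneg_nonneg sum_nonneg\<close>)
    also have "\<dots> = (1 + 2 * (4 * z\<^sup>2 * \<sigma>\<^sup>2)) powr (- (real (card R) / 2))"
      by (intro gaussP_exp_neg_square R) auto
    finally show ?thesis by (simp add: mult.assoc)
  qed
  finally show ?thesis .
qed

section \<open>Convergence in \<open>L\<^sup>2\<close>\<close>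

text \<open>The expectation of the sum is finite, hence the sum is finite almost everywhere.\<close>

lemma AE_summable_of_summable_nn_integrals:
  fixes v :: "nat \<Rightarrow> 'a \<Rightarrow> real"
  assumes [measurable]: "\<And>k. v k \<in> borel_measurable M" and nn: "\<And>k x. v k x \<ge> 0"
    and le: "\<And>k. (\<integral>\<^sup>+x. ennreal (v k x) \<partial>M) \<le> ennreal ((1/2) ^ k)"
  shows "AE x in M. summable (\<lambda>k. v k x)"
proof -
  have "(\<integral>\<^sup>+x. (\<Sum>k. ennreal (v k x)) \<partial>M) = (\<Sum>k. \<integral>\<^sup>+x. ennreal (v k x) \<partial>M)"
    by (intro nn_integral_suminf) auto
  also have "\<dots> \<le> (\<Sum>k. ennreal ((1/2) ^ k))" by (intro suminf_le le) auto
  also have "\<dots> = ennreal (\<Sum>k. (1/2) ^ k)" by (intro suminf_ennreal2) (auto intro: summable_geometric)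
  also have "\<dots> < \<infinity>" by simp
  finally have "AE x in M. (\<Sum>k. ennreal (v k x)) \<noteq> \<infinity>"
    by (intro nn_integral_noteq_infinite) auto
  then show ?thesis
    by eventually_elim (auto intro!: summable_suminf_not_top nn)
qed

lemma AE_subseq_tendsto_0:
  fixes v :: "nat \<Rightarrow> 'a \<Rightarrow> real"
  assumes [measurable]: "\<And>k. v k \<in> borel_measurable M" and nn: "\<And>k x. v k x \<ge> 0"
    and lim: "(\<lambda>k. \<integral>\<^sup>+x. ennreal (v k x) \<partial>M) \<longlonglongrightarrow> 0"
  obtains r where "strict_mono r" "AE x in M. (\<lambda>k. v (r k) x) \<longlonglongrightarrow> 0"
proof -
  have step: "\<exists>m. (\<integral>\<^sup>+x. ennreal (v m x) \<partial>M) \<le> ennreal ((1/2) ^ Suc k) \<and> n < m" for n k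
  proof -
    have "\<forall>\<^sub>F m in sequentially. (\<integral>\<^sup>+x. ennreal (v m x) \<partial>M) < ennreal ((1/2) ^ Suc k)"
      by (intro order_tendstoD[OF lim]) simp
    moreover have "\<forall>\<^sub>F m in sequentially. m > n" by (rule eventually_gt_at_top)
    ultimately have "\<forall>\<^sub>F m in sequentially. m > n \<and> (\<integral>\<^sup>+x. ennreal (v m x) \<partial>M) \<le> ennreal ((1/2) ^ Suc k)"
      by eventually_elim auto
    then show ?thesis by (auto dest: eventually_happens)
  qed
  have base: "\<exists>m. (\<integral>\<^sup>+x. ennreal (v m x) \<partial>M) \<le> ennreal ((1/2) ^ 0)"
  proof -
    have "\<forall>\<^sub>F m in sequentially. (\<integral>\<^sup>+x. ennreal (v m x) \<partial>M) < 1"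
      by (intro order_tendstoD[OF lim]) simp
    then obtain m where "(\<integral>\<^sup>+x. ennreal (v m x) \<partial>M) < 1" by (auto dest: eventually_happens)
    then show ?thesis by (intro exI[of _ m]) (simp add: less_imp_le)
  qed
  have "\<exists>r. \<forall>k. (\<integral>\<^sup>+x. ennreal (v (r k) x) \<partial>M) \<le> ennreal ((1/2) ^ k) \<and> r k < r (Suc k)"
    by (rule dependent_nat_choice[OF base step])
  then obtain r where r: "\<And>k. (\<integral>\<^sup>+x. ennreal (v (r k) x) \<partial>M) \<le> ennreal ((1/2) ^ k)"
      "\<And>k. r k < r (Suc k)" by blast
  have "AE x in M. summable (\<lambda>k. v (r k) x)"
    by (intro AE_summable_of_summable_nn_integrals r nn) auto
  then have "AE x in M. (\<lambda>k. v (r k) x) \<longlonglongrightarrow> 0"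
    by eventually_elim (rule summable_LIMSEQ_zero)
  then show ?thesis using that[of r] r(2) by (auto simp: strict_mono_Suc_iff)
qed

text \<open>Riesz-Fischer: along a subsequence with squared distances at most \<open>8\<^sup>-\<^sup>k\<close> the series of
  \<open>4\<^sup>k\<close> times the squared increments converges almost everywhere, so that the increments are eventually
  below \<open>2\<^sup>-\<^sup>k\<close>. Fatou's lemma transfers the Cauchy estimate to the limit.\<close>

lemma L2_complete:
  fixes f :: "nat \<Rightarrow> 'a \<Rightarrow> real"
  assumes [measurable]: "\<And>n. f n \<in> borel_measurable M"
    and cauchy: "\<And>e. e > 0 \<Longrightarrow> \<exists>N. \<forall>m\<ge>N. \<forall>n\<ge>N. (\<integral>\<^sup>+x. ennreal ((f m x - f n x)\<^sup>2) \<partial>M) \<le> ennreal e"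
  obtains g where "g \<in> borel_measurable M"
    "(\<lambda>n. \<integral>\<^sup>+x. ennreal ((f n x - g x)\<^sup>2) \<partial>M) \<longlonglongrightarrow> 0"
proof -
  obtain N where N: "\<And>k m n. m \<ge> N k \<Longrightarrow> n \<ge> N k \<Longrightarrow>
      (\<integral>\<^sup>+x. ennreal ((f m x - f n x)\<^sup>2) \<partial>M) \<le> ennreal ((1/8) ^ k)"
    using cauchy[of "(1/8) ^ k" for k] by (metis zero_less_divide_1_iff zero_less_numeral zero_less_power)
  \<comment> \<open>strictly increasing and at least \<open>N k\<close> at \<open>k\<close>\<close>
  define r where "r = rec_nat (N 0) (\<lambda>k m. max (N (Suc k)) (Suc m))"
  have r_ge: "r k \<ge> N k" for k by (cases k) (auto simp: r_def)
  have r_Suc: "r k < r (Suc k)" for k by (simp add: r_def)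
  then have r: "strict_mono r" by (simp add: strict_mono_Suc_iff)
  have four: "(2 ^ k)\<^sup>2 = (4::real) ^ k" for k :: nat
    by (simp add: power2_eq_square flip: power_mult_distrib)
  define v where "v k x = 4 ^ k * (f (r (Suc k)) x - f (r k) x)\<^sup>2" for k x
  have "AE x in M. summable (\<lambda>k. v k x)"
  proof (rule AE_summable_of_summable_nn_integrals)
    fix k
    have "(\<integral>\<^sup>+x. ennreal (v k x) \<partial>M) = ennreal (4 ^ k) * (\<integral>\<^sup>+x. ennreal ((f (r (Suc k)) x - f (r k) x)\<^sup>2) \<partial>M)"
      by (subst nn_integral_cmult[symmetric]) (auto simp: v_def ennreal_mult simp del: ennreal_power)
    also have "\<dots> \<le> ennreal (4 ^ k) * ennreal ((1/8) ^ k)"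
      using r_ge[of k] r_Suc[of k] by (intro mult_left_mono N) auto
    also have "\<dots> = ennreal ((1/2) ^ k)"
      by (subst ennreal_mult[symmetric]) (auto simp: power_mult_distrib[symmetric])
    finally show "(\<integral>\<^sup>+x. ennreal (v k x) \<partial>M) \<le> ennreal ((1/2) ^ k)" .
  qed (auto simp: v_def)
  then have conv: "AE x in M. convergent (\<lambda>k. f (r k) x)"
  proof eventually_elim
    case (elim x)
    then have "\<forall>\<^sub>F k in sequentially. v k x < 1"
      by (intro order_tendstoD[OF summable_LIMSEQ_zero]) auto
    then have "\<forall>\<^sub>F k in sequentially. norm (f (r (Suc k)) x - f (r k) x) \<le> (1/2) ^ k"
    proof eventually_elim
      case (elim k)
      then have "(2 ^ k * \<bar>f (r (Suc k)) x - f (r k) x\<bar>)\<^sup>2 \<le> 1\<^sup>2"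
        by (simp add: v_def power_mult_distrib four)
      then have "2 ^ k * \<bar>f (r (Suc k)) x - f (r k) x\<bar> \<le> 1" by (rule power2_le_imp_le) simp
      then show ?case by (simp add: power_divide field_simps)
    qed
    then have "summable (\<lambda>k. f (r (Suc k)) x - f (r k) x)"
      by (rule summable_comparison_test_ev) (auto intro: summable_geometric)
    then obtain L where "(\<lambda>m. \<Sum>k<m. f (r (Suc k)) x - f (r k) x) \<longlonglongrightarrow> L"
      by (auto simp: summable_def sums_def)
    then have "(\<lambda>m. f (r m) x - f (r 0) x) \<longlonglongrightarrow> L"
      by (simp only: sum_lessThan_telescope[of "\<lambda>k. f (r k) x"])
    then have "(\<lambda>m. f (r m) x - f (r 0) x + f (r 0) x) \<longlonglongrightarrow> L + f (r 0) x"
      by (intro tendsto_add tendsto_const)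
    then show ?case by (auto simp: convergent_def)
  qed
  define g where "g x = lim (\<lambda>k. f (r k) x)" for x
  have [measurable]: "g \<in> borel_measurable M" unfolding g_def by measurable
  have lim: "AE x in M. (\<lambda>k. f (r k) x) \<longlonglongrightarrow> g x"
    using conv by eventually_elim (simp add: g_def convergent_LIMSEQ_iff)
  have small: "(\<integral>\<^sup>+x. ennreal ((f n x - g x)\<^sup>2) \<partial>M) \<le> ennreal ((1/8) ^ k)" if "n \<ge> N k" for n k
  proof -
    have "(\<integral>\<^sup>+x. ennreal ((f n x - g x)\<^sup>2) \<partial>M) =
        (\<integral>\<^sup>+x. liminf (\<lambda>j. ennreal ((f n x - f (r j) x)\<^sup>2)) \<partial>M)"
    proof (intro nn_integral_cong_AE)
      show "AE x in M. ennreal ((f n x - g x)\<^sup>2) = liminf (\<lambda>j. ennreal ((f n x - f (r j) x)\<^sup>2))"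
        using lim by eventually_elim
          (intro lim_imp_Liminf[symmetric] tendsto_ennrealI tendsto_intros; simp)
    qed
    also have "\<dots> \<le> liminf (\<lambda>j. \<integral>\<^sup>+x. ennreal ((f n x - f (r j) x)\<^sup>2) \<partial>M)"
      by (intro nn_integral_liminf) auto
    also have "\<dots> \<le> ennreal ((1/8) ^ k)"
    proof (rule Liminf_le)
      have "\<forall>\<^sub>F j in sequentially. j \<ge> N k" by (rule eventually_ge_at_top)
      then show "\<forall>\<^sub>F j in sequentially. (\<integral>\<^sup>+x. ennreal ((f n x - f (r j) x)\<^sup>2) \<partial>M) \<le> ennreal ((1/8) ^ k)"
        by eventually_elim (use that strict_mono_imp_increasing[OF r] in \<open>auto intro!: N intro: order_trans\<close>)
    qed auto
    finally show ?thesis .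
  qed
  have "(\<lambda>n. \<integral>\<^sup>+x. ennreal ((f n x - g x)\<^sup>2) \<partial>M) \<longlonglongrightarrow> 0"
  proof (rule order_tendstoI)
    fix e :: ennreal assume "0 < e"
    moreover have "(\<lambda>k. ennreal ((1/8) ^ k)) \<longlonglongrightarrow> ennreal 0"
      by (intro tendsto_ennrealI LIMSEQ_realpow_zero) auto
    ultimately have "\<forall>\<^sub>F k in sequentially. ennreal ((1/8) ^ k) < e"
      by (intro order_tendstoD) auto
    then obtain k where k: "ennreal ((1/8) ^ k) < e" by (auto dest: eventually_happens)
    show "\<forall>\<^sub>F n in sequentially. (\<integral>\<^sup>+x. ennreal ((f n x - g x)\<^sup>2) \<partial>M) < e"
      using eventually_ge_at_top[of "N k"] by eventually_elim (rule le_less_trans[OF small k])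
  qed simp
  then show ?thesis using that[of g] by simp
qed

lemma nn_integral_square_diff_le:
  fixes u v w :: "'a \<Rightarrow> real"
  assumes [measurable]: "u \<in> borel_measurable N" "v \<in> borel_measurable N" "w \<in> borel_measurable N"
  shows "(\<integral>\<^sup>+x. ennreal ((u x - v x)\<^sup>2) \<partial>N) \<le>
    2 * (\<integral>\<^sup>+x. ennreal ((u x - w x)\<^sup>2) \<partial>N) + 2 * (\<integral>\<^sup>+x. ennreal ((v x - w x)\<^sup>2) \<partial>N)"
proof -
  have "(\<integral>\<^sup>+x. ennreal ((u x - v x)\<^sup>2) \<partial>N) \<le>
    (\<integral>\<^sup>+x. 2 * ennreal ((u x - w x)\<^sup>2) + 2 * ennreal ((v x - w x)\<^sup>2) \<partial>N)"
  proof (intro nn_integral_mono)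
    fix x
    have "(u x - v x)\<^sup>2 \<le> 2 * (u x - w x)\<^sup>2 + 2 * (v x - w x)\<^sup>2"
      using zero_le_power2[of "(u x - w x) + (v x - w x)"] by (simp add: power2_eq_square algebra_simps)
    then have "ennreal ((u x - v x)\<^sup>2) \<le> ennreal (2 * (u x - w x)\<^sup>2 + 2 * (v x - w x)\<^sup>2)"
      by (rule ennreal_leI)
    then show "ennreal ((u x - v x)\<^sup>2) \<le> 2 * ennreal ((u x - w x)\<^sup>2) + 2 * ennreal ((v x - w x)\<^sup>2)"
      by (simp add: ennreal_mult)
  qed
  then show ?thesis by (simp add: nn_integral_add nn_integral_cmult)
qed

lemma L2_indicator_pairing:
  fixes h :: "'a \<Rightarrow> real"
  assumes [measurable]: "h \<in> borel_measurable N" "S \<in> sets N"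
    and fin: "(\<integral>\<^sup>+p. ennreal ((h p)\<^sup>2) \<partial>N) < \<infinity>" and S: "emeasure N S = ennreal m" "m \<ge> 0"
  shows "integrable N (\<lambda>p. indicator S p * h p)"
    and "\<bar>\<integral>p. indicator S p * h p \<partial>N\<bar> \<le> sqrt m * sqrt (enn2real (\<integral>\<^sup>+p. ennreal ((h p)\<^sup>2) \<partial>N))"
proof -
  define Q where "Q = (\<integral>\<^sup>+p. ennreal ((h p)\<^sup>2) \<partial>N)"
  have "(\<integral>\<^sup>+p. ennreal (norm (indicator S p * h p)) \<partial>N)\<^sup>2
      = (\<integral>\<^sup>+p. indicator S p * ennreal \<bar>h p\<bar> \<partial>N)\<^sup>2"
    by (intro arg_cong[where f="\<lambda>x. x\<^sup>2"] nn_integral_cong) (auto split: split_indicator)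
  also have "\<dots> \<le> (\<integral>\<^sup>+p. (indicator S p)\<^sup>2 \<partial>N) * (\<integral>\<^sup>+p. (ennreal \<bar>h p\<bar>)\<^sup>2 \<partial>N)"
    by (rule Cauchy_Schwarz_nn_integral) measurable
  also have "(\<integral>\<^sup>+p. (indicator S p)\<^sup>2 \<partial>N) = (\<integral>\<^sup>+p. indicator S p \<partial>N)"
    by (intro nn_integral_cong) (auto split: split_indicator)
  also have "\<dots> = ennreal m" by (simp add: S)
  also have "(\<integral>\<^sup>+p. (ennreal \<bar>h p\<bar>)\<^sup>2 \<partial>N) = Q"
    unfolding Q_def by (intro nn_integral_cong) (simp add: ennreal_power)
  finally have CS: "(\<integral>\<^sup>+p. ennreal (norm (indicator S p * h p)) \<partial>N)\<^sup>2 \<le> ennreal m * Q" .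
  have Q: "Q = ennreal (enn2real Q)" using fin by (simp add: Q_def)
  have "ennreal m * Q < \<infinity>" using fin by (simp add: Q_def ennreal_mult_less_top)
  with CS have "(\<integral>\<^sup>+p. ennreal (norm (indicator S p * h p)) \<partial>N)\<^sup>2 < \<infinity>" by (rule le_less_trans)
  then have less: "(\<integral>\<^sup>+p. ennreal (norm (indicator S p * h p)) \<partial>N) < \<infinity>"
    by (auto simp: power2_eq_square ennreal_mult_less_top)
  show int: "integrable N (\<lambda>p. indicator S p * h p)"
    using less by (intro integrableI_bounded) auto
  define J where "J = (\<integral>p. norm (indicator S p * h p) \<partial>N)"
  have J: "(\<integral>\<^sup>+p. ennreal (norm (indicator S p * h p)) \<partial>N) = ennreal J" "J \<ge> 0"
    unfolding J_def using int by (auto intro!: nn_integral_eq_integral)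
  have "ennreal (J\<^sup>2) \<le> ennreal (m * enn2real Q)"
    using CS unfolding J by (subst (asm) Q) (simp add: ennreal_power J ennreal_mult S)
  then have "J\<^sup>2 \<le> m * enn2real Q" using S by (simp add: ennreal_le_iff)
  then have "sqrt (J\<^sup>2) \<le> sqrt (m * enn2real Q)" by (rule real_sqrt_le_mono)
  then have "J \<le> sqrt m * sqrt (enn2real Q)" using J(2) by (simp add: real_sqrt_mult)
  moreover have "\<bar>\<integral>p. indicator S p * h p \<partial>N\<bar> \<le> J"
    unfolding J_def using integral_norm_bound[of N "\<lambda>p. indicator S p * h p"] by simp
  ultimately show "\<bar>\<integral>p. indicator S p * h p \<partial>N\<bar> \<le> sqrt m * sqrt (enn2real (\<integral>\<^sup>+p. ennreal ((h p)\<^sup>2) \<partial>N))"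
    by (simp add: Q_def)
qed

section \<open>White noise on partitions\<close>

abbreviation lborel2 :: "(real \<times> real) measure"
  where "lborel2 \<equiv> lborel \<Otimes>\<^sub>M lborel"

lemma fin_borel_subset: "A \<in> fin_borel \<Longrightarrow> B \<in> sets borel \<Longrightarrow> B \<subseteq> A \<Longrightarrow> B \<in> fin_borel"
  unfolding fin_borel_def using emeasure_mono[of B A lborel] by (auto simp: less_top[symmetric] top_unique)

lemma fin_borel_Un: "A \<in> fin_borel \<Longrightarrow> B \<in> fin_borel \<Longrightarrow> A \<union> B \<in> fin_borel"
  unfolding fin_borel_def using emeasure_subadditive[of A lborel B]
  by (auto simp: less_top[symmetric] top_unique)

lemma fin_borel_empty [simp]: "{} \<in> fin_borel"
  by (simp add: fin_borel_def)

lemma fin_borel_UN: "finite J \<Longrightarrow> (\<And>i. i \<in> J \<Longrightarrow> C i \<in> fin_borel) \<Longrightarrow> (\<Union>i\<in>J. C i) \<in> fin_borel"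
  by (induction J rule: finite_induct) (auto intro: fin_borel_Un)

lemma fin_borel_sets: "A \<in> fin_borel \<Longrightarrow> A \<in> sets borel"
  by (simp add: fin_borel_def)

lemma fin_borel_emeasure: "A \<in> fin_borel \<Longrightarrow> emeasure lborel A = ennreal (measure lborel A)"
  by (intro emeasure_eq_ennreal_measure) (auto simp: fin_borel_def)

text \<open>The cells are nonempty, so that a function that is constant on cells can be read off at a
  representative. They are continued by empty sets to a full sequence, the form in which
  independence and additivity of the noise are given.\<close>

definition refining :: "nat \<Rightarrow> (nat \<Rightarrow> real set) \<Rightarrow> real set set \<Rightarrow> bool"
  where "refining N C \<A> \<longleftrightarrow> N > 0 \<and> disjoint_family C \<and> range C \<subseteq> fin_borel \<and>
    (\<forall>i\<ge>N. C i = {}) \<and> (\<forall>i<N. C i \<noteq> {}) \<and>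
    (\<forall>A\<in>\<A>. A \<subseteq> (\<Union>i<N. C i) \<and> (\<forall>i<N. C i \<subseteq> A \<or> C i \<inter> A = {}))"

text \<open>The cells are the atoms of the generated algebra inside the union, that is the nonempty sets of
  points with a fixed nonempty collection of members of the family. The unit interval is added to the
  family only to have at least one cell.\<close>

lemma ex_refining:
  assumes "finite \<A>" "\<A> \<subseteq> fin_borel"
  shows "\<exists>N C. refining N C \<A>"
proof -
  define \<B> where "\<B> = insert {0..1::real} \<A>"
  have \<B>: "finite \<B>" "\<B> \<subseteq> fin_borel" "{0..1} \<in> \<B>"
    using assms by (auto simp: \<B>_def fin_borel_def)
  define cellof where "cellof S = {y. \<forall>A\<in>\<B>. y \<in> A \<longleftrightarrow> A \<in> S}" for S
  have cellof_sets: "cellof S \<in> sets borel" for S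
  proof -
    have "cellof S = (\<Inter>A\<in>\<B>. if A \<in> S then A else - A)" by (auto simp: cellof_def split: if_splits)
    also have "\<dots> \<in> sets borel"
      using \<B> by (intro sets.finite_INT) (auto simp: subset_iff fin_borel_def intro: borel_comp)
    finally show ?thesis .
  qed
  define \<C> where "\<C> = {cellof S | S. S \<subseteq> \<B> \<and> S \<noteq> {} \<and> cellof S \<noteq> {}}"
  have fin: "finite \<C>"
  proof -
    have "\<C> \<subseteq> cellof ` Pow \<B>" by (auto simp: \<C>_def)
    then show ?thesis using \<B> by (auto intro: finite_subset)
  qed
  have cover: "\<exists>c\<in>\<C>. x \<in> c \<and> c \<subseteq> A" if "A \<in> \<B>" "x \<in> A" for x A
  proof (intro bexI conjI)
    have x: "x \<in> cellof {A\<in>\<B>. x \<in> A}" by (simp add: cellof_def)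
    then show "x \<in> cellof {A\<in>\<B>. x \<in> A}" .
    show "cellof {A\<in>\<B>. x \<in> A} \<subseteq> A" using that by (auto simp: cellof_def)
    show "cellof {A\<in>\<B>. x \<in> A} \<in> \<C>" using x that unfolding \<C>_def by blast
  qed
  have split: "c \<subseteq> A \<or> c \<inter> A = {}" if "A \<in> \<B>" "c \<in> \<C>" for A c
    using that by (auto simp: \<C>_def cellof_def)
  have cfb: "c \<in> fin_borel" if c: "c \<in> \<C>" for c
  proof -
    obtain S A where "c = cellof S" "A \<in> S" "S \<subseteq> \<B>" using c by (auto simp: \<C>_def)
    then show ?thesis using \<B> cellof_sets by (intro fin_borel_subset[of A c]) (auto simp: cellof_def)
  qed
  have disj: "c \<inter> d = {}" if cd: "c \<in> \<C>" "d \<in> \<C>" "c \<noteq> d" for c d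
  proof -
    obtain S S' where *: "c = cellof S" "S \<subseteq> \<B>" "d = cellof S'" "S' \<subseteq> \<B>" using cd by (auto simp: \<C>_def)
    have "x \<notin> d" if "x \<in> c" for x
    proof
      assume "x \<in> d"
      with that * have "S = S'" by (auto simp: cellof_def)
      with * cd show False by simp
    qed
    then show ?thesis by auto
  qed
  obtain h where h: "bij_betw h {..<card \<C>} \<C>"
    using ex_bij_betw_nat_finite[OF fin] by (auto simp: atLeast0LessThan)
  define C where "C i = (if i < card \<C> then h i else {})" for i
  have hC: "h i \<in> \<C>" if "i < card \<C>" for i using h that by (auto simp: bij_betw_def)
  have surj: "\<exists>i<card \<C>. c = C i" if "c \<in> \<C>" for c
    using h that by (auto simp: bij_betw_def C_def)
  have "refining (card \<C>) C \<B>"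
    unfolding refining_def
  proof (intro conjI ballI allI impI)
    show "card \<C> > 0" using cover[OF \<B>(3), of 0] fin by (auto simp: card_gt_0_iff)
    show "disjoint_family C"
    proof (unfold disjoint_family_on_def, intro ballI impI)
      fix m n :: nat assume "m \<noteq> n"
      moreover have "h m \<noteq> h n" if "m < card \<C>" "n < card \<C>" "m \<noteq> n"
        using h that by (auto simp: bij_betw_def inj_on_def)
      ultimately show "C m \<inter> C n = {}" using hC disj by (simp add: C_def)
    qed
    show "range C \<subseteq> fin_borel" using hC cfb by (auto simp: C_def)
    fix i assume "i < card \<C>"
    then show "C i \<noteq> {}" using hC[of i] by (auto simp: C_def \<C>_def)
  next
    fix A assume A: "A \<in> \<B>"
    show "A \<subseteq> (\<Union>i<card \<C>. C i)"
    proof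
      fix x assume "x \<in> A"
      then obtain c where "c \<in> \<C>" "x \<in> c" using cover[OF A] by blast
      then show "x \<in> (\<Union>i<card \<C>. C i)" using surj[of c] by auto
    qed
    fix i assume "i < card \<C>"
    then show "C i \<subseteq> A \<or> C i \<inter> A = {}" using split[OF A hC[of i]] by (auto simp: C_def)
  qed (auto simp: C_def)
  then have "refining (card \<C>) C \<A>" by (auto simp: refining_def \<B>_def)
  then show ?thesis by blast
qed

text \<open>For a function that is constant on the products of cells this is its matrix of values; being
  evaluation at points, it is linear in the function.\<close>

definition cell_coeff :: "(nat \<Rightarrow> real set) \<Rightarrow> (real \<times> real \<Rightarrow> real) \<Rightarrow> nat \<Rightarrow> nat \<Rightarrow> real"
  where "cell_coeff C f i j = f (SOME x. x \<in> C i, SOME x. x \<in> C j)"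

lemma refining_point:
  assumes "refining N C \<A>" "i < N" "A \<in> \<A>"
  shows "(SOME x. x \<in> C i) \<in> A \<longleftrightarrow> C i \<subseteq> A"
proof -
  have "C i \<noteq> {}" "C i \<subseteq> A \<or> C i \<inter> A = {}" using assms by (auto simp: refining_def)
  then have "(SOME x. x \<in> C i) \<in> C i" by (simp add: some_in_eq)
  then show ?thesis using \<open>C i \<subseteq> A \<or> C i \<inter> A = {}\<close> by auto
qed

lemma sum_swap_pairs:
  "(\<Sum>k\<in>K. \<Sum>l\<in>L. \<Sum>i\<in>I. \<Sum>j\<in>J. F k l i j) = (\<Sum>i\<in>I. \<Sum>j\<in>J. \<Sum>k\<in>K. \<Sum>l\<in>L. F k l i j)"
proof -
  have "(\<Sum>k\<in>K. \<Sum>l\<in>L. \<Sum>i\<in>I. \<Sum>j\<in>J. F k l i j) = (\<Sum>k\<in>K. \<Sum>i\<in>I. \<Sum>l\<in>L. \<Sum>j\<in>J. F k l i j)"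
    by (rule sum.cong[OF refl], rule sum.swap)
  also have "\<dots> = (\<Sum>i\<in>I. \<Sum>k\<in>K. \<Sum>l\<in>L. \<Sum>j\<in>J. F k l i j)" by (rule sum.swap)
  also have "\<dots> = (\<Sum>i\<in>I. \<Sum>k\<in>K. \<Sum>j\<in>J. \<Sum>l\<in>L. F k l i j)"
    by (rule sum.cong[OF refl], rule sum.cong[OF refl], rule sum.swap)
  also have "\<dots> = (\<Sum>i\<in>I. \<Sum>j\<in>J. \<Sum>k\<in>K. \<Sum>l\<in>L. F k l i j)"
    by (rule sum.cong[OF refl], rule sum.swap)
  finally show ?thesis .
qed

lemma simple_fun2_cells:
  assumes "\<And>i j. i < N \<Longrightarrow> j < N \<Longrightarrow> i \<noteq> j \<Longrightarrow> C i \<inter> C j = {}"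
    and "i < N" "j < N" "x \<in> C i" "y \<in> C j"
  shows "simple_fun2 N C b (x, y) = b i j"
proof -
  have "simple_fun2 N C b (x, y) = (\<Sum>k<N. \<Sum>l<N. if l = j then if k = i then b i j else 0 else 0)"
    unfolding simple_fun2_def case_prod_conv
  proof (intro sum.cong refl)
    fix k l assume "k \<in> {..<N}" "l \<in> {..<N}"
    then show "b k l * indicator (C k) x * indicator (C l) y =
       (if l = j then if k = i then b i j else 0 else 0)"
      using assms(1)[of k i] assms(1)[of l j] assms(2-) by (auto simp: indicator_def)
  qed
  also have "\<dots> = b i j" using assms by simp
  finally show ?thesis .
qed

lemma simple_fun2_outside:
  "(x \<notin> (\<Union>i<N. C i) \<or> y \<notin> (\<Union>i<N. C i)) \<Longrightarrow> simple_fun2 N C b (x, y) = 0"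
  unfolding simple_fun2_def case_prod_conv by (intro sum.neutral ballI) (auto simp: indicator_def)

lemma refining_disjoint: "refining N C \<A> \<Longrightarrow> i \<noteq> j \<Longrightarrow> C i \<inter> C j = {}"
  by (auto simp: refining_def disjoint_family_on_def)

lemma simple_fun2_sym:
  assumes "simple_data n A a"
  shows "simple_fun2 n A a (x, y) = simple_fun2 n A a (y, x)"
  using assms unfolding simple_fun2_def simple_data_def case_prod_conv
  by (subst sum.swap) (auto intro!: sum.cong)

context
  fixes n A a N C \<A>
  assumes sd: "simple_data n A a" and ref: "refining N C \<A>" and sub: "A ` {..<n} \<subseteq> \<A>"
begin

lemma refine_coeff:
  assumes "i < N" "j < N"
  shows "cell_coeff C (simple_fun2 n A a) i j =
    (\<Sum>k<n. \<Sum>l<n. a k l * of_bool (C i \<subseteq> A k) * of_bool (C j \<subseteq> A l))"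
  unfolding cell_coeff_def simple_fun2_def case_prod_conv
  using refining_point[OF ref assms(1)] refining_point[OF ref assms(2)] sub
  by (intro sum.cong refl) (auto simp: indicator_def)

lemma refine_simple_fun2:
  "simple_fun2 N C (cell_coeff C (simple_fun2 n A a)) = simple_fun2 n A a"
proof (rule ext, clarify)
  fix x y
  show "simple_fun2 N C (cell_coeff C (simple_fun2 n A a)) (x, y) = simple_fun2 n A a (x, y)"
  proof (cases "x \<in> (\<Union>i<N. C i) \<and> y \<in> (\<Union>i<N. C i)")
    case False
    moreover have "(\<Union>k<n. A k) \<subseteq> (\<Union>i<N. C i)" using ref sub by (fastforce simp: refining_def)
    ultimately have "x \<notin> (\<Union>k<n. A k) \<or> y \<notin> (\<Union>k<n. A k)" by blast
    moreover have "x \<notin> (\<Union>i<N. C i) \<or> y \<notin> (\<Union>i<N. C i)" using False by blast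
    ultimately show ?thesis by (simp only: simple_fun2_outside)
  next
    case True
    then obtain i j where ij: "i < N" "j < N" "x \<in> C i" "y \<in> C j" by auto
    have eq: "w \<in> A k \<longleftrightarrow> C m \<subseteq> A k" if "m < N" "w \<in> C m" "k < n" for m w k
    proof -
      have "A k \<in> \<A>" using sub that by auto
      then have "C m \<subseteq> A k \<or> C m \<inter> A k = {}" using ref that by (simp add: refining_def)
      then show ?thesis using that by auto
    qed
    have "simple_fun2 N C (cell_coeff C (simple_fun2 n A a)) (x, y) = cell_coeff C (simple_fun2 n A a) i j"
      using ij refining_disjoint[OF ref] by (intro simple_fun2_cells) auto
    also have "\<dots> = (\<Sum>k<n. \<Sum>l<n. a k l * of_bool (C i \<subseteq> A k) * of_bool (C j \<subseteq> A l))"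
      by (rule refine_coeff[OF ij(1,2)])
    also have "\<dots> = simple_fun2 n A a (x, y)"
      unfolding simple_fun2_def case_prod_conv
      using ij by (intro sum.cong refl) (auto simp: indicator_def eq)
    finally show ?thesis .
  qed
qed

text \<open>The diagonal stays zero: a cell lies in at most one of the disjoint sets \<open>A k\<close>, and there the
  coefficient is \<open>a k k = 0\<close>.\<close>

lemma refine_simple_data: "simple_data N C (cell_coeff C (simple_fun2 n A a))"
  unfolding simple_data_def
proof (intro conjI allI impI)
  show "C k \<in> fin_borel" for k using ref by (auto simp: refining_def)
  show "disjoint_family_on C {..<N}" using ref by (auto simp: refining_def disjoint_family_on_def)
  show "cell_coeff C (simple_fun2 n A a) k j = cell_coeff C (simple_fun2 n A a) j k" for k j
    unfolding cell_coeff_def by (rule simple_fun2_sym[OF sd])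
  fix k assume k: "k < N"
  have ne: "C k \<noteq> {}" using ref k by (auto simp: refining_def)
  have "a p q * of_bool (C k \<subseteq> A p) * of_bool (C k \<subseteq> A q) = 0" if "p < n" "q < n" for p q
  proof (cases "p = q")
    case True then show ?thesis using sd that by (simp add: simple_data_def)
  next
    case False
    then have "A p \<inter> A q = {}" using sd that by (auto simp: simple_data_def disjoint_family_on_def)
    then show ?thesis using ne by auto
  qed
  then show "cell_coeff C (simple_fun2 n A a) k k = 0"
    unfolding refine_coeff[OF k k] by (intro sum.neutral ballI) auto
qed

end

context white_noise
begin

lemma W_measurable: "A \<in> fin_borel \<Longrightarrow> W A \<in> borel_measurable M"
  using gaussian by (simp add: centered_gaussian_def)

lemma W_distr:
  assumes A: "A \<in> fin_borel"
  shows "distr M borel (W A) = gauss (measure lborel A)"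
proof (cases "measure lborel A = 0")
  case True
  then have "distr M borel (W A) = distr M borel (\<lambda>_. 0::real)"
    using gaussian[OF A] by (intro distr_cong_AE) (auto simp: centered_gaussian_def)
  also have "\<dots> = return borel 0" by (rule distr_const) auto
  also have "return borel 0 = distr std_normal_distribution borel (\<lambda>_. 0::real)"
    by (rule prob_space.distr_const[symmetric, OF prob_space_normal_density]) auto
  also have "\<dots> = gauss 0" by (simp add: gauss_def)
  finally show ?thesis using True by simp
next
  case False
  define v where "v = measure lborel A"
  have v: "v > 0" using False by (simp add: v_def less_le)
  have "distr M borel (W A) = distr M lborel (W A)" by (intro distr_cong) auto
  also have "\<dots> = density lborel (normal_density 0 (sqrt v))"
    using gaussian[OF A] False by (simp add: centered_gaussian_def distributed_def v_def)
  also have "\<dots> = gauss v" by (rule gauss_density[OF v, symmetric])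
  finally show ?thesis by (simp add: v_def)
qed

lemma W_empty: "AE \<omega> in M. W {} \<omega> = 0"
  using gaussian[of "{}"] by (simp add: centered_gaussian_def)

lemma W_finite_union:
  fixes C :: "nat \<Rightarrow> real set"
  assumes "finite J" "disjoint_family C" "range C \<subseteq> fin_borel"
  shows "AE \<omega> in M. W (\<Union>i\<in>J. C i) \<omega> = (\<Sum>i\<in>J. W (C i) \<omega>)"
proof -
  define B where "B i = (if i \<in> J then C i else {})" for i
  have U: "(\<Union>i. B i) = (\<Union>i\<in>J. C i)" by (auto simp: B_def split: if_splits)
  have "AE \<omega> in M. (\<lambda>i. W (B i) \<omega>) sums W (\<Union>i. B i) \<omega>"
    using assms unfolding U
    by (intro additive[of B, unfolded U] fin_borel_UN)
      (auto simp: B_def disjoint_family_on_def)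
  with W_empty show ?thesis
  proof eventually_elim
    case (elim \<omega>)
    have "(\<lambda>i. W (B i) \<omega>) sums (\<Sum>i\<in>J. W (B i) \<omega>)"
      using elim by (intro sums_finite assms(1)) (auto simp: B_def)
    with elim have "W (\<Union>i. B i) \<omega> = (\<Sum>i\<in>J. W (B i) \<omega>)" by (auto intro: sums_unique2)
    then show ?case unfolding U by (simp add: B_def)
  qed
qed

text \<open>All that follows about finitely many disjoint sets is a computation in this product of Gaussian
  laws.\<close>

lemma W_joint_distr:
  fixes C :: "nat \<Rightarrow> real set"
  assumes "N > 0" "disjoint_family C" "range C \<subseteq> fin_borel"
  shows "distr M (Pi\<^sub>M {..<N} (\<lambda>_. borel)) (\<lambda>\<omega>. \<lambda>i\<in>{..<N}. W (C i) \<omega>)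
    = gaussP (\<lambda>i. measure lborel (C i)) {..<N}"
proof -
  have "indep_vars (\<lambda>_. borel) (\<lambda>i. W (C i)) {..<N}"
    using independent[OF assms(3,2)] by (rule indep_vars_subset) auto
  then have "distr M (Pi\<^sub>M {..<N} (\<lambda>_. borel)) (\<lambda>\<omega>. \<lambda>i\<in>{..<N}. W (C i) \<omega>)
      = Pi\<^sub>M {..<N} (\<lambda>i. distr M borel (W (C i)))"
    using assms by (subst (asm) indep_vars_iff_distr_eq_PiM) (auto intro!: W_measurable)
  also have "\<dots> = gaussP (\<lambda>i. measure lborel (C i)) {..<N}"
    using assms(3) by (intro PiM_cong refl W_distr) auto
  finally show ?thesis .
qed

lemma simple_I2_measurable:
  assumes "simple_data n A a"
  shows "simple_I2 W n A a \<in> borel_measurable M"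
proof -
  have [measurable]: "W (A k) \<in> borel_measurable M" if "k < n" for k
    using assms that by (auto simp: simple_data_def intro: W_measurable)
  have "(\<lambda>\<omega>. \<Sum>k<n. \<Sum>j<n. a k j * W (A k) \<omega> * W (A j) \<omega>) \<in> borel_measurable M"
    by (intro borel_measurable_sum borel_measurable_times) auto
  then show ?thesis by (simp add: simple_I2_def[abs_def])
qed

text \<open>The noise of \<open>A k\<close> is almost surely the sum of the noise of its cells.\<close>

lemma refine_simple_I2:
  assumes sd: "simple_data n A a" and ref: "refining N C \<A>" and sub: "A ` {..<n} \<subseteq> \<A>"
  shows "AE \<omega> in M. simple_I2 W N C (cell_coeff C (simple_fun2 n A a)) \<omega> = simple_I2 W n A a \<omega>"
proof -
  have C: "disjoint_family C" "range C \<subseteq> fin_borel" using ref by (auto simp: refining_def)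
  have "AE \<omega> in M. \<forall>k\<in>{..<n}. W (A k) \<omega> = (\<Sum>i<N. of_bool (C i \<subseteq> A k) * W (C i) \<omega>)"
  proof (intro AE_finite_allI)
    fix k assume k: "k \<in> {..<n}"
    have Ak: "A k \<subseteq> (\<Union>i<N. C i)" "\<And>i. i < N \<Longrightarrow> C i \<subseteq> A k \<or> C i \<inter> A k = {}"
      using ref sub k unfolding refining_def by (metis image_subset_iff)+
    have U: "(\<Union>i\<in>{i\<in>{..<N}. C i \<subseteq> A k}. C i) = A k"
    proof (intro equalityI subsetI)
      fix x assume x: "x \<in> A k"
      then obtain i where "i < N" "x \<in> C i" using Ak(1) by auto
      then show "x \<in> (\<Union>i\<in>{i\<in>{..<N}. C i \<subseteq> A k}. C i)" using Ak(2)[of i] x by auto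
    qed auto
    have S: "(\<Sum>i\<in>{i\<in>{..<N}. C i \<subseteq> A k}. W (C i) \<omega>) = (\<Sum>i<N. of_bool (C i \<subseteq> A k) * W (C i) \<omega>)" for \<omega>
      by (intro sum.mono_neutral_cong_left) auto
    show "AE \<omega> in M. W (A k) \<omega> = (\<Sum>i<N. of_bool (C i \<subseteq> A k) * W (C i) \<omega>)"
      using W_finite_union[of "{i\<in>{..<N}. C i \<subseteq> A k}" C] C unfolding U S by simp
  qed simp
  then show ?thesis
  proof eventually_elim
    case (elim \<omega>)
    have "simple_I2 W n A a \<omega> = (\<Sum>k<n. \<Sum>l<n. a k l *
       (\<Sum>i<N. of_bool (C i \<subseteq> A k) * W (C i) \<omega>) * (\<Sum>j<N. of_bool (C j \<subseteq> A l) * W (C j) \<omega>))"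
      unfolding simple_I2_def using elim by (intro sum.cong refl) auto
    also have "\<dots> = (\<Sum>k<n. \<Sum>l<n. \<Sum>i<N. \<Sum>j<N.
       a k l * (of_bool (C i \<subseteq> A k) * W (C i) \<omega>) * (of_bool (C j \<subseteq> A l) * W (C j) \<omega>))"
      by (simp only: sum_distrib_left sum_distrib_right) (intro sum.cong refl sum.swap)
    also have "\<dots> = (\<Sum>i<N. \<Sum>j<N. \<Sum>k<n. \<Sum>l<n.
       a k l * (of_bool (C i \<subseteq> A k) * W (C i) \<omega>) * (of_bool (C j \<subseteq> A l) * W (C j) \<omega>))"
      by (rule sum_swap_pairs)
    also have "\<dots> = (\<Sum>i<N. \<Sum>j<N. cell_coeff C (simple_fun2 n A a) i j * W (C i) \<omega> * W (C j) \<omega>)"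
    proof (intro sum.cong refl)
      fix i j assume "i \<in> {..<N}" "j \<in> {..<N}"
      then show "(\<Sum>k<n. \<Sum>l<n. a k l * (of_bool (C i \<subseteq> A k) * W (C i) \<omega>) * (of_bool (C j \<subseteq> A l) * W (C j) \<omega>))
         = cell_coeff C (simple_fun2 n A a) i j * W (C i) \<omega> * W (C j) \<omega>"
        by (subst refine_coeff[OF sd ref sub]) (simp_all only: sum_distrib_left sum_distrib_right lessThan_iff mult_ac)
    qed
    also have "\<dots> = simple_I2 W N C (cell_coeff C (simple_fun2 n A a)) \<omega>"
      by (simp add: simple_I2_def)
    finally show ?case by simp
  qed
qed

end

section \<open>Isometry and characteristic functions of simple double integrals\<close>

lemma simple_I2_diff: "simple_I2 W N C (\<lambda>i j. b i j - d i j) \<omega> = simple_I2 W N C b \<omega> - simple_I2 W N C d \<omega>"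
  by (simp add: simple_I2_def sum_subtractf left_diff_distrib)

lemma simple_fun2_diff: "simple_fun2 N C (\<lambda>i j. b i j - d i j) p = simple_fun2 N C b p - simple_fun2 N C d p"
  by (simp add: simple_fun2_def sum_subtractf left_diff_distrib split_beta)

lemma simple_data_diff:
  "simple_data N C b \<Longrightarrow> simple_data N C d \<Longrightarrow> simple_data N C (\<lambda>i j. b i j - d i j)"
  by (simp add: simple_data_def)

lemma simple_fun2_indicator:
  "simple_fun2 N C b p = (\<Sum>i<N. \<Sum>j<N. b i j * indicator (C i \<times> C j) p)"
  by (cases p) (simp add: simple_fun2_def indicator_times mult.assoc)

lemma simple_fun2_measurable:
  assumes "simple_data n A a"
  shows "simple_fun2 n A a \<in> borel_measurable lborel2"
proof -
  have A: "A k \<in> sets lborel" if "k < n" for k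
    using assms that by (auto simp: simple_data_def fin_borel_def)
  show ?thesis
    unfolding simple_fun2_indicator[abs_def]
    by (intro borel_measurable_sum borel_measurable_times borel_measurable_const
      borel_measurable_indicator pair_measureI A) auto
qed

lemma emeasure_cell:
  assumes "C \<in> fin_borel" "D \<in> fin_borel"
  shows "emeasure lborel2 (C \<times> D) = ennreal (measure lborel C * measure lborel D)"
  using assms by (subst lborel.emeasure_pair_measure_Times)
    (auto simp: fin_borel_sets fin_borel_emeasure ennreal_mult)

lemma refining_fin_borel: "refining N C \<A> \<Longrightarrow> C i \<in> fin_borel"
  by (auto simp: refining_def)

lemma nn_integral_simple_fun2_square:
  assumes ref: "refining N C \<A>"
  shows "(\<integral>\<^sup>+p. ennreal ((simple_fun2 N C b p)\<^sup>2) \<partial>lborel2)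
    = ennreal (\<Sum>i<N. \<Sum>j<N. (b i j)\<^sup>2 * measure lborel (C i) * measure lborel (C j))"
proof -
  have sq: "(simple_fun2 N C b p)\<^sup>2 = simple_fun2 N C (\<lambda>i j. (b i j)\<^sup>2) p" for p
  proof (cases p)
    case (Pair x y)
    show ?thesis
    proof (cases "x \<in> (\<Union>i<N. C i) \<and> y \<in> (\<Union>i<N. C i)")
      case True
      then obtain i j where "i < N" "j < N" "x \<in> C i" "y \<in> C j" by auto
      then have "simple_fun2 N C c (x, y) = c i j" for c
        using refining_disjoint[OF ref] by (intro simple_fun2_cells) auto
      then show ?thesis by (simp add: Pair)
    next
      case False
      then have "simple_fun2 N C c (x, y) = 0" for c by (intro simple_fun2_outside) blast
      then show ?thesis by (simp add: Pair)
    qed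
  qed
  have C: "C i \<in> fin_borel" for i by (rule refining_fin_borel[OF ref])
  then have [measurable]: "C i \<in> sets borel" for i by (simp add: fin_borel_sets)
  have "(\<integral>\<^sup>+p. ennreal ((simple_fun2 N C b p)\<^sup>2) \<partial>lborel2) =
    (\<integral>\<^sup>+p. (\<Sum>i<N. \<Sum>j<N. ennreal ((b i j)\<^sup>2) * indicator (C i \<times> C j) p) \<partial>lborel2)"
    unfolding sq
  proof (intro nn_integral_cong)
    fix p
    have "(\<Sum>i<N. \<Sum>j<N. ennreal ((b i j)\<^sup>2) * indicator (C i \<times> C j) p)
      = (\<Sum>i<N. \<Sum>j<N. ennreal ((b i j)\<^sup>2 * indicator (C i \<times> C j) p))"
      by (intro sum.cong refl) (auto split: split_indicator)
    also have "\<dots> = ennreal (simple_fun2 N C (\<lambda>i j. (b i j)\<^sup>2) p)"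
      unfolding simple_fun2_indicator
      by (simp only: sum_ennreal sum_nonneg zero_le_power2 mult_nonneg_nonneg indicator_pos_le)
    finally show "ennreal (simple_fun2 N C (\<lambda>i j. (b i j)\<^sup>2) p) =
      (\<Sum>i<N. \<Sum>j<N. ennreal ((b i j)\<^sup>2) * indicator (C i \<times> C j) p)" by simp
  qed
  also have "\<dots> = (\<Sum>i<N. \<integral>\<^sup>+p. (\<Sum>j<N. ennreal ((b i j)\<^sup>2) * indicator (C i \<times> C j) p) \<partial>lborel2)"
    by (intro nn_integral_sum) measurable
  also have "\<dots> = (\<Sum>i<N. \<Sum>j<N. \<integral>\<^sup>+p. ennreal ((b i j)\<^sup>2) * indicator (C i \<times> C j) p \<partial>lborel2)"
    by (intro sum.cong refl nn_integral_sum) measurable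
  also have "\<dots> = (\<Sum>i<N. \<Sum>j<N. ennreal ((b i j)\<^sup>2) * emeasure lborel2 (C i \<times> C j))"
    by (intro sum.cong refl nn_integral_cmult_indicator) measurable
  also have "\<dots> = (\<Sum>i<N. \<Sum>j<N. ennreal ((b i j)\<^sup>2 * measure lborel (C i) * measure lborel (C j)))"
    using C by (intro sum.cong refl) (simp add: emeasure_cell ennreal_mult[symmetric] mult.assoc)
  also have "\<dots> = ennreal (\<Sum>i<N. \<Sum>j<N. (b i j)\<^sup>2 * measure lborel (C i) * measure lborel (C j))"
    by (simp add: sum_nonneg sum_ennreal)
  finally show ?thesis .
qed

context white_noise
begin

lemma simple_I2_distr:
  assumes ref: "refining N C \<A>"
  shows "distr M borel (simple_I2 W N C b) =
    distr (gaussP (\<lambda>i. measure lborel (C i)) {..<N}) borel (\<lambda>x. \<Sum>i<N. \<Sum>j<N. b i j * x i * x j)"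
proof -
  let ?X = "\<lambda>\<omega>. \<lambda>i\<in>{..<N}. W (C i) \<omega>"
  have [measurable]: "W (C i) \<in> borel_measurable M" for i
    using refining_fin_borel[OF ref] by (rule W_measurable)
  have Q: "(\<lambda>x. \<Sum>i<N. \<Sum>j<N. b i j * x i * x j) \<in> borel_measurable (Pi\<^sub>M {..<N} (\<lambda>_. borel :: real measure))"
    by (intro borel_measurable_sum borel_measurable_times measurable_component_singleton) auto
  have "gaussP (\<lambda>i. measure lborel (C i)) {..<N} = distr M (Pi\<^sub>M {..<N} (\<lambda>_. borel)) ?X"
    using ref by (intro W_joint_distr[symmetric]) (auto simp: refining_def)
  also have "distr \<dots> borel (\<lambda>x. \<Sum>i<N. \<Sum>j<N. b i j * x i * x j) =
      distr M borel ((\<lambda>x. \<Sum>i<N. \<Sum>j<N. b i j * x i * x j) \<circ> ?X)"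
    by (intro distr_distr Q) measurable
  also have "(\<lambda>x. \<Sum>i<N. \<Sum>j<N. b i j * x i * x j) \<circ> ?X = simple_I2 W N C b"
    by (auto simp: simple_I2_def fun_eq_iff intro!: sum.cong)
  finally show ?thesis by simp
qed

lemma simple_I2_square:
  assumes ref: "refining N C \<A>" and sd: "simple_data N C b"
  shows "(\<integral>\<^sup>+\<omega>. ennreal ((simple_I2 W N C b \<omega>)\<^sup>2) \<partial>M)
    = 2 * (\<integral>\<^sup>+p. ennreal ((simple_fun2 N C b p)\<^sup>2) \<partial>lborel2)"
proof -
  let ?G = "gaussP (\<lambda>i. measure lborel (C i)) {..<N}"
  let ?Q = "\<lambda>x. \<Sum>i<N. \<Sum>j<N. b i j * x i * x j"
  note [measurable] = simple_I2_measurable[OF sd]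
  have [measurable]: "?Q \<in> borel_measurable ?G" by measurable
  have "(\<integral>\<^sup>+\<omega>. ennreal ((simple_I2 W N C b \<omega>)\<^sup>2) \<partial>M) =
      (\<integral>\<^sup>+y. ennreal (y\<^sup>2) \<partial>distr M borel (simple_I2 W N C b))"
    by (subst nn_integral_distr) auto
  also have "\<dots> = (\<integral>\<^sup>+x. ennreal ((?Q x)\<^sup>2) \<partial>?G)"
    unfolding simple_I2_distr[OF ref] by (subst nn_integral_distr) auto
  also have "\<dots> = ennreal (\<integral>x. (?Q x)\<^sup>2 \<partial>?G)"
    using sd by (intro nn_integral_eq_integral quadratic_second_moment) (auto simp: simple_data_def)
  also have "(\<integral>x. (?Q x)\<^sup>2 \<partial>?G) = 2 * (\<Sum>i<N. \<Sum>j<N. (b i j)\<^sup>2 * measure lborel (C i) * measure lborel (C j))"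
    using sd by (intro quadratic_second_moment) (auto simp: simple_data_def)
  finally show ?thesis
    unfolding nn_integral_simple_fun2_square[OF ref] by (simp add: ennreal_mult sum_nonneg)
qed

text \<open>Differences of simple integrals become single quadratic forms on a partition that also resolves
  prescribed test sets \<open>\<U>\<close>.\<close>

lemma common_refinement:
  assumes sd: "simple_data n1 A1 a1" "simple_data n2 A2 a2" and "finite \<U>" "\<U> \<subseteq> fin_borel"
  obtains N C b \<A> where "refining N C \<A>" "\<U> \<subseteq> \<A>" "simple_data N C b"
    "\<And>p. simple_fun2 N C b p = simple_fun2 n1 A1 a1 p - simple_fun2 n2 A2 a2 p"
    "AE \<omega> in M. simple_I2 W N C b \<omega> = simple_I2 W n1 A1 a1 \<omega> - simple_I2 W n2 A2 a2 \<omega>"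
proof -
  define \<A> where "\<A> = A1 ` {..<n1} \<union> A2 ` {..<n2} \<union> \<U>"
  have "finite \<A>" "\<A> \<subseteq> fin_borel" using assms by (auto simp: \<A>_def simple_data_def)
  then obtain N C where ref: "refining N C \<A>" using ex_refining by blast
  have sub: "A1 ` {..<n1} \<subseteq> \<A>" "A2 ` {..<n2} \<subseteq> \<A>" by (auto simp: \<A>_def)
  let ?c1 = "cell_coeff C (simple_fun2 n1 A1 a1)" and ?c2 = "cell_coeff C (simple_fun2 n2 A2 a2)"
  show ?thesis
  proof (rule that[OF ref, of "\<lambda>i j. ?c1 i j - ?c2 i j"])
    show "\<U> \<subseteq> \<A>" by (simp add: \<A>_def)
    show "simple_data N C (\<lambda>i j. ?c1 i j - ?c2 i j)"
      by (intro simple_data_diff refine_simple_data[OF sd(1) ref sub(1)] refine_simple_data[OF sd(2) ref sub(2)])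
    show "simple_fun2 N C (\<lambda>i j. ?c1 i j - ?c2 i j) p = simple_fun2 n1 A1 a1 p - simple_fun2 n2 A2 a2 p" for p
      unfolding simple_fun2_diff refine_simple_fun2[OF sd(1) ref sub(1)] refine_simple_fun2[OF sd(2) ref sub(2)] ..
    show "AE \<omega> in M. simple_I2 W N C (\<lambda>i j. ?c1 i j - ?c2 i j) \<omega> = simple_I2 W n1 A1 a1 \<omega> - simple_I2 W n2 A2 a2 \<omega>"
      using refine_simple_I2[OF sd(1) ref sub(1)] refine_simple_I2[OF sd(2) ref sub(2)]
      by eventually_elim (simp add: simple_I2_diff)
  qed
qed

text \<open>Stated for the difference of two simple kernels with unrelated partitions, as the Cauchy property
  of an approximating sequence requires.\<close>

lemma simple_I2_isometry:
  assumes sd: "simple_data n1 A1 a1" "simple_data n2 A2 a2"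
  shows "(\<integral>\<^sup>+\<omega>. ennreal ((simple_I2 W n1 A1 a1 \<omega> - simple_I2 W n2 A2 a2 \<omega>)\<^sup>2) \<partial>M) =
    2 * (\<integral>\<^sup>+p. ennreal ((simple_fun2 n1 A1 a1 p - simple_fun2 n2 A2 a2 p)\<^sup>2) \<partial>lborel2)"
proof -
  obtain N C b \<A> where *: "refining N C \<A>" "simple_data N C b"
    "\<And>p. simple_fun2 N C b p = simple_fun2 n1 A1 a1 p - simple_fun2 n2 A2 a2 p"
    "AE \<omega> in M. simple_I2 W N C b \<omega> = simple_I2 W n1 A1 a1 \<omega> - simple_I2 W n2 A2 a2 \<omega>"
    by (rule common_refinement[OF sd finite.emptyI empty_subsetI]) (rule that)
  have "(\<integral>\<^sup>+\<omega>. ennreal ((simple_I2 W n1 A1 a1 \<omega> - simple_I2 W n2 A2 a2 \<omega>)\<^sup>2) \<partial>M)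
      = (\<integral>\<^sup>+\<omega>. ennreal ((simple_I2 W N C b \<omega>)\<^sup>2) \<partial>M)"
    by (intro nn_integral_cong_AE eventually_mono[OF *(4)]) simp
  then show ?thesis by (simp add: simple_I2_square[OF *(1,2)] *(3))
qed

text \<open>On a partition that resolves the test sets, the matrix of integrals over \<open>U r \<times> V q\<close> is the block
  matrix of the quadratic form. The cells in the union of the sets \<open>U r\<close> form the group \<open>x\<close>, all other cells
  the group \<open>y\<close>.\<close>

lemma simple_I2_char_bound:
  fixes U V :: "'r \<Rightarrow> real set"
  assumes sd: "simple_data n1 A1 a1" "simple_data n2 A2 a2" and R: "finite R"
    and fb: "\<And>r. r \<in> R \<Longrightarrow> U r \<in> fin_borel" "\<And>r. r \<in> R \<Longrightarrow> V r \<in> fin_borel"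
    and len: "\<And>r. r \<in> R \<Longrightarrow> measure lborel (U r) = \<rho>" "\<And>r. r \<in> R \<Longrightarrow> measure lborel (V r) = \<rho>"
    and \<rho>: "\<rho> > 0"
    and disj: "disjoint_family_on U R" "disjoint_family_on V R"
      "\<And>r q. r \<in> R \<Longrightarrow> q \<in> R \<Longrightarrow> U r \<inter> V q = {}"
    and B: "\<And>r q. r \<in> R \<Longrightarrow> q \<in> R \<Longrightarrow> B r q = (\<integral>p. indicator (U r \<times> V q) p *
        (simple_fun2 n1 A1 a1 p - simple_fun2 n2 A2 a2 p) \<partial>lborel2) / \<rho>"
    and nondeg: "\<And>\<eta>. (\<Sum>r\<in>R. (\<Sum>q\<in>R. B r q * \<eta> q)\<^sup>2) \<ge> \<sigma>\<^sup>2 * (\<Sum>q\<in>R. (\<eta> q)\<^sup>2)"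
  shows "(cmod (\<integral>\<omega>. iexp (z * (simple_I2 W n1 A1 a1 \<omega> - simple_I2 W n2 A2 a2 \<omega>)) \<partial>M))\<^sup>2
    \<le> (1 + 8 * z\<^sup>2 * \<sigma>\<^sup>2) powr (- (real (card R) / 2))"
proof -
  have fin: "finite (U ` R \<union> V ` R)" "U ` R \<union> V ` R \<subseteq> fin_borel" using R fb by auto
  obtain N C b \<A> where ref: "refining N C \<A>" and UV: "U ` R \<union> V ` R \<subseteq> \<A>" and sdb: "simple_data N C b"
    and fun_eq: "\<And>p. simple_fun2 N C b p = simple_fun2 n1 A1 a1 p - simple_fun2 n2 A2 a2 p"
    and I2_eq: "AE \<omega> in M. simple_I2 W N C b \<omega> = simple_I2 W n1 A1 a1 \<omega> - simple_I2 W n2 A2 a2 \<omega>"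
    by (rule common_refinement[OF sd fin]) (rule that)
  define v where "v i = measure lborel (C i)" for i
  define cells where "cells S = {i. i < N \<and> C i \<subseteq> S}" for S
  define P where "P = (\<Union>r\<in>R. cells (U r))"
  define Q where "Q = {..<N} - P"
  have PQ: "P \<union> Q = {..<N}" "P \<inter> Q = {}" "finite P" "finite Q"
    by (auto simp: P_def Q_def cells_def intro: finite_subset[of _ "{..<N}"])
  have C: "C i \<in> fin_borel" for i by (rule refining_fin_borel[OF ref])
  then have [measurable]: "C i \<in> sets borel" for i by (simp add: fin_borel_sets)
  have ne: "C i \<noteq> {}" if "i < N" for i using ref that by (auto simp: refining_def)
  have cells_disj: "cells S \<inter> cells S' = {}" if "S \<inter> S' = {}" for S S'
    using that ne by (fastforce simp: cells_def)
  have cells_eq: "(\<Union>i\<in>cells S. C i) = S" and cells_split: "\<And>i. i < N \<Longrightarrow> C i \<subseteq> S \<or> C i \<inter> S = {}"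
    if "S \<in> \<A>" for S
  proof -
    have S: "S \<subseteq> (\<Union>i<N. C i)" "\<And>i. i < N \<Longrightarrow> C i \<subseteq> S \<or> C i \<inter> S = {}"
      using ref that by (auto simp: refining_def)
    show "C i \<subseteq> S \<or> C i \<inter> S = {}" if "i < N" for i using S(2) that .
    show "(\<Union>i\<in>cells S. C i) = S"
    proof (intro equalityI subsetI)
      fix x assume x: "x \<in> S"
      then obtain i where "i < N" "x \<in> C i" using S(1) by auto
      then show "x \<in> (\<Union>i\<in>cells S. C i)" using S(2)[of i] x by (auto simp: cells_def)
    qed (auto simp: cells_def)
  qed
  have cells_len: "(\<Sum>i\<in>cells S. v i) = measure lborel S" if "S \<in> \<A>" for S
  proof -
    have "measure lborel (\<Union>i\<in>cells S. C i) = (\<Sum>i\<in>cells S. v i)"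
      unfolding v_def
    proof (rule measure_finite_Union)
      show "disjoint_family_on C (cells S)"
        using ref by (auto simp: refining_def disjoint_family_on_def)
      show "emeasure lborel (C i) \<noteq> \<infinity>" for i using C[of i] by (auto simp: fin_borel_def)
    qed (auto simp: cells_def)
    then show ?thesis using cells_eq[OF that] by simp
  qed
  have integral: "(\<integral>p. indicator (S \<times> S') p * (simple_fun2 n1 A1 a1 p - simple_fun2 n2 A2 a2 p) \<partial>lborel2)
      = (\<Sum>i\<in>cells S. \<Sum>j\<in>cells S'. b i j * v i * v j)" if S: "S \<in> \<A>" "S' \<in> \<A>" for S S'
  proof -
    have *: "indicator (S \<times> S') p * (simple_fun2 n1 A1 a1 p - simple_fun2 n2 A2 a2 p) =
      (\<Sum>i\<in>cells S. \<Sum>j\<in>cells S'. b i j * indicator (C i \<times> C j) p)" for p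
    proof -
      have i: "indicator S x * indicator (C i) x = (of_bool (C i \<subseteq> S) * indicator (C i) x :: real)"
        if "S \<in> \<A>" "i < N" for S i x using cells_split[OF that] by (auto simp: indicator_def)
      have "indicator (S \<times> S') p * (simple_fun2 n1 A1 a1 p - simple_fun2 n2 A2 a2 p) =
        (\<Sum>i<N. \<Sum>j<N. b i j * (indicator S (fst p) * indicator (C i) (fst p)) * (indicator S' (snd p) * indicator (C j) (snd p)))"
        unfolding fun_eq[symmetric] unfolding simple_fun2_indicator sum_distrib_left
        by (intro sum.cong refl) (cases p, simp add: indicator_times ac_simps)
      also have "\<dots> = (\<Sum>i<N. \<Sum>j<N. of_bool (C i \<subseteq> S) * (of_bool (C j \<subseteq> S') * (b i j * indicator (C i \<times> C j) p)))"
        using S by (intro sum.cong refl) (simp add: i, cases p, simp add: indicator_times)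
      also have "\<dots> = (\<Sum>i<N. of_bool (C i \<subseteq> S) * (\<Sum>j<N. of_bool (C j \<subseteq> S') * (b i j * indicator (C i \<times> C j) p)))"
        by (simp only: sum_distrib_left)
      also have "\<dots> = (\<Sum>i\<in>cells S. \<Sum>j<N. of_bool (C j \<subseteq> S') * (b i j * indicator (C i \<times> C j) p))"
        by (intro sum.mono_neutral_cong_right) (auto simp: cells_def)
      also have "\<dots> = (\<Sum>i\<in>cells S. \<Sum>j\<in>cells S'. b i j * indicator (C i \<times> C j) p)"
        by (intro sum.cong[OF refl] sum.mono_neutral_cong_right) (auto simp: cells_def)
      finally show ?thesis .
    qed
    have int: "has_bochner_integral lborel2 (indicator (C i \<times> C j)) (v i * v j)" for i j
      using emeasure_cell[OF C[of i] C[of j]]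
      by (subst has_bochner_integral_iff)
        (auto simp: v_def measure_def less_top[symmetric])
    show ?thesis unfolding *
      by (intro has_bochner_integral_integral_eq has_bochner_integral_sum)
        (auto simp: mult.assoc intro!: has_bochner_integral_mult_right int)
  qed
  have U\<A>: "U r \<in> \<A>" "V r \<in> \<A>" if "r \<in> R" for r using UV that by auto
  let ?Q = "\<lambda>x. \<Sum>i<N. \<Sum>j<N. b i j * x i * x j"
  note [measurable] = simple_I2_measurable[OF sdb] simple_I2_measurable[OF sd(1)] simple_I2_measurable[OF sd(2)]
  have [measurable]: "?Q \<in> borel_measurable (gaussP v {..<N})" by measurable
  have "(\<integral>\<omega>. iexp (z * (simple_I2 W n1 A1 a1 \<omega> - simple_I2 W n2 A2 a2 \<omega>)) \<partial>M)
    = (\<integral>\<omega>. iexp (z * simple_I2 W N C b \<omega>) \<partial>M)"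
    using I2_eq by (intro integral_cong_AE) (measurable, auto)
  also have "\<dots> = (\<integral>y. iexp (z * y) \<partial>distr M borel (simple_I2 W N C b))"
    by (subst integral_distr) auto
  also have "\<dots> = (\<integral>x. iexp (z * ?Q x) \<partial>gaussP v {..<N})"
    unfolding simple_I2_distr[OF ref] v_def[symmetric] by (subst integral_distr) auto
  also have "(cmod \<dots>)\<^sup>2 \<le> (1 + 8 * z\<^sup>2 * \<sigma>\<^sup>2) powr (- (real (card R) / 2))"
  proof -
    have "(cmod (\<integral>x. iexp (z * (\<Sum>i\<in>P\<union>Q. \<Sum>j\<in>P\<union>Q. b i j * x i * x j)) \<partial>gaussP v (P \<union> Q)))\<^sup>2
      \<le> (1 + 8 * z\<^sup>2 * \<sigma>\<^sup>2) powr (- (real (card R) / 2))"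
    proof (rule quadratic_chaos_char_bound[where U="\<lambda>r. cells (U r)" and V="\<lambda>r. cells (V r)" and \<rho>=\<rho>])
      show "b i j = b j i" if "i \<in> P \<union> Q" "j \<in> P \<union> Q" for i j
        using that sdb unfolding PQ by (auto simp: simple_data_def)
      show "disjoint_family_on (\<lambda>r. cells (U r)) R" "disjoint_family_on (\<lambda>r. cells (V r)) R"
        using disj(1,2) unfolding disjoint_family_on_def by (intro ballI impI cells_disj; simp)+
      show "cells (U r) \<subseteq> P" if "r \<in> R" for r using that by (auto simp: P_def)
      show "cells (V r) \<subseteq> Q" if "r \<in> R" for r
      proof -
        have *: "cells (U r') \<inter> cells (V r) = {}" if "r' \<in> R" for r'
          by (intro cells_disj disj(3) that \<open>r \<in> R\<close>)
        show ?thesis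
        proof
          fix i assume i: "i \<in> cells (V r)"
          then have "i \<notin> P" using * unfolding P_def by blast
          then show "i \<in> Q" using i by (simp add: Q_def cells_def)
        qed
      qed
      show "\<sigma>\<^sup>2 * (\<Sum>q\<in>R. (\<eta> q)\<^sup>2) \<le> (\<Sum>r\<in>R. (\<Sum>q\<in>R. (\<Sum>i\<in>cells (U r). \<Sum>j\<in>cells (V q). b i j * v i * v j) / \<rho> * \<eta> q)\<^sup>2)" for \<eta>
      proof -
        have "(\<Sum>r\<in>R. (\<Sum>q\<in>R. (\<Sum>i\<in>cells (U r). \<Sum>j\<in>cells (V q). b i j * v i * v j) / \<rho> * \<eta> q)\<^sup>2)
          = (\<Sum>r\<in>R. (\<Sum>q\<in>R. B r q * \<eta> q)\<^sup>2)"
          by (intro sum.cong refl arg_cong[where f="\<lambda>x. x\<^sup>2"]) (simp add: B integral U\<A>)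
        then show ?thesis using nondeg by simp
      qed
    qed (use PQ R \<rho> len U\<A> cells_len in \<open>auto simp: v_def\<close>)
    then show ?thesis by (simp only: PQ)
  qed
  finally show ?thesis .
qed

end

section \<open>The kernel of the generalized Rosenblatt process\<close>

lemma AE_off_diagonal: "AE q in lborel2. fst q \<noteq> (snd q :: real)"
proof (rule lborel_pair.AE_pair_measure)
  show "{q \<in> space lborel2. fst q \<noteq> (snd q :: real)} \<in> sets lborel2"
    by (rule borel_measurable_neq) measurable
  have "AE y in lborel. x \<noteq> y" for x :: real
    using AE_lborel_singleton[of x] by eventually_elim auto
  then show "AE x in lborel. AE y in lborel. fst (x, y) \<noteq> (snd (x, y) :: real)" by simp
qed

lemma pos_powr_nonneg [simp]: "pos_powr u a \<ge> 0"
  by (simp add: pos_powr_def)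

lemma pos_powr_measurable [measurable (raw)]:
  assumes [measurable]: "f \<in> borel_measurable M"
  shows "(\<lambda>x. pos_powr (f x) a) \<in> borel_measurable M"
  unfolding pos_powr_def by measurable

text \<open>One of the two terms of the kernel, with values in the extended half-line so that the divergence on
  the diagonal is visible and Tonelli's theorem applies.\<close>

definition powr_overlap :: "real \<Rightarrow> real \<Rightarrow> real \<Rightarrow> real \<times> real \<Rightarrow> ennreal"
  where "powr_overlap a b t p =
    (\<integral>\<^sup>+s. ennreal (pos_powr (s - fst p) a * pos_powr (s - snd p) b) * indicator {0..t} s \<partial>lborel)"

lemma powr_overlap_measurable [measurable]: "powr_overlap a b t \<in> borel_measurable lborel2"
  unfolding powr_overlap_def by measurable

lemma powr_overlap_swap: "powr_overlap a b t (x, y) = powr_overlap b a t (y, x)"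
  by (simp add: powr_overlap_def mult.commute)

lemma powr_overlap_eq_0: "t \<le> x \<or> t \<le> y \<Longrightarrow> powr_overlap a b t (x, y) = 0"
  unfolding powr_overlap_def by (intro nn_integral_zero') (auto simp: pos_powr_def indicator_def)

lemma kernel_integral_eq_overlap:
  "(LBINT s:{0..t}. rosenblatt_kernel h1 h2 s x y) =
    enn2real (powr_overlap (h1/2 - 1) (h2/2 - 1) t (x, y) + powr_overlap (h2/2 - 1) (h1/2 - 1) t (x, y))"
proof -
  have "(LBINT s:{0..t}. rosenblatt_kernel h1 h2 s x y) =
      enn2real (\<integral>\<^sup>+s. ennreal (indicator {0..t} s * rosenblatt_kernel h1 h2 s x y) \<partial>lborel)"
    unfolding set_lebesgue_integral_def real_scaleR_def
    by (intro integral_eq_nn_integral) (auto simp: rosenblatt_kernel_def)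
  also have "(\<integral>\<^sup>+s. ennreal (indicator {0..t} s * rosenblatt_kernel h1 h2 s x y) \<partial>lborel) =
     (\<integral>\<^sup>+s. ennreal (pos_powr (s - x) (h1/2 - 1) * pos_powr (s - y) (h2/2 - 1)) * indicator {0..t} s +
       ennreal (pos_powr (s - x) (h2/2 - 1) * pos_powr (s - y) (h1/2 - 1)) * indicator {0..t} s \<partial>lborel)"
    by (intro nn_integral_cong) (auto simp: rosenblatt_kernel_def split: split_indicator)
  also have "\<dots> = powr_overlap (h1/2 - 1) (h2/2 - 1) t (x, y) + powr_overlap (h2/2 - 1) (h1/2 - 1) t (x, y)"
    unfolding powr_overlap_def by (subst nn_integral_add) auto
  finally show ?thesis .
qed

lemma nn_integral_powr_0:
  assumes "c > -1" "t \<ge> 0"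
  shows "(\<integral>\<^sup>+r. ennreal (r powr c) * indicator {0..t} r \<partial>lborel) = ennreal (t powr (c + 1) / (c + 1))"
  using has_integral_powr_from_0[OF assms] by (intro nn_integral_has_integral_lebesgue') auto

lemma nn_integral_powr_inf:
  assumes "c < -1" "t > 0"
  shows "(\<integral>\<^sup>+r. ennreal (r powr c) * indicator {t..} r \<partial>lborel) = ennreal (- (t powr (c + 1)) / (c + 1))"
  using has_integral_powr_to_inf[OF assms] by (intro nn_integral_has_integral_lebesgue') auto

lemma nn_integral_pos_powr:
  assumes "c > -1"
  shows "(\<integral>\<^sup>+s. ennreal (pos_powr (s - y) c) * indicator {..t} s \<partial>lborel) = ennreal (pos_powr (t - y) (c + 1) / (c + 1))"
proof -
  have "(\<integral>\<^sup>+s. ennreal (pos_powr (s - y) c) * indicator {..t} s \<partial>lborel) =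
     (\<integral>\<^sup>+r. ennreal (pos_powr r c) * indicator {..t} (y + r) \<partial>lborel)"
    by (subst nn_integral_real_affine[where c=1 and t=y]) auto
  also have "\<dots> = ennreal (pos_powr (t - y) (c + 1) / (c + 1))"
  proof (cases "t > y")
    case True
    have "(\<integral>\<^sup>+r. ennreal (pos_powr r c) * indicator {..t} (y + r) \<partial>lborel) =
       (\<integral>\<^sup>+r. ennreal (r powr c) * indicator {0..t - y} r \<partial>lborel)"
      by (intro nn_integral_cong) (auto simp: pos_powr_def split: split_indicator)
    then show ?thesis using True assms by (simp add: nn_integral_powr_0 pos_powr_def)
  next
    case False
    have "(\<integral>\<^sup>+r. ennreal (pos_powr r c) * indicator {..t} (y + r) \<partial>lborel) = 0"
      using False by (intro nn_integral_zero') (auto simp: pos_powr_def split: split_indicator)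
    then show ?thesis using False by (simp add: pos_powr_def)
  qed
  finally show ?thesis .
qed

lemma powr_antimono: "c \<le> 0 \<Longrightarrow> 0 < u \<Longrightarrow> u \<le> v \<Longrightarrow> v powr c \<le> (u::real) powr c"
  by (rule powr_mono2')

text \<open>The factor with the smaller base point \<open>x\<close> is largest at \<open>s = y\<close>; the other one is integrated.\<close>

lemma powr_overlap_upper:
  assumes a: "a \<le> 0" and b: "b > -1" and xy: "x < y"
  shows "powr_overlap a b t (x, y) \<le> ennreal ((y - x) powr a * (pos_powr (t - y) (b + 1) / (b + 1)))"
proof -
  have "powr_overlap a b t (x, y) \<le> (\<integral>\<^sup>+s. ennreal ((y - x) powr a) * (ennreal (pos_powr (s - y) b) * indicator {..t} s) \<partial>lborel)"
    unfolding powr_overlap_def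
  proof (intro nn_integral_mono)
    fix s
    have "pos_powr (s - x) a * pos_powr (s - y) b \<le> (y - x) powr a * pos_powr (s - y) b"
      using xy powr_antimono[OF a, of "y - x" "s - x"] by (auto simp: pos_powr_def intro!: mult_right_mono)
    then show "ennreal (pos_powr (s - fst (x, y)) a * pos_powr (s - snd (x, y)) b) * indicator {0..t} s
      \<le> ennreal ((y - x) powr a) * (ennreal (pos_powr (s - y) b) * indicator {..t} s)"
      by (auto simp: ennreal_mult[symmetric] intro!: ennreal_leI split: split_indicator)
  qed
  also have "\<dots> = ennreal ((y - x) powr a * (pos_powr (t - y) (b + 1) / (b + 1)))"
    using b by (simp add: nn_integral_cmult nn_integral_pos_powr ennreal_mult[symmetric])
  finally show ?thesis .
qed

text \<open>Only \<open>s\<close> in \<open>(y, y + l]\<close> is kept, where both bases are at most \<open>3 l\<close>.\<close>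

lemma powr_overlap_lower:
  assumes a: "a \<le> 0" and b: "b \<le> 0" and xy: "x < y" "y \<le> x + 2 * l" "0 \<le> y" "y + l \<le> t"
  shows "powr_overlap a b t (x, y) \<ge> ennreal (l * (3 * l) powr (a + b))"
proof -
  have l: "l > 0" using xy by linarith
  have "ennreal (l * (3 * l) powr (a + b)) = (\<integral>\<^sup>+s. ennreal ((3 * l) powr (a + b)) * indicator {y<..y + l} s \<partial>lborel)"
    using l by (subst nn_integral_cmult_indicator) (auto simp: ennreal_mult[symmetric] ac_simps)
  also have "\<dots> \<le> powr_overlap a b t (x, y)"
    unfolding powr_overlap_def
  proof (intro nn_integral_mono)
    fix s
    have "(3 * l) powr (a + b) \<le> pos_powr (s - x) a * pos_powr (s - y) b" if "y < s" "s \<le> y + l"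
      using that xy powr_antimono[OF a, of "s - x" "3 * l"] powr_antimono[OF b, of "s - y" "3 * l"]
      by (auto simp: pos_powr_def powr_add intro!: mult_mono)
    then show "ennreal ((3 * l) powr (a + b)) * indicator {y<..y + l} s \<le>
       ennreal (pos_powr (s - fst (x, y)) a * pos_powr (s - snd (x, y)) b) * indicator {0..t} s"
      using xy by (auto intro!: ennreal_leI split: split_indicator)
  qed
  finally show ?thesis .
qed

text \<open>For fixed \<open>s\<close> the integrand is continuous at the point \<open>p\<close> unless \<open>s\<close> is one of its coordinates.\<close>

lemma powr_overlap_lsc:
  assumes X: "X \<longlonglongrightarrow> p"
  shows "powr_overlap a b t p \<le> liminf (\<lambda>n. powr_overlap a b t (X n))"
proof -
  have "powr_overlap a b t p \<le> (\<integral>\<^sup>+s. liminf (\<lambda>n. ennreal (pos_powr (s - fst (X n)) a * pos_powr (s - snd (X n)) b) * indicator {0..t} s) \<partial>lborel)"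
    unfolding powr_overlap_def
  proof (intro nn_integral_mono_AE)
    have lim: "(\<lambda>n. pos_powr (s - f n) c) \<longlonglongrightarrow> pos_powr (s - u) c"
      if f: "f \<longlonglongrightarrow> u" and s: "s \<noteq> u" for f s u c
    proof (cases "s > u")
      case True
      have "\<forall>\<^sub>F n in sequentially. f n < s" using f True by (rule order_tendstoD)
      then have "\<forall>\<^sub>F n in sequentially. pos_powr (s - f n) c = (s - f n) powr c"
        by eventually_elim (simp add: pos_powr_def)
      moreover have "(\<lambda>n. (s - f n) powr c) \<longlonglongrightarrow> (s - u) powr c"
        using True by (intro tendsto_intros f) auto
      ultimately show ?thesis using True by (simp add: pos_powr_def tendsto_cong)
    next
      case False
      then have "\<forall>\<^sub>F n in sequentially. f n > s" using f s by (intro order_tendstoD) auto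
      then have "\<forall>\<^sub>F n in sequentially. pos_powr (s - f n) c = 0"
        by eventually_elim (simp add: pos_powr_def)
      then show ?thesis using False s by (simp add: pos_powr_def tendsto_eventually)
    qed
    have "AE s in lborel. s \<noteq> fst p" "AE s in lborel. s \<noteq> snd p" by (rule AE_lborel_singleton)+
    then show "AE s in lborel. ennreal (pos_powr (s - fst p) a * pos_powr (s - snd p) b) * indicator {0..t} s
      \<le> liminf (\<lambda>n. ennreal (pos_powr (s - fst (X n)) a * pos_powr (s - snd (X n)) b) * indicator {0..t} s)"
    proof eventually_elim
      case (elim s)
      have "(\<lambda>n. ennreal (pos_powr (s - fst (X n)) a * pos_powr (s - snd (X n)) b))
        \<longlonglongrightarrow> ennreal (pos_powr (s - fst p) a * pos_powr (s - snd p) b)"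
        using elim X by (intro tendsto_ennrealI tendsto_mult lim tendsto_fst tendsto_snd)
      then have "(\<lambda>n. ennreal (pos_powr (s - fst (X n)) a * pos_powr (s - snd (X n)) b) * indicator {0..t} s)
        \<longlonglongrightarrow> ennreal (pos_powr (s - fst p) a * pos_powr (s - snd p) b) * indicator {0..t} s"
        by (auto split: split_indicator)
      then show ?case by (simp add: lim_imp_Liminf)
    qed
  qed
  also have "\<dots> \<le> liminf (\<lambda>n. powr_overlap a b t (X n))"
    unfolding powr_overlap_def by (intro nn_integral_liminf) measurable
  finally show ?thesis .
qed

text \<open>The part on each side of \<open>s\<close> is at most the integral of \<open>r powr c\<close> over \<open>[0, t]\<close>.\<close>

lemma nn_integral_abs_powr:
  assumes c: "c > -1" and s: "s \<in> {0..t}"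
  shows "(\<integral>\<^sup>+s'. ennreal (\<bar>s - s'\<bar> powr c) * indicator {0..t} s' \<partial>lborel) \<le> ennreal (2 * (t powr (c + 1) / (c + 1)))"
proof -
  have t: "t \<ge> 0" using s by auto
  have "(\<integral>\<^sup>+s'. ennreal (\<bar>s - s'\<bar> powr c) * indicator {0..t} s' \<partial>lborel)
     \<le> (\<integral>\<^sup>+s'. ennreal (pos_powr (s' - s) c) * indicator {..t} s' + ennreal (pos_powr (s - s') c) * indicator {0..} s' \<partial>lborel)"
    by (intro nn_integral_mono) (auto simp: pos_powr_def abs_if split: split_indicator)
  also have "\<dots> = (\<integral>\<^sup>+s'. ennreal (pos_powr (s' - s) c) * indicator {..t} s' \<partial>lborel) +
     (\<integral>\<^sup>+s'. ennreal (pos_powr (s - s') c) * indicator {0..} s' \<partial>lborel)"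
    by (intro nn_integral_add) auto
  also have "(\<integral>\<^sup>+s'. ennreal (pos_powr (s - s') c) * indicator {0..} s' \<partial>lborel) =
     (\<integral>\<^sup>+s'. ennreal (pos_powr (s' - 0) c) * indicator {..s} s' \<partial>lborel)"
    by (subst nn_integral_real_affine[where c="-1" and t=s]) (auto intro!: nn_integral_cong split: split_indicator)
  also have "(\<integral>\<^sup>+s'. ennreal (pos_powr (s' - s) c) * indicator {..t} s' \<partial>lborel) +
      (\<integral>\<^sup>+s'. ennreal (pos_powr (s' - 0) c) * indicator {..s} s' \<partial>lborel) =
      ennreal (pos_powr (t - s) (c + 1) / (c + 1) + pos_powr (s - 0) (c + 1) / (c + 1))"
    using c by (simp only: nn_integral_pos_powr) (simp add: ennreal_plus[symmetric] del: ennreal_plus)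
  also have "\<dots> \<le> ennreal (2 * (t powr (c + 1) / (c + 1)))"
  proof (intro ennreal_leI)
    have "pos_powr u (c + 1) \<le> t powr (c + 1)" if "u \<le> t" for u
      using that c by (auto simp: pos_powr_def intro!: powr_mono2)
    from this[of "t - s"] this[of s] s c
    show "pos_powr (t - s) (c + 1) / (c + 1) + pos_powr (s - 0) (c + 1) / (c + 1) \<le> 2 * (t powr (c + 1) / (c + 1))"
      by (simp add: add_divide_distrib[symmetric] divide_right_mono)
  qed
  finally show ?thesis .
qed

text \<open>With \<open>r = s - x\<close> and \<open>d = s' - s\<close> the integrand is \<open>r powr a * (r + d) powr a\<close>. For \<open>r \<le> d\<close> the second
  factor is at most \<open>d powr a\<close>, for \<open>r \<ge> d\<close> it is at most \<open>r powr a\<close>; both resulting integrals converge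
  for exponents between \<open>-1\<close> and \<open>-1/2\<close>.\<close>

lemma pos_powr_correlation:
  assumes a: "-1 < a" "a < - 1 / 2" and ss: "s < s'"
  shows "(\<integral>\<^sup>+x. ennreal (pos_powr (s - x) a * pos_powr (s' - x) a) \<partial>lborel)
    \<le> ennreal ((1 / (a + 1) - 1 / (2 * a + 1)) * (s' - s) powr (2 * a + 1))"
proof -
  define d where "d = s' - s"
  have d: "d > 0" using ss by (simp add: d_def)
  have "(\<integral>\<^sup>+x. ennreal (pos_powr (s - x) a * pos_powr (s' - x) a) \<partial>lborel)
     = (\<integral>\<^sup>+r. ennreal (pos_powr r a * pos_powr (d + r) a) \<partial>lborel)"
    by (subst nn_integral_real_affine[where c="-1" and t=s]) (auto simp: d_def)
  also have "\<dots> \<le> (\<integral>\<^sup>+r. ennreal (d powr a) * (ennreal (r powr a) * indicator {0..d} r) + ennreal (r powr (2 * a)) * indicator {d..} r \<partial>lborel)"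
  proof (intro nn_integral_mono)
    fix r
    have "pos_powr r a * pos_powr (d + r) a \<le> d powr a * r powr a" if "0 < r"
      using that d a powr_antimono[of a d "d + r"] by (auto simp: pos_powr_def mult.commute intro!: mult_right_mono)
    moreover have "pos_powr r a * pos_powr (d + r) a \<le> r powr (2 * a)" if "d \<le> r"
    proof -
      have "pos_powr r a * pos_powr (d + r) a \<le> r powr a * r powr a"
        using that d a powr_antimono[of a r "d + r"] by (auto simp: pos_powr_def intro!: mult_left_mono)
      then show ?thesis by (simp add: powr_add[symmetric])
    qed
    ultimately show "ennreal (pos_powr r a * pos_powr (d + r) a) \<le>
       ennreal (d powr a) * (ennreal (r powr a) * indicator {0..d} r) + ennreal (r powr (2 * a)) * indicator {d..} r"
      by (cases "r \<le> 0"; cases "d \<le> r")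
        (auto simp: pos_powr_def ennreal_mult[symmetric] intro!: ennreal_leI split: split_indicator
         intro: add_increasing)
  qed
  also have "\<dots> = ennreal (d powr a) * (\<integral>\<^sup>+r. ennreal (r powr a) * indicator {0..d} r \<partial>lborel) +
      (\<integral>\<^sup>+r. ennreal (r powr (2 * a)) * indicator {d..} r \<partial>lborel)"
    by (subst nn_integral_add) (auto simp: nn_integral_cmult)
  also have "\<dots> = ennreal (d powr a * (d powr (a + 1) / (a + 1)) + - (d powr (2 * a + 1)) / (2 * a + 1))"
  proof -
    have e: "ennreal u * ennreal v + ennreal w = ennreal (u * v + w)" if "u \<ge> 0" "v \<ge> 0" "w \<ge> 0" for u v w
      using that by (simp add: ennreal_mult)
    have "2 * a < -1" using a by simp
    then show ?thesis
      using a d by (simp only: nn_integral_powr_0 nn_integral_powr_inf less_imp_le)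
        (rule e, simp, simp, rule divide_nonpos_neg, auto)
  qed
  also have "d powr a * (d powr (a + 1) / (a + 1)) + - (d powr (2 * a + 1)) / (2 * a + 1)
     = (1 / (a + 1) - 1 / (2 * a + 1)) * d powr (2 * a + 1)"
  proof -
    have "d powr a * d powr (a + 1) = d powr (2 * a + 1)" by (simp add: powr_add[symmetric])
    then show ?thesis by (simp add: left_diff_distrib)
  qed
  finally show ?thesis by (simp add: d_def)
qed

lemma pos_powr_correlation_abs:
  assumes a: "-1 < a" "a < - 1 / 2" and ss: "s \<noteq> s'"
  shows "(\<integral>\<^sup>+x. ennreal (pos_powr (s - x) a * pos_powr (s' - x) a) \<partial>lborel)
    \<le> ennreal ((1 / (a + 1) - 1 / (2 * a + 1)) * \<bar>s - s'\<bar> powr (2 * a + 1))"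
  using pos_powr_correlation[OF a, of s s'] pos_powr_correlation[OF a, of s' s] ss
  by (cases "s < s'") (simp_all add: abs_if mult.commute)

text \<open>Write the square as a double integral in \<open>(s, s')\<close> and integrate over \<open>x\<close> and \<open>y\<close> first. The result is a
  product of two correlations, of order \<open>\<bar>s - s'\<bar> powr (2a + 2b + 2)\<close>, and the exponent exceeds \<open>-1\<close>
  because \<open>a\<close> and \<open>b\<close> exceed \<open>-3/4\<close>.\<close>

lemma powr_overlap_square_integrable:
  assumes a: "- 3 / 4 < a" "a < - 1 / 2" and b: "- 3 / 4 < b" "b < - 1 / 2"
  shows "(\<integral>\<^sup>+p. (powr_overlap a b t p)\<^sup>2 \<partial>lborel2) < \<infinity>"
proof (cases "t \<ge> 0")
  case False
  then have "powr_overlap a b t p = 0" for p by (simp add: powr_overlap_def)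
  then show ?thesis by simp
next
  case t: True
  interpret LL: pair_sigma_finite "lborel2" "lborel2"
    by (intro pair_sigma_finite.intro sigma_finite_pair_measure lborel.sigma_finite_measure_axioms)
  define I where "I s = (indicator {0..t} s :: ennreal)" for s :: real
  have [measurable]: "I \<in> borel_measurable borel" unfolding I_def by measurable
  \<comment> \<open>the variables are \<open>q = (s, s')\<close> and \<open>p = (x, y)\<close>\<close>
  define F where "F q p = ennreal (pos_powr (fst q - fst p) a * pos_powr (snd q - fst p) a) *
      ennreal (pos_powr (fst q - snd p) b * pos_powr (snd q - snd p) b) * (I (fst q) * I (snd q))"
    for q p :: "real \<times> real"
  have [measurable]: "case_prod F \<in> borel_measurable (lborel2 \<Otimes>\<^sub>M lborel2)"
    unfolding F_def by measurable
  have [measurable]: "(\<lambda>q. F q p) \<in> borel_measurable lborel2"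
    "F p \<in> borel_measurable lborel2" for p
    unfolding F_def by measurable
  have sq: "(powr_overlap a b t p)\<^sup>2 = (\<integral>\<^sup>+q. F q p \<partial>lborel2)" for p
  proof -
    define m where "m s = ennreal (pos_powr (s - fst p) a * pos_powr (s - snd p) b) * I s" for s
    have [measurable]: "m \<in> borel_measurable borel" unfolding m_def by measurable
    have "(\<integral>\<^sup>+q. F q p \<partial>lborel2) = (\<integral>\<^sup>+s. \<integral>\<^sup>+s'. F (s, s') p \<partial>lborel \<partial>lborel)"
      by (subst lborel.nn_integral_fst[symmetric]) auto
    also have "\<dots> = (\<integral>\<^sup>+s. \<integral>\<^sup>+s'. m s * m s' \<partial>lborel \<partial>lborel)"
      by (intro nn_integral_cong) (simp add: F_def m_def ennreal_mult ac_simps)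
    also have "\<dots> = (\<integral>\<^sup>+s. m s \<partial>lborel)\<^sup>2"
      by (simp add: nn_integral_cmult nn_integral_multc power2_eq_square)
    finally show ?thesis by (simp add: powr_overlap_def m_def I_def)
  qed
  define Ca where "Ca = 1 / (a + 1) - 1 / (2 * a + 1)"
  define Cb where "Cb = 1 / (b + 1) - 1 / (2 * b + 1)"
  have C: "Ca \<ge> 0" "Cb \<ge> 0" 
  proof -
    have "1 / (a + 1) \<ge> 0" "1 / (2 * a + 1) \<le> 0" "1 / (b + 1) \<ge> 0" "1 / (2 * b + 1) \<le> 0"
      using a b by (auto simp: divide_le_0_iff)
    then show "Ca \<ge> 0" "Cb \<ge> 0" unfolding Ca_def Cb_def by linarith+
  qed
  define c where "c = (2 * a + 1) + (2 * b + 1)"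
  have c: "c > -1" using a b by (simp add: c_def)
  have inner: "(\<integral>\<^sup>+p. F q p \<partial>lborel2) \<le>
      ennreal (Ca * Cb) * (ennreal (\<bar>fst q - snd q\<bar> powr c) * I (snd q) * I (fst q))"
    if q: "fst q \<noteq> snd q" for q
  proof -
    have "(\<integral>\<^sup>+p. F q p \<partial>lborel2) = (\<integral>\<^sup>+x. \<integral>\<^sup>+y. F q (x, y) \<partial>lborel \<partial>lborel)"
      by (subst lborel.nn_integral_fst[symmetric]) (auto simp: F_def)
    also have "\<dots> = (\<integral>\<^sup>+x. ennreal (pos_powr (fst q - x) a * pos_powr (snd q - x) a) \<partial>lborel) *
       (\<integral>\<^sup>+y. ennreal (pos_powr (fst q - y) b * pos_powr (snd q - y) b) \<partial>lborel) * (I (fst q) * I (snd q))"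
      by (simp add: F_def nn_integral_cmult nn_integral_multc)
    also have "\<dots> \<le> ennreal (Ca * \<bar>fst q - snd q\<bar> powr (2 * a + 1)) * ennreal (Cb * \<bar>fst q - snd q\<bar> powr (2 * b + 1)) * (I (fst q) * I (snd q))"
      unfolding Ca_def Cb_def using a b q by (intro mult_mono pos_powr_correlation_abs order_refl) auto
    also have "\<dots> = ennreal (Ca * Cb) * (ennreal (\<bar>fst q - snd q\<bar> powr c) * I (snd q) * I (fst q))"
    proof -
      have "\<bar>fst q - snd q\<bar> powr c = \<bar>fst q - snd q\<bar> powr (2 * a + 1) * \<bar>fst q - snd q\<bar> powr (2 * b + 1)"
        by (simp only: c_def powr_add)
      then show ?thesis
        by (simp only: ennreal_mult C powr_ge_zero mult_nonneg_nonneg mult_ac)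
    qed
    finally show ?thesis .
  qed
  have ne: "AE q in lborel2. fst q \<noteq> (snd q :: real)" by (rule AE_off_diagonal)
  have "(\<integral>\<^sup>+p. (powr_overlap a b t p)\<^sup>2 \<partial>lborel2) =
     (\<integral>\<^sup>+q. \<integral>\<^sup>+p. F q p \<partial>lborel2 \<partial>lborel2)"
    unfolding sq by (rule LL.Fubini') measurable
  also have "\<dots> \<le> (\<integral>\<^sup>+q. ennreal (Ca * Cb) * (ennreal (\<bar>fst q - snd q\<bar> powr c) * I (snd q) * I (fst q)) \<partial>lborel2)"
    using ne by (intro nn_integral_mono_AE) (auto elim!: eventually_mono intro: inner)
  also have "\<dots> = (\<integral>\<^sup>+s. \<integral>\<^sup>+s'. ennreal (Ca * Cb) * (ennreal (\<bar>s - s'\<bar> powr c) * I s' * I s) \<partial>lborel \<partial>lborel)"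
    by (subst lborel.nn_integral_fst[symmetric]) auto
  also have "\<dots> = (\<integral>\<^sup>+s. ennreal (Ca * Cb) * ((\<integral>\<^sup>+s'. ennreal (\<bar>s - s'\<bar> powr c) * I s' \<partial>lborel) * I s) \<partial>lborel)"
    by (simp add: nn_integral_cmult nn_integral_multc)
  also have "\<dots> \<le> (\<integral>\<^sup>+s. ennreal (Ca * Cb) * (ennreal (2 * (t powr (c + 1) / (c + 1))) * I s) \<partial>lborel)"
    using nn_integral_abs_powr[OF c, of _ t]
    by (intro nn_integral_mono mult_left_mono) (auto simp: I_def split: split_indicator)
  also have "\<dots> < \<infinity>"
    using t by (simp add: I_def nn_integral_cmult nn_integral_cmult_indicator ennreal_mult_less_top)
  finally show ?thesis .
qed

section \<open>Existence of the double integral\<close>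

definition grid_cell :: "nat \<Rightarrow> nat \<Rightarrow> real set"
  where "grid_cell m k = {real k / real (m + 1) - real m ..< real (k + 1) / real (m + 1) - real m}"

lemma grid_cell_fin_borel: "grid_cell m k \<in> fin_borel"
proof -
  have "real k / real (m + 1) - real m \<le> real (k + 1) / real (m + 1) - real m"
    by (simp add: divide_right_mono)
  then have "emeasure lborel (grid_cell m k) < \<infinity>"
    unfolding grid_cell_def by (simp only: emeasure_lborel_Ico) simp
  moreover have "grid_cell m k \<in> sets borel" by (simp add: grid_cell_def)
  ultimately show ?thesis by (simp add: fin_borel_def)
qed

lemma grid_cell_disjoint: "k \<noteq> l \<Longrightarrow> grid_cell m k \<inter> grid_cell m l = {}"
proof -
  have "x \<notin> grid_cell m l" if "x \<in> grid_cell m k" "k < l" for x k l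
  proof
    assume "x \<in> grid_cell m l"
    with that have "real l / real (m + 1) < real (k + 1) / real (m + 1)" by (simp add: grid_cell_def)
    with that show False by (simp add: divide_less_cancel)
  qed
  then show "k \<noteq> l \<Longrightarrow> grid_cell m k \<inter> grid_cell m l = {}" by (metis disjoint_iff linorder_neqE_nat)
qed

lemma grid_cell_ex:
  assumes "\<bar>x\<bar> < real m"
  obtains k where "k < 2 * m * (m + 1)" "x \<in> grid_cell m k"
proof -
  define w where "w = (x + real m) * real (m + 1)"
  have w: "0 \<le> w" using assms by (simp add: w_def)
  define k where "k = nat \<lfloor>w\<rfloor>"
  have k: "real k \<le> w" "w < real (k + 1)" using w by (auto simp: k_def) linarith+
  have xw: "x = w / real (m + 1) - real m" by (simp add: w_def)
  have "x \<in> grid_cell m k"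
    using k unfolding grid_cell_def xw by (auto intro: divide_right_mono divide_strict_right_mono)
  moreover have "k < 2 * m * (m + 1)"
  proof -
    have "w < (2 * real m) * real (m + 1)" unfolding w_def using assms by (intro mult_strict_right_mono) auto
    moreover have "(2 * real m) * real (m + 1) = real (2 * m * (m + 1))" by (simp add: algebra_simps)
    ultimately have "real k < real (2 * m * (m + 1))" using k(1) by linarith
    then show ?thesis by (simp only: of_nat_less_iff)
  qed
  ultimately show ?thesis by (rule that[rotated])
qed

lemma grid_cell_dist: "x \<in> grid_cell m k \<Longrightarrow> y \<in> grid_cell m l \<Longrightarrow>
    \<bar>x - y\<bar> < (\<bar>real k - real l\<bar> + 1) / real (m + 1)"
proof -
  assume "x \<in> grid_cell m k" "y \<in> grid_cell m l"
  then have "x * real (m + 1) \<ge> real k - real m * real (m + 1)" "x * real (m + 1) < real k + 1 - real m * real (m + 1)"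
    "y * real (m + 1) \<ge> real l - real m * real (m + 1)" "y * real (m + 1) < real l + 1 - real m * real (m + 1)"
    by (auto simp: grid_cell_def field_simps)
  then have "\<bar>x * real (m + 1) - y * real (m + 1)\<bar> < \<bar>real k - real l\<bar> + 1" by linarith
  moreover have "\<bar>x * real (m + 1) - y * real (m + 1)\<bar> = \<bar>x - y\<bar> * real (m + 1)"
    by (simp add: left_diff_distrib[symmetric] abs_mult del: of_nat_Suc of_nat_add)
  ultimately show "\<bar>x - y\<bar> < (\<bar>real k - real l\<bar> + 1) / real (m + 1)"
    by (simp add: pos_less_divide_eq)
qed

text \<open>Cells that are equal or adjacent are left out, so that the approximation vanishes near the
  diagonal. The infimum keeps it below \<open>G\<close>, which makes \<open>G\<close> a dominating function.\<close>

definition grid_coeff :: "(real \<times> real \<Rightarrow> ennreal) \<Rightarrow> nat \<Rightarrow> nat \<Rightarrow> nat \<Rightarrow> real"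
  where "grid_coeff G m k l =
    (if k + 1 < l \<or> l + 1 < k then enn2real (INF p\<in>grid_cell m k \<times> grid_cell m l. G p) else 0)"

definition grid_approx :: "(real \<times> real \<Rightarrow> ennreal) \<Rightarrow> nat \<Rightarrow> real \<times> real \<Rightarrow> real"
  where "grid_approx G m = simple_fun2 (2 * m * (m + 1)) (grid_cell m) (grid_coeff G m)"

lemma grid_simple_data:
  assumes sym: "\<And>x y. G (x, y) = G (y, x)"
  shows "simple_data n (grid_cell m) (grid_coeff G m)"
proof -
  have "(INF p\<in>grid_cell m k \<times> grid_cell m l. G p) = (INF p\<in>grid_cell m l \<times> grid_cell m k. G p)" for k l
  proof -
    have "(INF p\<in>prod.swap ` (grid_cell m k \<times> grid_cell m l). G p) = (INF p\<in>grid_cell m k \<times> grid_cell m l. G (prod.swap p))"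
      by (simp add: image_image)
    also have "\<dots> = (INF p\<in>grid_cell m k \<times> grid_cell m l. G p)"
      using sym by (intro INF_cong) auto
    finally show ?thesis by (simp add: product_swap)
  qed
  then show ?thesis
    using grid_cell_disjoint
    by (auto simp: simple_data_def grid_cell_fin_borel disjoint_family_on_def grid_coeff_def)
qed

lemma grid_approx_eq:
  assumes "k < 2 * m * (m + 1)" "l < 2 * m * (m + 1)" "x \<in> grid_cell m k" "y \<in> grid_cell m l"
  shows "grid_approx G m (x, y) = grid_coeff G m k l"
  unfolding grid_approx_def using assms grid_cell_disjoint by (intro simple_fun2_cells) auto

lemma grid_approx_bounds:
  assumes "G p < \<infinity>"
  shows "0 \<le> grid_approx G m p" "grid_approx G m p \<le> enn2real (G p)"
proof -
  obtain x y where p: "p = (x, y)" by (cases p)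
  have "0 \<le> grid_approx G m p \<and> grid_approx G m p \<le> enn2real (G p)"
  proof (cases "x \<in> (\<Union>k<2 * m * (m + 1). grid_cell m k) \<and> y \<in> (\<Union>k<2 * m * (m + 1). grid_cell m k)")
    case True
    then obtain k l where kl: "k < 2 * m * (m + 1)" "l < 2 * m * (m + 1)" "x \<in> grid_cell m k" "y \<in> grid_cell m l"
      by auto
    have "(INF p\<in>grid_cell m k \<times> grid_cell m l. G p) \<le> G p"
      using kl by (intro INF_lower) (auto simp: p)
    then have "enn2real (INF p\<in>grid_cell m k \<times> grid_cell m l. G p) \<le> enn2real (G p)"
      using assms by (intro enn2real_mono) auto
    then show ?thesis using grid_approx_eq[OF kl, of G] by (auto simp: p grid_coeff_def)
  next
    case False
    then have "grid_approx G m p = 0" unfolding grid_approx_def p by (intro simple_fun2_outside) blast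
    then show ?thesis by simp
  qed
  then show "0 \<le> grid_approx G m p" "grid_approx G m p \<le> enn2real (G p)" by auto
qed

text \<open>The approximation is at most \<open>G\<close> at each point. It is eventually above every \<open>c < G (x, y)\<close>, because the
  cell of \<open>(x, y)\<close> shrinks into a neighbourhood where \<open>G\<close> exceeds \<open>c\<close>.\<close>

lemma grid_approx_tendsto:
  assumes xy: "x \<noteq> y" and fin: "G (x, y) < \<infinity>"
    and lsc: "\<And>c. c < G (x, y) \<Longrightarrow> \<forall>\<^sub>F q in nhds (x, y). c < G q"
  shows "(\<lambda>m. grid_approx G m (x, y)) \<longlonglongrightarrow> enn2real (G (x, y))"
proof -
  have inv: "(\<lambda>m. c / real (m + 1)) \<longlonglongrightarrow> 0" for c
    using LIMSEQ_Suc[OF lim_const_over_n[of c]] by (simp add: add.commute)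
  have "(\<lambda>m. ennreal (grid_approx G m (x, y))) \<longlonglongrightarrow> G (x, y)"
  proof (rule order_tendstoI)
    fix c assume "G (x, y) < c"
    moreover have "ennreal (grid_approx G m (x, y)) \<le> G (x, y)" for m
    proof -
      have "ennreal (grid_approx G m (x, y)) \<le> ennreal (enn2real (G (x, y)))"
        by (intro ennreal_leI grid_approx_bounds(2) fin)
      also have "\<dots> = G (x, y)" using fin by simp
      finally show ?thesis .
    qed
    ultimately show "\<forall>\<^sub>F m in sequentially. ennreal (grid_approx G m (x, y)) < c"
      by (intro always_eventually allI) (rule le_less_trans)
  next
    fix c assume "c < G (x, y)"
    then obtain c' where c': "c < c'" "c' < G (x, y)" using dense by blast
    obtain d where d: "d > 0" "\<And>q. dist q (x, y) < d \<Longrightarrow> c' < G q"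
      using lsc[OF c'(2)] by (auto simp: eventually_nhds_metric)
    have "\<forall>\<^sub>F m in sequentially. real m > max \<bar>x\<bar> \<bar>y\<bar>"
      by (intro eventually_gt_at_top filterlim_compose[OF _ filterlim_real_sequentially] |
          rule filterlim_at_top_dense[THEN iffD1, rule_format, OF filterlim_real_sequentially])+
    moreover have "\<forall>\<^sub>F m in sequentially. 2 / real (m + 1) < d"
      using d(1) by (intro order_tendstoD[OF inv])
    moreover have "\<forall>\<^sub>F m in sequentially. 2 / real (m + 1) < \<bar>x - y\<bar>"
      using xy by (intro order_tendstoD[OF inv]) auto
    ultimately show "\<forall>\<^sub>F m in sequentially. c < ennreal (grid_approx G m (x, y))"
    proof eventually_elim
      case (elim m)
      obtain k where k: "k < 2 * m * (m + 1)" "x \<in> grid_cell m k" using elim by (auto intro: grid_cell_ex[of x m])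
      obtain l where l: "l < 2 * m * (m + 1)" "y \<in> grid_cell m l" using elim by (auto intro: grid_cell_ex[of y m])
      have "2 / real (m + 1) < (\<bar>real k - real l\<bar> + 1) / real (m + 1)"
        using grid_cell_dist[OF k(2) l(2)] elim by linarith
      then have "1 < \<bar>real k - real l\<bar>" by (simp add: divide_less_cancel)
      then have far: "k + 1 < l \<or> l + 1 < k" by linarith
      let ?I = "INF p\<in>grid_cell m k \<times> grid_cell m l. G p"
      have "?I \<le> G (x, y)" using k l by (intro INF_lower) auto
      then have "?I < \<infinity>" using fin by (rule le_less_trans)
      have "c' \<le> ?I"
      proof (intro INF_greatest less_imp_le d(2))
        fix q assume "q \<in> grid_cell m k \<times> grid_cell m l"
        then have "\<bar>fst q - x\<bar> < 1 / real (m + 1)" "\<bar>snd q - y\<bar> < 1 / real (m + 1)"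
          using grid_cell_dist[of "fst q" m k x k] grid_cell_dist[of "snd q" m l y l] k l by auto
        moreover have "dist q (x, y) \<le> \<bar>fst q - x\<bar> + \<bar>snd q - y\<bar>"
          using sqrt_sum_squares_le_sum_abs[of "fst q - x" "snd q - y"]
          by (simp add: dist_prod_def dist_real_def)
        ultimately show "dist q (x, y) < d" using elim by simp
      qed
      with c' have "c < ?I" by simp
      also have "?I = ennreal (grid_approx G m (x, y))"
        using \<open>?I < \<infinity>\<close> far by (simp add: grid_approx_eq[OF k(1) l(1) k(2) l(2)] grid_coeff_def)
      finally show ?case .
    qed
  qed
  then have "(\<lambda>m. enn2real (ennreal (grid_approx G m (x, y)))) \<longlonglongrightarrow> enn2real (G (x, y))"
    using fin by (intro tendsto_enn2real) auto
  then show ?thesis using grid_approx_bounds(1)[of G "(x, y)", OF fin] by simp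
qed

text \<open>Dominated convergence makes the grid approximations converge in \<open>L\<^sup>2\<close>. By the isometry their
  double integrals form a Cauchy sequence.\<close>

lemma (in white_noise) has_I2_exists:
  fixes G :: "real \<times> real \<Rightarrow> ennreal"
  assumes [measurable]: "G \<in> borel_measurable lborel2"
    and sym: "\<And>x y. G (x, y) = G (y, x)"
    and fin: "(\<integral>\<^sup>+p. (G p)\<^sup>2 \<partial>lborel2) < \<infinity>"
    and lsc: "\<And>x y c. x \<noteq> y \<Longrightarrow> c < G (x, y) \<Longrightarrow> \<forall>\<^sub>F q in nhds (x, y). c < G q"
  shows "\<exists>Z. has_I2 M W (\<lambda>p. enn2real (G p)) Z"
proof -
  let ?L = "lborel2"
  define n where "n m = 2 * m * (m + 1)" for m :: nat
  define f where "f p = enn2real (G p)" for p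
  have sd: "simple_data (n m) (grid_cell m) (grid_coeff G m)" for m
    by (rule grid_simple_data) (rule sym)
  have fm: "simple_fun2 (n m) (grid_cell m) (grid_coeff G m) = grid_approx G m" for m
    by (simp add: grid_approx_def n_def)
  have [measurable]: "grid_approx G m \<in> borel_measurable ?L" for m
    using simple_fun2_measurable[OF sd[of m]] by (simp add: fm)
  have [measurable]: "f \<in> borel_measurable ?L" unfolding f_def by measurable
  have "AE p in ?L. (G p)\<^sup>2 \<noteq> \<infinity>" using fin by (intro nn_integral_noteq_infinite) auto
  then have Gfin: "AE p in ?L. G p < \<infinity>"
    by eventually_elim (auto simp: less_top power2_eq_square ennreal_mult_eq_top_iff)
  have sq: "ennreal ((f p)\<^sup>2) = (G p)\<^sup>2" if "G p < \<infinity>" for p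
    using that by (simp add: f_def ennreal_power[symmetric])
  have f2: "(\<integral>\<^sup>+p. ennreal ((f p)\<^sup>2) \<partial>?L) < \<infinity>"
  proof -
    have "(\<integral>\<^sup>+p. ennreal ((f p)\<^sup>2) \<partial>?L) = (\<integral>\<^sup>+p. (G p)\<^sup>2 \<partial>?L)"
      by (intro nn_integral_cong_AE eventually_mono[OF Gfin] sq)
    then show ?thesis using fin by simp
  qed
  have ne: "AE p in ?L. fst p \<noteq> snd p" by (rule AE_off_diagonal)
  have conv: "(\<lambda>m. \<integral>\<^sup>+p. ennreal ((grid_approx G m p - f p)\<^sup>2) \<partial>?L) \<longlonglongrightarrow> 0"
  proof -
    have "(\<lambda>m. \<integral>\<^sup>+p. ennreal ((grid_approx G m p - f p)\<^sup>2) \<partial>?L) \<longlonglongrightarrow> (\<integral>\<^sup>+p. 0 \<partial>?L)"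
    proof (rule nn_integral_dominated_convergence[where w="\<lambda>p. (G p)\<^sup>2"])
      show "AE p in ?L. ennreal ((grid_approx G m p - f p)\<^sup>2) \<le> (G p)\<^sup>2" for m
        using Gfin
      proof eventually_elim
        case (elim p)
        have "\<bar>grid_approx G m p - f p\<bar> \<le> \<bar>f p\<bar>"
          using grid_approx_bounds[of G p m, OF elim] by (auto simp: f_def)
        then have "(grid_approx G m p - f p)\<^sup>2 \<le> (f p)\<^sup>2" by (simp add: abs_le_square_iff)
        then show ?case using sq[OF elim] by (metis ennreal_leI)
      qed
      show "AE p in ?L. (\<lambda>m. ennreal ((grid_approx G m p - f p)\<^sup>2)) \<longlonglongrightarrow> 0"
        using Gfin ne
      proof eventually_elim
        case (elim p)
        have "(\<lambda>m. grid_approx G m (fst p, snd p)) \<longlonglongrightarrow> enn2real (G (fst p, snd p))"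
          using elim lsc[of "fst p" "snd p"] by (intro grid_approx_tendsto) auto
        then have "(\<lambda>m. (grid_approx G m p - f p)\<^sup>2) \<longlonglongrightarrow> (f p - f p)\<^sup>2"
          by (intro tendsto_intros) (simp add: f_def)
        then have "(\<lambda>m. ennreal ((grid_approx G m p - f p)\<^sup>2)) \<longlonglongrightarrow> ennreal 0"
          by (intro tendsto_ennrealI) simp
        then show ?case by simp
      qed
    qed (use fin in auto)
    then show ?thesis by simp
  qed
  define S where "S m = simple_I2 W (n m) (grid_cell m) (grid_coeff G m)" for m
  have [measurable]: "S m \<in> borel_measurable M" for m unfolding S_def by (rule simple_I2_measurable[OF sd])
  have iso: "(\<integral>\<^sup>+\<omega>. ennreal ((S m \<omega> - S k \<omega>)\<^sup>2) \<partial>M) = 2 * (\<integral>\<^sup>+p. ennreal ((grid_approx G m p - grid_approx G k p)\<^sup>2) \<partial>?L)" for m k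
    unfolding S_def fm[symmetric] by (rule simple_I2_isometry[OF sd sd])
  obtain Z where Z[measurable]: "Z \<in> borel_measurable M"
    and SZ: "(\<lambda>m. \<integral>\<^sup>+\<omega>. ennreal ((S m \<omega> - Z \<omega>)\<^sup>2) \<partial>M) \<longlonglongrightarrow> 0"
  proof (rule L2_complete[of S M])
    fix e :: real assume e: "e > 0"
    have "\<forall>\<^sub>F m in sequentially. (\<integral>\<^sup>+p. ennreal ((grid_approx G m p - f p)\<^sup>2) \<partial>?L) < ennreal (e / 8)"
      using e by (intro order_tendstoD[OF conv]) auto
    then obtain N where N: "\<And>m. m \<ge> N \<Longrightarrow> (\<integral>\<^sup>+p. ennreal ((grid_approx G m p - f p)\<^sup>2) \<partial>?L) \<le> ennreal (e / 8)"
      unfolding eventually_sequentially by (metis less_imp_le)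
    have "(\<integral>\<^sup>+\<omega>. ennreal ((S m \<omega> - S k \<omega>)\<^sup>2) \<partial>M) \<le> ennreal e" if "m \<ge> N" "k \<ge> N" for m k
    proof -
      have "(\<integral>\<^sup>+\<omega>. ennreal ((S m \<omega> - S k \<omega>)\<^sup>2) \<partial>M) \<le> 2 * (2 * ennreal (e / 8) + 2 * ennreal (e / 8))"
        unfolding iso
        by (intro mult_left_mono order_trans[OF nn_integral_square_diff_le[where w=f]] add_mono N that) auto
      also have "\<dots> = ennreal 2 * (ennreal 2 * ennreal (e / 8) + ennreal 2 * ennreal (e / 8))" by simp
      also have "\<dots> = ennreal (2 * (2 * (e / 8) + 2 * (e / 8)))"
        using e by (simp add: ennreal_mult[symmetric] ennreal_plus[symmetric] del: ennreal_plus ennreal_numeral)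
      finally show ?thesis by simp
    qed
    then show "\<exists>N. \<forall>m\<ge>N. \<forall>k\<ge>N. (\<integral>\<^sup>+\<omega>. ennreal ((S m \<omega> - S k \<omega>)\<^sup>2) \<partial>M) \<le> ennreal e" by blast
  qed (auto intro: that)
  have Z2: "(\<integral>\<^sup>+\<omega>. ennreal ((Z \<omega>)\<^sup>2) \<partial>M) < \<infinity>"
  proof -
    have "\<forall>\<^sub>F m in sequentially. (\<integral>\<^sup>+\<omega>. ennreal ((S m \<omega> - Z \<omega>)\<^sup>2) \<partial>M) < 1"
      by (intro order_tendstoD[OF SZ]) auto
    then obtain m where m: "(\<integral>\<^sup>+\<omega>. ennreal ((S m \<omega> - Z \<omega>)\<^sup>2) \<partial>M) < 1"
      by (auto dest: eventually_happens)
    have 0: "simple_data 0 (grid_cell m) (grid_coeff G m)" by (simp add: simple_data_def disjoint_family_on_def)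
    have "(\<integral>\<^sup>+\<omega>. ennreal ((S m \<omega>)\<^sup>2) \<partial>M) = 2 * (\<integral>\<^sup>+p. ennreal ((grid_approx G m p)\<^sup>2) \<partial>?L)"
      using simple_I2_isometry[OF sd[of m] 0]
      by (simp add: S_def fm simple_fun2_def[of 0] simple_I2_def[of _ 0] case_prod_beta)
    also have "(\<integral>\<^sup>+p. ennreal ((grid_approx G m p)\<^sup>2) \<partial>?L) \<le> (\<integral>\<^sup>+p. ennreal ((f p)\<^sup>2) \<partial>?L)"
      using grid_approx_bounds[of G _ m]
      by (intro nn_integral_mono_AE eventually_mono[OF Gfin] ennreal_leI power_mono) (auto simp: f_def)
    finally have Sm: "(\<integral>\<^sup>+\<omega>. ennreal ((S m \<omega>)\<^sup>2) \<partial>M) < \<infinity>"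
      using f2 by (auto simp: ennreal_mult_less_top mult_left_mono elim: le_less_trans)
    have "(\<integral>\<^sup>+\<omega>. ennreal ((Z \<omega>)\<^sup>2) \<partial>M) \<le> 2 * (\<integral>\<^sup>+\<omega>. ennreal ((S m \<omega> - Z \<omega>)\<^sup>2) \<partial>M) + 2 * (\<integral>\<^sup>+\<omega>. ennreal ((S m \<omega>)\<^sup>2) \<partial>M)"
      using nn_integral_square_diff_le[of Z M "\<lambda>_. 0" "S m"] by (simp add: power2_commute)
    also have "\<dots> < \<infinity>" using m Sm
      by (simp add: ennreal_mult_less_top ennreal_add_less_top less_trans[OF m])
    finally show ?thesis .
  qed
  have "has_I2 M W f Z"
    unfolding has_I2_def square_integrable_def
  proof (intro conjI allI exI[of _ n] exI[of _ grid_cell] exI[of _ "grid_coeff G"])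
    show "integrable ?L (\<lambda>p. (f p)\<^sup>2)" using f2 by (intro integrableI_bounded) auto
    show "integrable M (\<lambda>p. (Z p)\<^sup>2)" using Z2 by (intro integrableI_bounded) auto
    show "f (x, y) = f (y, x)" for x y by (simp add: f_def sym)
    show "simple_data (n m) (grid_cell m) (grid_coeff G m)" for m by (rule sd)
    show "(\<lambda>m. \<integral>\<^sup>+ p. ennreal ((simple_fun2 (n m) (grid_cell m) (grid_coeff G m) p - f p)\<^sup>2) \<partial>?L) \<longlonglongrightarrow> 0"
      using conv by (simp add: fm)
    show "(\<lambda>m. \<integral>\<^sup>+ \<omega>. ennreal ((simple_I2 W (n m) (grid_cell m) (grid_coeff G m) \<omega> - Z \<omega>)\<^sup>2) \<partial>M) \<longlonglongrightarrow> 0"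
      using SZ by (simp add: S_def)
  qed auto
  then show ?thesis unfolding f_def by blast
qed

section \<open>Characteristic functions of differences of double integrals\<close>

text \<open>The triangle inequality in the Euclidean norm: the diagonal part expands by at least \<open>D\<close>, and the
  Hilbert-Schmidt norm of the rest is at most \<open>card R * E\<close>.\<close>

lemma diagonally_dominant_lower_bound:
  fixes B :: "'r \<Rightarrow> 'r \<Rightarrow> real" and D E :: real
  assumes R: "finite R" and E: "E \<ge> 0" and D: "D - card R * E \<ge> 0"
    and diag: "\<And>r. r \<in> R \<Longrightarrow> D \<le> B r r"
    and off: "\<And>r q. r \<in> R \<Longrightarrow> q \<in> R \<Longrightarrow> r \<noteq> q \<Longrightarrow> \<bar>B r q\<bar> \<le> E"
  shows "(D - card R * E)\<^sup>2 * (\<Sum>q\<in>R. (\<eta> q)\<^sup>2) \<le> (\<Sum>r\<in>R. (\<Sum>q\<in>R. B r q * \<eta> q)\<^sup>2)"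
proof -
  define N where "N = L2_set \<eta> R"
  have N: "N \<ge> 0" "N\<^sup>2 = (\<Sum>q\<in>R. (\<eta> q)\<^sup>2)" by (auto simp: N_def L2_set_def sum_nonneg)
  define row where "row r = (\<Sum>q\<in>R. B r q * \<eta> q)" for r
  define rest where "rest r = (\<Sum>q\<in>R - {r}. B r q * \<eta> q)" for r
  have D0: "D \<ge> 0" using D E by (meson diff_ge_0_iff_ge mult_nonneg_nonneg of_nat_0_le_iff order_trans)
  have "D * N = L2_set (\<lambda>r. D * \<eta> r) R"
    using D0 by (simp add: N_def L2_set_right_distrib)
  also have "\<dots> \<le> L2_set (\<lambda>r. B r r * \<eta> r) R"
    unfolding L2_set_def
    by (intro real_sqrt_le_mono sum_mono)
      (use diag D0 in \<open>auto simp: power_mult_distrib intro!: mult_right_mono power_mono\<close>)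
  also have "L2_set (\<lambda>r. B r r * \<eta> r) R = L2_set (\<lambda>r. row r + - rest r) R"
    using R by (intro L2_set_cong refl) (simp add: row_def rest_def sum.remove)
  also have "\<dots> \<le> L2_set row R + L2_set (\<lambda>r. - rest r) R" by (rule L2_set_triangle_ineq)
  also have "L2_set (\<lambda>r. - rest r) R \<le> card R * E * N"
  proof -
    have "(rest r)\<^sup>2 \<le> E\<^sup>2 * (card R * N\<^sup>2)" if r: "r \<in> R" for r
    proof -
      have "\<bar>rest r\<bar> \<le> (\<Sum>q\<in>R - {r}. \<bar>B r q * \<eta> q\<bar>)" unfolding rest_def by (rule sum_abs)
      also have "\<dots> \<le> (\<Sum>q\<in>R - {r}. E * \<bar>\<eta> q\<bar>)"
        using off r by (intro sum_mono) (auto simp: abs_mult intro!: mult_right_mono)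
      also have "\<dots> \<le> (\<Sum>q\<in>R. E * \<bar>\<eta> q\<bar>)" using R E by (intro sum_mono2) auto
      finally have "\<bar>rest r\<bar> \<le> E * (\<Sum>q\<in>R. \<bar>\<eta> q\<bar>)" by (simp add: sum_distrib_left)
      then have "(rest r)\<^sup>2 \<le> (E * (\<Sum>q\<in>R. \<bar>\<eta> q\<bar>))\<^sup>2" by (metis abs_ge_zero power2_abs power_mono)
      also have "\<dots> = E\<^sup>2 * (\<Sum>q\<in>R. 1 * \<bar>\<eta> q\<bar>)\<^sup>2" by (simp add: power_mult_distrib)
      also have "\<dots> \<le> E\<^sup>2 * ((\<Sum>q\<in>R. 1) * (\<Sum>q\<in>R. 1 * \<bar>\<eta> q\<bar>\<^sup>2))"
        by (intro mult_left_mono sum_square_le_weighted) auto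
      finally show ?thesis by (simp add: N)
    qed
    then have "(\<Sum>r\<in>R. (- rest r)\<^sup>2) \<le> (\<Sum>r\<in>R. E\<^sup>2 * (card R * N\<^sup>2))" by (intro sum_mono) auto
    also have "\<dots> = (card R * E * N)\<^sup>2" by (simp add: power2_eq_square)
    finally have "L2_set (\<lambda>r. - rest r) R \<le> sqrt ((card R * E * N)\<^sup>2)"
      unfolding L2_set_def by (rule real_sqrt_le_mono)
    then show ?thesis using E N by simp
  qed
  finally have "(D - card R * E) * N \<le> L2_set row R" by (simp add: left_diff_distrib)
  then have "((D - card R * E) * N)\<^sup>2 \<le> (L2_set row R)\<^sup>2" using D N by (intro power_mono) auto
  then show ?thesis by (simp add: power_mult_distrib N L2_set_def sum_nonneg row_def)
qed

lemma L2_rectangle_pairing: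
  assumes [measurable]: "h \<in> borel_measurable lborel2"
    and fin: "(\<integral>\<^sup>+p. ennreal ((h p)\<^sup>2) \<partial>lborel2) < \<infinity>"
    and UV: "U \<in> fin_borel" "V \<in> fin_borel" "measure lborel U = \<rho>" "measure lborel V = \<rho>"
  shows "integrable lborel2 (\<lambda>p. indicator (U \<times> V) p * h p)"
    and "\<bar>\<integral>p. indicator (U \<times> V) p * h p \<partial>lborel2\<bar>
      \<le> \<rho> * sqrt (enn2real (\<integral>\<^sup>+p. ennreal ((h p)\<^sup>2) \<partial>lborel2))"
proof -
  have S: "U \<times> V \<in> sets lborel2" using UV by (auto simp: fin_borel_def)
  have em: "emeasure lborel2 (U \<times> V) = ennreal (\<rho>\<^sup>2)"
    using emeasure_cell[OF UV(1,2)] UV(3,4) by (simp add: power2_eq_square)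
  have \<rho>: "\<rho> \<ge> 0" using UV(3) by auto
  show "integrable lborel2 (\<lambda>p. indicator (U \<times> V) p * h p)"
    by (rule L2_indicator_pairing(1)[OF assms(1) S fin em]) simp
  show "\<bar>\<integral>p. indicator (U \<times> V) p * h p \<partial>lborel2\<bar>
      \<le> \<rho> * sqrt (enn2real (\<integral>\<^sup>+p. ennreal ((h p)\<^sup>2) \<partial>lborel2))"
    using L2_indicator_pairing(2)[OF assms(1) S fin em] \<rho> by simp
qed

lemma ennreal_tendsto_0_twice_sum:
  fixes u v :: "nat \<Rightarrow> ennreal"
  assumes "u \<longlonglongrightarrow> 0" "v \<longlonglongrightarrow> 0" "\<And>m. w m \<le> 2 * u m + 2 * v m"
  shows "w \<longlonglongrightarrow> 0"
proof -
  have "(\<lambda>m. ennreal 2 * u m + ennreal 2 * v m) \<longlonglongrightarrow> ennreal 2 * 0 + ennreal 2 * 0"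
    using assms(1,2) by (intro tendsto_add ennreal_tendsto_cmult) auto
  then have lim: "(\<lambda>m. 2 * u m + 2 * v m) \<longlonglongrightarrow> 0" by simp
  show ?thesis
    by (rule tendsto_sandwich[OF _ _ tendsto_const lim]) (auto simp: assms(3))
qed

text \<open>The matrices of the approximating simple kernels differ from \<open>B\<close> by at most the \<open>L\<^sup>2\<close> distance of the
  kernels, by the Cauchy-Schwarz inequality on a rectangle. So they stay diagonally dominant with
  constants that converge to those of the limit. The characteristic functions converge
  along a subsequence on which the integrals converge almost surely.\<close>

lemma (in white_noise) has_I2_diff_char_bound:
  fixes U V :: "'r \<Rightarrow> real set" and D E \<sigma> z :: real
  assumes Z1: "has_I2 M W f1 Z1" and Z2: "has_I2 M W f2 Z2" and R: "finite R"
    and fb: "\<And>r. r \<in> R \<Longrightarrow> U r \<in> fin_borel" "\<And>r. r \<in> R \<Longrightarrow> V r \<in> fin_borel"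
    and len: "\<And>r. r \<in> R \<Longrightarrow> measure lborel (U r) = \<rho>" "\<And>r. r \<in> R \<Longrightarrow> measure lborel (V r) = \<rho>"
    and \<rho>: "\<rho> > 0"
    and disj: "disjoint_family_on U R" "disjoint_family_on V R"
      "\<And>r q. r \<in> R \<Longrightarrow> q \<in> R \<Longrightarrow> U r \<inter> V q = {}"
    and B: "\<And>r q. B r q = (\<integral>p. indicator (U r \<times> V q) p * (f1 p - f2 p) \<partial>lborel2) / \<rho>"
    and diag: "\<And>r. r \<in> R \<Longrightarrow> D \<le> B r r"
    and off: "\<And>r q. r \<in> R \<Longrightarrow> q \<in> R \<Longrightarrow> r \<noteq> q \<Longrightarrow> \<bar>B r q\<bar> \<le> E"
    and E: "E \<ge> 0" and \<sigma>: "\<sigma> = D - card R * E" "\<sigma> > 0"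
  shows "(cmod (\<integral>\<omega>. iexp (z * (Z1 \<omega> - Z2 \<omega>)) \<partial>M))\<^sup>2
    \<le> (1 + 8 * z\<^sup>2 * \<sigma>\<^sup>2) powr (- (real (card R) / 2))"
proof -
  let ?L = "lborel2"
  obtain n1 A1 a1 where sd1: "\<And>m::nat. simple_data (n1 m) (A1 m) (a1 m)"
    and f1: "(\<lambda>m. \<integral>\<^sup>+p. ennreal ((simple_fun2 (n1 m) (A1 m) (a1 m) p - f1 p)\<^sup>2) \<partial>?L) \<longlonglongrightarrow> 0"
    and S1: "(\<lambda>m. \<integral>\<^sup>+\<omega>. ennreal ((simple_I2 W (n1 m) (A1 m) (a1 m) \<omega> - Z1 \<omega>)\<^sup>2) \<partial>M) \<longlonglongrightarrow> 0"
    using Z1 unfolding has_I2_def by blast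
  obtain n2 A2 a2 where sd2: "\<And>m::nat. simple_data (n2 m) (A2 m) (a2 m)"
    and f2: "(\<lambda>m. \<integral>\<^sup>+p. ennreal ((simple_fun2 (n2 m) (A2 m) (a2 m) p - f2 p)\<^sup>2) \<partial>?L) \<longlonglongrightarrow> 0"
    and S2: "(\<lambda>m. \<integral>\<^sup>+\<omega>. ennreal ((simple_I2 W (n2 m) (A2 m) (a2 m) \<omega> - Z2 \<omega>)\<^sup>2) \<partial>M) \<longlonglongrightarrow> 0"
    using Z2 unfolding has_I2_def by blast
  have [measurable]: "f1 \<in> borel_measurable ?L" "f2 \<in> borel_measurable ?L"
      "Z1 \<in> borel_measurable M" "Z2 \<in> borel_measurable M"
    using Z1 Z2 by (auto simp: has_I2_def square_integrable_def)
  define g1 where "g1 m = simple_fun2 (n1 m) (A1 m) (a1 m)" for m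
  define g2 where "g2 m = simple_fun2 (n2 m) (A2 m) (a2 m)" for m
  define T1 where "T1 m = simple_I2 W (n1 m) (A1 m) (a1 m)" for m
  define T2 where "T2 m = simple_I2 W (n2 m) (A2 m) (a2 m)" for m
  have [measurable]: "g1 m \<in> borel_measurable ?L" "g2 m \<in> borel_measurable ?L"
      "T1 m \<in> borel_measurable M" "T2 m \<in> borel_measurable M" for m
    unfolding g1_def g2_def T1_def T2_def
    using sd1[of m] sd2[of m] by (auto intro: simple_fun2_measurable simple_I2_measurable)
  define S where "S m \<omega> = T1 m \<omega> - T2 m \<omega>" for m \<omega>
  define Z where "Z \<omega> = Z1 \<omega> - Z2 \<omega>" for \<omega>
  define f where "f p = f1 p - f2 p" for p
  define g where "g m p = g1 m p - g2 m p" for m p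
  have [measurable]: "f \<in> borel_measurable ?L" "g m \<in> borel_measurable ?L" "S m \<in> borel_measurable M"
      "Z \<in> borel_measurable M" for m
    unfolding f_def g_def S_def Z_def by measurable
  have SZ: "(\<lambda>m. \<integral>\<^sup>+\<omega>. ennreal ((S m \<omega> - Z \<omega>)\<^sup>2) \<partial>M) \<longlonglongrightarrow> 0"
  proof (rule ennreal_tendsto_0_twice_sum[OF S1 S2])
    fix m
    have "(S m \<omega> - Z \<omega>)\<^sup>2 = ((T1 m \<omega> - Z1 \<omega>) - (T2 m \<omega> - Z2 \<omega>))\<^sup>2" for \<omega>
      by (simp add: S_def Z_def algebra_simps)
    then show "(\<integral>\<^sup>+\<omega>. ennreal ((S m \<omega> - Z \<omega>)\<^sup>2) \<partial>M) \<le>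
      2 * (\<integral>\<^sup>+\<omega>. ennreal ((simple_I2 W (n1 m) (A1 m) (a1 m) \<omega> - Z1 \<omega>)\<^sup>2) \<partial>M) +
      2 * (\<integral>\<^sup>+\<omega>. ennreal ((simple_I2 W (n2 m) (A2 m) (a2 m) \<omega> - Z2 \<omega>)\<^sup>2) \<partial>M)"
      using nn_integral_square_diff_le[of "\<lambda>\<omega>. T1 m \<omega> - Z1 \<omega>" M "\<lambda>\<omega>. T2 m \<omega> - Z2 \<omega>" "\<lambda>_. 0"]
      by (simp add: T1_def[symmetric] T2_def[symmetric])
  qed
  have gf: "(\<lambda>m. \<integral>\<^sup>+p. ennreal ((g m p - f p)\<^sup>2) \<partial>?L) \<longlonglongrightarrow> 0"
  proof (rule ennreal_tendsto_0_twice_sum[OF f1 f2])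
    fix m
    have "(g m p - f p)\<^sup>2 = ((g1 m p - f1 p) - (g2 m p - f2 p))\<^sup>2" for p
      by (simp add: g_def f_def algebra_simps)
    then show "(\<integral>\<^sup>+p. ennreal ((g m p - f p)\<^sup>2) \<partial>?L) \<le>
      2 * (\<integral>\<^sup>+p. ennreal ((simple_fun2 (n1 m) (A1 m) (a1 m) p - f1 p)\<^sup>2) \<partial>?L) +
      2 * (\<integral>\<^sup>+p. ennreal ((simple_fun2 (n2 m) (A2 m) (a2 m) p - f2 p)\<^sup>2) \<partial>?L)"
      using nn_integral_square_diff_le[of "\<lambda>p. g1 m p - f1 p" ?L "\<lambda>p. g2 m p - f2 p" "\<lambda>_. 0"]
      by (simp add: g1_def[symmetric] g2_def[symmetric])
  qed
  have f_fin: "(\<integral>\<^sup>+p. ennreal ((f p)\<^sup>2) \<partial>?L) < \<infinity>"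
  proof -
    have "(\<integral>\<^sup>+p. ennreal ((f p)\<^sup>2) \<partial>?L) \<le> 2 * (\<integral>\<^sup>+p. ennreal ((f1 p)\<^sup>2) \<partial>?L) + 2 * (\<integral>\<^sup>+p. ennreal ((f2 p)\<^sup>2) \<partial>?L)"
      using nn_integral_square_diff_le[of f1 ?L f2 "\<lambda>_. 0"] by (simp add: f_def)
    also have "\<dots> < \<infinity>"
      using Z1 Z2 by (auto simp: has_I2_def square_integrable_def integrable_iff_bounded
        ennreal_add_less_top ennreal_mult_less_top)
    finally show ?thesis .
  qed
  define e where "e m = sqrt (enn2real (\<integral>\<^sup>+p. ennreal ((g m p - f p)\<^sup>2) \<partial>?L))" for m
  have e: "e \<longlonglongrightarrow> 0"
  proof -
    have "(\<lambda>m. sqrt (enn2real (\<integral>\<^sup>+p. ennreal ((g m p - f p)\<^sup>2) \<partial>?L))) \<longlonglongrightarrow> sqrt (enn2real 0)"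
      using gf by (intro tendsto_real_sqrt tendsto_enn2real) auto
    then show ?thesis by (simp add: e_def[abs_def])
  qed
  have e0: "e m \<ge> 0" for m by (simp add: e_def)
  define Bm where "Bm m r q = (\<integral>p. indicator (U r \<times> V q) p * (simple_fun2 (n1 m) (A1 m) (a1 m) p -
      simple_fun2 (n2 m) (A2 m) (a2 m) p) \<partial>?L) / \<rho>" for m r q
  \<comment> \<open>the constant for diagonal entries at least \<open>D - e m\<close> and other entries at most \<open>E + e m\<close>\<close>
  define \<sigma>m where "\<sigma>m m = \<sigma> - real (1 + card R) * e m" for m
  have \<sigma>m: "\<sigma>m \<longlonglongrightarrow> \<sigma>"
  proof -
    have "(\<lambda>m. \<sigma> - real (1 + card R) * e m) \<longlonglongrightarrow> \<sigma> - real (1 + card R) * 0" by (intro tendsto_intros e)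
    then show ?thesis by (simp add: \<sigma>m_def[abs_def])
  qed
  have bound: "\<forall>\<^sub>F m in sequentially. (cmod (\<integral>\<omega>. iexp (z * S m \<omega>) \<partial>M))\<^sup>2
      \<le> (1 + 8 * z\<^sup>2 * (\<sigma>m m)\<^sup>2) powr (- (real (card R) / 2))"
  proof -
    have "\<forall>\<^sub>F m in sequentially. \<sigma>m m > 0" using \<sigma>m \<sigma>(2) by (rule order_tendstoD)
    moreover have "\<forall>\<^sub>F m in sequentially. (\<integral>\<^sup>+p. ennreal ((g m p - f p)\<^sup>2) \<partial>?L) < \<infinity>"
      by (intro order_tendstoD[OF gf]) auto
    ultimately show ?thesis
    proof eventually_elim
      case (elim m)
      have close: "\<bar>Bm m r q - B r q\<bar> \<le> e m" if "r \<in> R" "q \<in> R" for r q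
      proof -
        have i1: "integrable ?L (\<lambda>p. indicator (U r \<times> V q) p * (g m p - f p))"
          and i2: "integrable ?L (\<lambda>p. indicator (U r \<times> V q) p * f p)"
          using elim f_fin fb len that by (auto intro!: L2_rectangle_pairing(1))
        have "(\<lambda>p. indicator (U r \<times> V q) p * g m p) =
            (\<lambda>p. indicator (U r \<times> V q) p * (g m p - f p) + indicator (U r \<times> V q) p * f p)"
          by (simp add: algebra_simps)
        then have "(\<integral>p. indicator (U r \<times> V q) p * g m p \<partial>?L) =
            (\<integral>p. indicator (U r \<times> V q) p * (g m p - f p) \<partial>?L) + (\<integral>p. indicator (U r \<times> V q) p * f p \<partial>?L)"
          using i1 i2 by (simp only: Bochner_Integration.integral_add)
        then have "Bm m r q - B r q = (\<integral>p. indicator (U r \<times> V q) p * (g m p - f p) \<partial>?L) / \<rho>"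
          by (simp add: Bm_def B g1_def[symmetric] g2_def[symmetric] g_def[symmetric] f_def[symmetric]
            diff_divide_distrib[symmetric])
        moreover have "\<bar>\<integral>p. indicator (U r \<times> V q) p * (g m p - f p) \<partial>?L\<bar> \<le> \<rho> * e m"
          unfolding e_def using elim fb len that by (intro L2_rectangle_pairing(2)) auto
        ultimately have "\<bar>Bm m r q - B r q\<bar> \<le> \<rho> * e m / \<rho>"
          using \<rho> by (simp only: abs_divide abs_of_pos divide_right_mono less_imp_le)
        then show ?thesis using \<rho> by simp
      qed
      have "(cmod (\<integral>\<omega>. iexp (z * (T1 m \<omega> - T2 m \<omega>)) \<partial>M))\<^sup>2
        \<le> (1 + 8 * z\<^sup>2 * (\<sigma>m m)\<^sup>2) powr (- (real (card R) / 2))"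
        unfolding T1_def T2_def
      proof (rule simple_I2_char_bound[OF sd1 sd2 R, where B="Bm m"])
        fix \<eta> :: "'r \<Rightarrow> real"
        have D': "(D - e m) - card R * (E + e m) = \<sigma>m m" by (simp add: \<sigma>m_def \<sigma> algebra_simps)
        show "(\<sigma>m m)\<^sup>2 * (\<Sum>q\<in>R. (\<eta> q)\<^sup>2) \<le> (\<Sum>r\<in>R. (\<Sum>q\<in>R. Bm m r q * \<eta> q)\<^sup>2)"
          unfolding D'[symmetric]
        proof (rule diagonally_dominant_lower_bound[OF R])
          show "D - e m \<le> Bm m r r" if "r \<in> R" for r
            using close[OF that that] diag[OF that] by linarith
          show "\<bar>Bm m r q\<bar> \<le> E + e m" if "r \<in> R" "q \<in> R" "r \<noteq> q" for r q
            using close[OF that(1,2)] off[OF that] by linarith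
        qed (use E e0[of m] elim(1) D' in auto)
      qed (use fb len \<rho> disj in \<open>auto simp: Bm_def\<close>)
      then show ?case by (simp add: S_def)
    qed
  qed
  obtain r where r: "strict_mono r" "AE \<omega> in M. (\<lambda>m. (S (r m) \<omega> - Z \<omega>)\<^sup>2) \<longlonglongrightarrow> 0"
    by (rule AE_subseq_tendsto_0[of "\<lambda>m \<omega>. (S m \<omega> - Z \<omega>)\<^sup>2" M]) (auto intro: SZ)
  have lhs: "(\<lambda>m. \<integral>\<omega>. iexp (z * S (r m) \<omega>) \<partial>M) \<longlonglongrightarrow> (\<integral>\<omega>. iexp (z * Z \<omega>) \<partial>M)"
  proof (rule integral_dominated_convergence[where w="\<lambda>_. 1"])
    show "AE \<omega> in M. (\<lambda>m. iexp (z * S (r m) \<omega>)) \<longlonglongrightarrow> iexp (z * Z \<omega>)"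
      using r(2)
    proof eventually_elim
      case (elim \<omega>)
      have "(\<lambda>m. sqrt ((S (r m) \<omega> - Z \<omega>)\<^sup>2)) \<longlonglongrightarrow> sqrt 0" by (intro tendsto_real_sqrt elim)
      then have "(\<lambda>m. S (r m) \<omega> - Z \<omega>) \<longlonglongrightarrow> 0" by (simp add: tendsto_rabs_zero_iff)
      then have "(\<lambda>m. S (r m) \<omega>) \<longlonglongrightarrow> Z \<omega>" by (simp add: LIM_zero_iff)
      then show ?case by (intro tendsto_intros)
    qed
  qed auto
  have rhs: "(\<lambda>m. (1 + 8 * z\<^sup>2 * (\<sigma>m (r m))\<^sup>2) powr (- (real (card R) / 2)))
      \<longlonglongrightarrow> (1 + 8 * z\<^sup>2 * \<sigma>\<^sup>2) powr (- (real (card R) / 2))"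
  proof -
    have "(\<lambda>m. \<sigma>m (r m)) \<longlonglongrightarrow> \<sigma>" using LIMSEQ_subseq_LIMSEQ[OF \<sigma>m r(1)] by (simp add: o_def)
    moreover have "0 \<le> 8 * z\<^sup>2 * \<sigma>\<^sup>2" by simp
    then have "1 + 8 * z\<^sup>2 * \<sigma>\<^sup>2 \<noteq> 0" by linarith
    ultimately show ?thesis
      by (intro tendsto_powr tendsto_add tendsto_mult tendsto_power tendsto_const)
  qed
  have "(cmod (\<integral>\<omega>. iexp (z * Z \<omega>) \<partial>M))\<^sup>2 \<le> (1 + 8 * z\<^sup>2 * \<sigma>\<^sup>2) powr (- (real (card R) / 2))"
  proof (rule tendsto_le[OF _ rhs])
    show "(\<lambda>m. (cmod (\<integral>\<omega>. iexp (z * S (r m) \<omega>) \<partial>M))\<^sup>2) \<longlonglongrightarrow> (cmod (\<integral>\<omega>. iexp (z * Z \<omega>) \<partial>M))\<^sup>2"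
      by (intro tendsto_intros lhs)
    show "\<forall>\<^sub>F m in sequentially. (cmod (\<integral>\<omega>. iexp (z * S (r m) \<omega>) \<partial>M))\<^sup>2
      \<le> (1 + 8 * z\<^sup>2 * (\<sigma>m (r m))\<^sup>2) powr (- (real (card R) / 2))"
      using eventually_compose_filterlim[OF bound filterlim_subseq[OF r(1)]] .
  qed simp
  then show ?thesis by (simp add: Z_def)
qed

section \<open>Increments of the generalized Rosenblatt process\<close>

lemma powr_overlap_pair_square_integrable:
  assumes "- 3 / 4 < a" "a < - 1 / 2" "- 3 / 4 < b" "b < - 1 / 2"
  shows "(\<integral>\<^sup>+p. (powr_overlap a b t p + powr_overlap b a t p)\<^sup>2 \<partial>lborel2) < \<infinity>"
proof -
  have "(u + v)\<^sup>2 \<le> 4 * u\<^sup>2 + 4 * v\<^sup>2" for u v :: ennreal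
  proof -
    have "u + v \<le> 2 * max u v" using add_mono[of u "max u v" v "max u v"] by (simp add: mult_2)
    then have "(u + v)\<^sup>2 \<le> (2 * max u v)\<^sup>2" by (intro power_mono) auto
    also have "\<dots> = 4 * (max u v)\<^sup>2" by (simp add: power_mult_distrib)
    also have "\<dots> \<le> 4 * u\<^sup>2 + 4 * v\<^sup>2" by (cases "u \<le> v") (auto simp: max_def intro: add_increasing add_increasing2)
    finally show ?thesis .
  qed
  then have "(\<integral>\<^sup>+p. (powr_overlap a b t p + powr_overlap b a t p)\<^sup>2 \<partial>lborel2) \<le>
     (\<integral>\<^sup>+p. 4 * (powr_overlap a b t p)\<^sup>2 + 4 * (powr_overlap b a t p)\<^sup>2 \<partial>lborel2)"
    by (intro nn_integral_mono)
  also have "\<dots> < \<infinity>"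
    using powr_overlap_square_integrable[of a b t] powr_overlap_square_integrable[of b a t] assms
    by (simp add: nn_integral_add nn_integral_cmult ennreal_add_less_top ennreal_mult_less_top)
  finally show ?thesis .
qed

lemma ennreal_liminf_superadditive:
  fixes f g :: "nat \<Rightarrow> ennreal"
  shows "liminf f + liminf g \<le> liminf (\<lambda>n. f n + g n)"
proof -
  have inc: "incseq (\<lambda>n. INF m\<in>{n..}. h m)" for h :: "nat \<Rightarrow> ennreal"
    by (intro incseq_SucI INF_superset_mono) auto
  have "liminf f + liminf g = (SUP n. (INF m\<in>{n..}. f m) + (INF m\<in>{n..}. g m))"
    unfolding liminf_SUP_INF by (rule ennreal_SUP_add[symmetric, OF inc inc])
  also have "\<dots> \<le> (SUP n. INF m\<in>{n..}. f m + g m)"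
    by (intro SUP_mono' INF_greatest add_mono INF_lower) auto
  finally show ?thesis by (simp add: liminf_SUP_INF)
qed

lemma powr_overlap_pair_lsc:
  assumes "c < powr_overlap a b t p + powr_overlap b a t p"
  shows "\<forall>\<^sub>F q in nhds p. c < powr_overlap a b t q + powr_overlap b a t q"
proof (unfold eventually_nhds_iff_sequentially, intro allI impI)
  fix X assume X: "X \<longlonglongrightarrow> p"
  have "powr_overlap a b t p + powr_overlap b a t p \<le> liminf (\<lambda>n. powr_overlap a b t (X n)) + liminf (\<lambda>n. powr_overlap b a t (X n))"
    by (intro add_mono powr_overlap_lsc X)
  also have "\<dots> \<le> liminf (\<lambda>n. powr_overlap a b t (X n) + powr_overlap b a t (X n))"
    by (rule ennreal_liminf_superadditive)
  finally show "\<forall>\<^sub>F n in sequentially. c < powr_overlap a b t (X n) + powr_overlap b a t (X n)"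
    using assms by (intro less_LiminfD) (rule less_le_trans)
qed

definition rosenblatt_fun :: "real \<Rightarrow> real \<Rightarrow> real \<Rightarrow> real \<times> real \<Rightarrow> real"
  where "rosenblatt_fun h1 h2 t = (\<lambda>(x, y). LBINT s:{0..t}. rosenblatt_kernel h1 h2 s x y)"

lemma rosenblatt_fun_eq:
  "rosenblatt_fun h1 h2 t p =
    enn2real (powr_overlap (h1/2 - 1) (h2/2 - 1) t p + powr_overlap (h2/2 - 1) (h1/2 - 1) t p)"
  by (cases p) (simp add: rosenblatt_fun_def kernel_integral_eq_overlap)

lemma (in white_noise) gen_rosenblatt_has_I2:
  assumes h: "h1 \<in> {1/2<..<1}" "h2 \<in> {1/2<..<1}"
  shows "has_I2 M W (rosenblatt_fun h1 h2 t) (gen_rosenblatt M W h1 h2 t)"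
proof -
  let ?a = "h1/2 - 1" and ?b = "h2/2 - 1"
  have "\<exists>Z. has_I2 M W (\<lambda>p. enn2real (powr_overlap ?a ?b t p + powr_overlap ?b ?a t p)) Z"
  proof (rule has_I2_exists)
    show "powr_overlap ?a ?b t (x, y) + powr_overlap ?b ?a t (x, y) = powr_overlap ?a ?b t (y, x) + powr_overlap ?b ?a t (y, x)" for x y
      by (simp only: powr_overlap_swap[of ?a ?b t x y] powr_overlap_swap[of ?b ?a t x y] add.commute)
    show "(\<integral>\<^sup>+p. (powr_overlap ?a ?b t p + powr_overlap ?b ?a t p)\<^sup>2 \<partial>lborel2) < \<infinity>"
      using h by (intro powr_overlap_pair_square_integrable) auto
  qed (auto intro: powr_overlap_pair_lsc)
  then have "\<exists>Z. has_I2 M W (rosenblatt_fun h1 h2 t) Z"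
    unfolding rosenblatt_fun_eq[abs_def] .
  then have "has_I2 M W (rosenblatt_fun h1 h2 t) (SOME Z. has_I2 M W (rosenblatt_fun h1 h2 t) Z)"
    by (rule someI_ex)
  then show ?thesis unfolding gen_rosenblatt_def I2_def rosenblatt_fun_def .
qed

lemma rosenblatt_fun_eq_0: "t \<le> x \<or> t \<le> y \<Longrightarrow> rosenblatt_fun h1 h2 t (x, y) = 0"
  by (simp add: rosenblatt_fun_eq powr_overlap_eq_0)

lemma powr_overlap_far:
  assumes a: "- 3 / 4 < a" "a < - 1 / 2" and b: "- 3 / 4 < b" "b < - 1 / 2"
    and d: "0 < d" "d / 8 \<le> \<bar>x - y\<bar>" "t - d \<le> x" "t - d \<le> y"
  shows "powr_overlap a b t (x, y) \<le> ennreal (32 * d powr (a + b + 1))"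
proof -
  have *: "powr_overlap a b t (x, y) \<le> ennreal (32 * d powr (a + b + 1))"
    if ab: "- 3 / 4 < a" "a < - 1 / 2" "- 3 / 4 < b" "b < - 1 / 2" and xy: "d / 8 \<le> y - x" "t - d \<le> y" for a b x y
  proof -
    have pos: "0 < d / 8" "0 < y - x" using d(1) xy(1) by (auto intro: less_le_trans)
    have "(y - x) powr a \<le> (d / 8) powr a" using pos xy ab by (intro powr_antimono) auto
    also have "\<dots> = d powr a * 8 powr (- a)" using d(1) by (simp add: powr_divide powr_minus field_simps)
    also have "\<dots> \<le> d powr a * 8 powr 1" using ab by (intro mult_left_mono powr_mono) auto
    finally have 1: "(y - x) powr a \<le> 8 * d powr a" by simp
    have "pos_powr (t - y) (b + 1) \<le> d powr (b + 1)"
      using xy ab d(1) by (auto simp: pos_powr_def intro!: powr_mono2)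
    then have "pos_powr (t - y) (b + 1) / (b + 1) \<le> d powr (b + 1) / (1 / 4)"
      using ab by (intro frac_le) auto
    then have 2: "pos_powr (t - y) (b + 1) / (b + 1) \<le> 4 * d powr (b + 1)" by simp
    have "powr_overlap a b t (x, y) \<le> ennreal ((y - x) powr a * (pos_powr (t - y) (b + 1) / (b + 1)))"
      using ab pos by (intro powr_overlap_upper) auto
    also have "\<dots> \<le> ennreal (8 * d powr a * (4 * d powr (b + 1)))"
      using 1 2 ab by (intro ennreal_leI mult_mono divide_nonneg_pos) auto
    also have "8 * d powr a * (4 * d powr (b + 1)) = 32 * d powr (a + b + 1)"
      by (simp add: powr_add[symmetric] add.assoc)
    finally show ?thesis .
  qed
  show ?thesis
  proof (cases "x < y")
    case True
    then show ?thesis using *[of a b y x] a b d by auto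
  next
    case False
    then have "powr_overlap b a t (y, x) \<le> ennreal (32 * d powr (b + a + 1))" using a b d by (intro *) auto
    then show ?thesis by (simp only: powr_overlap_swap[of a b t x y] add.commute[of a b])
  qed
qed

text \<open>The constant: \<open>(d/8) powr a \<le> 8 * d powr a\<close> as \<open>a > -1\<close>, the integral of the other factor
  contributes at most \<open>1 / (b + 1) \<le> 4\<close>, and the kernel has two such terms.\<close>

lemma rosenblatt_fun_far:
  assumes h: "h1 \<in> {1/2<..<1}" "h2 \<in> {1/2<..<1}"
    and d: "0 < d" "d / 8 \<le> \<bar>x - y\<bar>" "t - d \<le> x" "t - d \<le> y"
  shows "0 \<le> rosenblatt_fun h1 h2 t (x, y)"
    "rosenblatt_fun h1 h2 t (x, y) \<le> 64 * d powr ((h1 + h2) / 2 - 1)"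
proof -
  let ?a = "h1/2 - 1" and ?b = "h2/2 - 1"
  have e: "?a + ?b + 1 = (h1 + h2) / 2 - 1" "?b + ?a + 1 = (h1 + h2) / 2 - 1" by (auto simp: field_simps)
  have "powr_overlap ?a ?b t (x, y) + powr_overlap ?b ?a t (x, y) \<le>
    ennreal (32 * d powr ((h1 + h2) / 2 - 1)) + ennreal (32 * d powr ((h1 + h2) / 2 - 1))"
    using powr_overlap_far[of ?a ?b d x y t] powr_overlap_far[of ?b ?a d x y t] h d unfolding e by (intro add_mono) auto
  also have "\<dots> = ennreal (64 * d powr ((h1 + h2) / 2 - 1))" by (simp add: ennreal_plus[symmetric] del: ennreal_plus)
  finally show "rosenblatt_fun h1 h2 t (x, y) \<le> 64 * d powr ((h1 + h2) / 2 - 1)"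
    unfolding rosenblatt_fun_eq by (intro enn2real_leI) auto
  show "0 \<le> rosenblatt_fun h1 h2 t (x, y)" by (simp add: rosenblatt_fun_eq)
qed

text \<open>Each of the two terms of the kernel contributes \<open>3 powr (a + b) \<ge> 1/9\<close>, as \<open>a + b > -2\<close>.\<close>

lemma rosenblatt_fun_near:
  assumes h: "h1 \<in> {1/2<..<1}" "h2 \<in> {1/2<..<1}"
    and xy: "x < y" "y \<le> x + 2 * l" "0 \<le> y" "y + l \<le> t"
  shows "2 / 9 * l powr ((h1 + h2) / 2 - 1) \<le> rosenblatt_fun h1 h2 t (x, y)"
proof -
  let ?a = "h1/2 - 1" and ?b = "h2/2 - 1"
  have l: "l > 0" using xy by linarith
  have fin: "powr_overlap a b t (x, y) < \<infinity>" if "a \<le> 0" "b > -1" for a b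
    using powr_overlap_upper[OF that xy(1), of t] by (rule le_less_trans) simp
  have low: "ennreal (1 / 9 * l powr ((h1 + h2) / 2 - 1)) \<le> powr_overlap a b t (x, y)"
    if ab: "a \<le> 0" "b \<le> 0" "a + b = (h1 + h2) / 2 - 2" for a b
  proof -
    have "(1::real) / 9 = 3 powr (- 2)" by (simp add: powr_minus powr_numeral)
    also have "\<dots> \<le> 3 powr (a + b)" using h unfolding ab by (intro powr_mono) auto
    finally have "1 / 9 * (l * l powr (a + b)) \<le> 3 powr (a + b) * (l * l powr (a + b))"
      using l by (intro mult_right_mono) auto
    also have "\<dots> = l * (3 * l) powr (a + b)" using l by (simp add: powr_mult)
    also have "l * l powr (a + b) = l powr ((h1 + h2) / 2 - 1)"
      using l powr_add[of l 1 "a + b"] by (simp add: ab)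
    finally have "ennreal (1 / 9 * l powr ((h1 + h2) / 2 - 1)) \<le> ennreal (l * (3 * l) powr (a + b))"
      by (rule ennreal_leI)
    also have "\<dots> \<le> powr_overlap a b t (x, y)" by (rule powr_overlap_lower[OF ab(1,2) xy])
    finally show ?thesis .
  qed
  have "ennreal (2 / 9 * l powr ((h1 + h2) / 2 - 1)) =
      ennreal (1 / 9 * l powr ((h1 + h2) / 2 - 1)) + ennreal (1 / 9 * l powr ((h1 + h2) / 2 - 1))"
    by (simp add: ennreal_plus[symmetric] del: ennreal_plus)
  also have "\<dots> \<le> powr_overlap ?a ?b t (x, y) + powr_overlap ?b ?a t (x, y)"
    using h by (intro add_mono low) (auto simp: field_simps)
  finally have "enn2real (ennreal (2 / 9 * l powr ((h1 + h2) / 2 - 1))) \<le> rosenblatt_fun h1 h2 t (x, y)"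
    unfolding rosenblatt_fun_eq using h fin[of ?a ?b] fin[of ?b ?a] by (intro enn2real_mono) auto
  then show ?thesis by simp
qed

lemma rectangle_integral_bounds:
  assumes UV: "U \<in> fin_borel" "V \<in> fin_borel" "measure lborel U = \<rho>" "measure lborel V = \<rho>"
    and int: "integrable lborel2 (\<lambda>p. indicator (U \<times> V) p * h p)"
  shows "(\<And>x y. x \<in> U \<Longrightarrow> y \<in> V \<Longrightarrow> c \<le> h (x, y)) \<Longrightarrow>
      c * \<rho>\<^sup>2 \<le> (\<integral>p. indicator (U \<times> V) p * h p \<partial>lborel2)"
    and "(\<And>x y. x \<in> U \<Longrightarrow> y \<in> V \<Longrightarrow> h (x, y) \<le> c) \<Longrightarrow>
      (\<integral>p. indicator (U \<times> V) p * h p \<partial>lborel2) \<le> c * \<rho>\<^sup>2"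
proof -
  have s: "U \<times> V \<in> sets lborel2" using UV by (auto simp: fin_borel_def)
  have em: "emeasure lborel2 (U \<times> V) = ennreal (\<rho>\<^sup>2)"
    using emeasure_cell[OF UV(1,2)] UV(3,4) by (simp add: power2_eq_square)
  then have m: "measure lborel2 (U \<times> V) = \<rho>\<^sup>2" by (simp add: measure_def)
  have i: "integrable lborel2 (\<lambda>p. indicator (U \<times> V) p * c)"
    using s em by (intro integrable_mult_left) auto
  have v: "(\<integral>p. indicator (U \<times> V) p * c \<partial>lborel2) = c * \<rho>\<^sup>2"
    using s em m by (simp add: mult.commute)
  show "c * \<rho>\<^sup>2 \<le> (\<integral>p. indicator (U \<times> V) p * h p \<partial>lborel2)"
    if "\<And>x y. x \<in> U \<Longrightarrow> y \<in> V \<Longrightarrow> c \<le> h (x, y)"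
    unfolding v[symmetric] using that by (intro integral_mono i int) (auto split: split_indicator)
  show "(\<integral>p. indicator (U \<times> V) p * h p \<partial>lborel2) \<le> c * \<rho>\<^sup>2"
    if "\<And>x y. x \<in> U \<Longrightarrow> y \<in> V \<Longrightarrow> h (x, y) \<le> c"
    unfolding v[symmetric] using that by (intro integral_mono i int) (auto split: split_indicator)
qed

text \<open>The test rectangles lie in the square of \<open>(s, t)\<close>, where the difference of the two kernels is the kernel at
  time \<open>t\<close>. The diagonal entries are at least \<open>193 * \<theta> * (t - s) powr H\<close> by the choice of
  \<open>\<theta>\<close>, the other entries at most \<open>64 * \<theta> * (t - s) powr H\<close>, and \<open>193 - 3 * 64 = 1\<close>.\<close>

lemma (in white_noise) rosenblatt_increment_char_bound:
  assumes h: "h1 \<in> {1/2<..<1}" "h2 \<in> {1/2<..<1}" and k: "k1 \<in> {1/2<..<1}" "k2 \<in> {1/2<..<1}"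
    and st: "0 \<le> s" "s < t"
    and \<theta>: "0 < \<theta>" "\<theta> \<le> 1 / 40" "193 \<le> 2 / 9 * \<theta> powr ((h1 + h2) / 2 - 1)"
  shows "(cmod (\<integral>\<omega>. iexp (z * (gen_rosenblatt M W h1 h2 t \<omega> - gen_rosenblatt M W k1 k2 s \<omega>)) \<partial>M))\<^sup>2
    \<le> (1 + 8 * z\<^sup>2 * (\<theta> * (t - s) powr ((h1 + h2) / 2))\<^sup>2) powr (- (3 / 2))"
proof -
  define d where "d = t - s"
  define H where "H = (h1 + h2) / 2"
  define l where "l = \<theta> * d"
  have d: "d > 0" using st by (simp add: d_def)
  have l: "l > 0" "l \<le> d / 40" using d \<theta> by (auto simp: l_def intro: order_trans[OF mult_right_mono])
  \<comment> \<open>left end points of the three pairs; the factor \<open>1/5\<close> keeps the pairs apart and leaves room below \<open>t\<close>\<close>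
  define p where "p r = s + real (r + 1) * d / 5" for r :: nat
  define U where "U r = {p r..<p r + l}" for r
  define V where "V r = {p r + l..<p r + 2 * l}" for r
  have p3: "p r \<in> {s<..s + 3 * d / 5}" if "r < 3" for r
    using d that by (auto simp: p_def)
  have psep: "\<bar>p r - p q\<bar> \<ge> d / 5" if "r \<noteq> q" for r q
  proof -
    have "\<bar>real r - real q\<bar> \<ge> 1" using that by linarith
    then have "\<bar>real r - real q\<bar> * (d / 5) \<ge> 1 * (d / 5)" using d by (intro mult_right_mono) auto
    moreover have "p r - p q = (real r - real q) * (d / 5)" by (simp add: p_def field_simps)
    ultimately show ?thesis using d by (simp only: abs_mult)
  qed
  have Udisj: "U r \<inter> U q = {}" and Vdisj: "V r \<inter> V q = {}" if "r \<noteq> q" for r q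
  proof -
    have "\<bar>p r - p q\<bar> > 2 * l" using psep[OF that] l d by linarith
    then show "U r \<inter> U q = {}" "V r \<inter> V q = {}" unfolding U_def V_def using l by (auto simp: disjoint_iff)
  qed
  have UVdisj: "U r \<inter> V q = {}" for r q
  proof (cases "r = q")
    case False
    then have "\<bar>p r - p q\<bar> > 2 * l" using psep[OF False] l d by linarith
    then show ?thesis unfolding U_def V_def using l by (auto simp: disjoint_iff)
  qed (auto simp: U_def V_def)
  have fb: "U r \<in> fin_borel" "V r \<in> fin_borel" for r
    using l by (auto simp: U_def V_def fin_borel_def)
  have len: "measure lborel (U r) = l" "measure lborel (V r) = l" for r
    using l by (auto simp: U_def V_def)
  define f where "f q = rosenblatt_fun h1 h2 t q - rosenblatt_fun k1 k2 s q" for q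
  have I1: "has_I2 M W (rosenblatt_fun h1 h2 t) (gen_rosenblatt M W h1 h2 t)"
    and I2: "has_I2 M W (rosenblatt_fun k1 k2 s) (gen_rosenblatt M W k1 k2 s)"
    by (intro gen_rosenblatt_has_I2 h k)+
  have int: "integrable lborel2 (\<lambda>w. indicator (U r \<times> V q) w * f w)" for r q
  proof -
    have "integrable lborel2 (\<lambda>w. indicator (U r \<times> V q) w * g w)"
      if "square_integrable lborel2 g" for g
      using that fb len by (intro L2_rectangle_pairing(1))
        (auto simp: square_integrable_def integrable_iff_bounded)
    moreover have "square_integrable lborel2 (rosenblatt_fun h1 h2 t)"
      "square_integrable lborel2 (rosenblatt_fun k1 k2 s)"
      using I1 I2 unfolding has_I2_def by blast+
    ultimately show ?thesis unfolding f_def right_diff_distrib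
      by (intro Bochner_Integration.integrable_diff)
  qed
  have f_eq: "f (x, y) = rosenblatt_fun h1 h2 t (x, y)" if "x \<in> U r" "y \<in> V q" "r < 3" for x y r q
    using that p3[of r] by (auto simp: f_def U_def rosenblatt_fun_eq_0)
  have D: "193 * \<theta> * d powr H \<le> (\<integral>w. indicator (U r \<times> V r) w * f w \<partial>lborel2) / l" if r: "r < 3" for r
  proof -
    have near: "2 / 9 * l powr (H - 1) \<le> rosenblatt_fun h1 h2 t (x, y)" if "x \<in> U r" "y \<in> V r" for x y
      unfolding H_def
    proof (intro rosenblatt_fun_near h)
      have xy: "p r \<le> x" "x < p r + l" "p r + l \<le> y" "y < p r + 2 * l" "s < p r" "p r \<le> s + 3 * d / 5" "d = t - s"
        using that p3[OF r] by (auto simp: U_def V_def d_def)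
      show "x < y" "y \<le> x + 2 * l" "0 \<le> y" "y + l \<le> t" using xy l d st by linarith+
    qed
    have large: "193 * d powr (H - 1) \<le> 2 / 9 * l powr (H - 1)"
    proof -
      have "l powr (H - 1) = \<theta> powr (H - 1) * d powr (H - 1)" using \<theta> d by (simp add: l_def powr_mult)
      then show ?thesis using mult_right_mono[OF \<theta>(3), of "d powr (H - 1)"] by (simp add: H_def)
    qed
    have bd: "193 * d powr (H - 1) \<le> f (x, y)" if "x \<in> U r" "y \<in> V r" for x y
      unfolding f_eq[OF that r] by (rule order_trans[OF large near[OF that]])
    have "193 * d powr (H - 1) * l\<^sup>2 \<le> (\<integral>w. indicator (U r \<times> V r) w * f w \<partial>lborel2)"
      by (rule rectangle_integral_bounds(1)[OF fb(1)[of r] fb(2)[of r] len(1) len(2) int bd])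
    then have "193 * d powr (H - 1) * l\<^sup>2 / l \<le> (\<integral>w. indicator (U r \<times> V r) w * f w \<partial>lborel2) / l"
      using l by (intro divide_right_mono) auto
    moreover have "193 * d powr (H - 1) * l\<^sup>2 / l = 193 * \<theta> * (d powr (H - 1) * d)"
      using l d \<theta> by (simp add: power2_eq_square l_def)
    moreover have "d powr (H - 1) * d = d powr H" using d powr_add[of d "H - 1" 1] by simp
    ultimately show ?thesis by simp
  qed
  have E: "\<bar>(\<integral>w. indicator (U r \<times> V q) w * f w \<partial>lborel2) / l\<bar> \<le> 64 * \<theta> * d powr H"
    if r: "r < 3" "q < 3" "r \<noteq> q" for r q
  proof -
    have bd: "0 \<le> f (x, y) \<and> f (x, y) \<le> 64 * d powr (H - 1)" if xy: "x \<in> U r" "y \<in> V q" for x y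
    proof -
      have "d / 8 \<le> \<bar>x - y\<bar>" using xy psep[OF r(3)] l d unfolding U_def V_def atLeastLessThan_iff by linarith
      then show ?thesis
        unfolding f_eq[OF xy r(1)] H_def using rosenblatt_fun_far[OF h d, of x y t] xy p3[OF r(1)] p3[OF r(2)] l
        by (auto simp: U_def V_def d_def)
    qed
    note b = rectangle_integral_bounds[OF fb(1)[of r] fb(2)[of q] len(1) len(2) int]
    let ?I = "\<integral>w. indicator (U r \<times> V q) w * f w \<partial>lborel2"
    have "0 * l\<^sup>2 \<le> ?I" by (rule b(1)) (use bd in blast)
    moreover have "?I \<le> 64 * d powr (H - 1) * l\<^sup>2" by (rule b(2)) (use bd in blast)
    ultimately have "\<bar>?I / l\<bar> \<le> 64 * d powr (H - 1) * l\<^sup>2 / l" using l by (simp add: divide_right_mono)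
    also have "\<dots> = 64 * \<theta> * (d powr (H - 1) * d)"
      using l d \<theta> by (simp add: power2_eq_square l_def)
    also have "d powr (H - 1) * d = d powr H" using d powr_add[of d "H - 1" 1] by simp
    finally show ?thesis .
  qed
  have "(cmod (\<integral>\<omega>. iexp (z * (gen_rosenblatt M W h1 h2 t \<omega> - gen_rosenblatt M W k1 k2 s \<omega>)) \<partial>M))\<^sup>2
    \<le> (1 + 8 * z\<^sup>2 * (\<theta> * d powr H)\<^sup>2) powr (- (real (card {..<3::nat}) / 2))"
  proof (rule has_I2_diff_char_bound[OF I1 I2, where U=U and V=V and \<rho>=l and D="193 * \<theta> * d powr H" and E="64 * \<theta> * d powr H"])
    show "disjoint_family_on U {..<3}" "disjoint_family_on V {..<3}"
      unfolding disjoint_family_on_def using Udisj Vdisj by blast+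
    show "U r \<inter> V q = {}" for r q by (rule UVdisj)
  qed (use fb len l D E d \<theta> in \<open>auto simp: f_def\<close>)
  then show ?thesis by (simp add: d_def H_def)
qed

section \<open>The heat kernel and decay of characteristic functions\<close>

text \<open>Up to a factor, the Gaussian density is the characteristic function of the Gaussian law of the
  inverse variance.\<close>

lemma normal_density_fourier:
  assumes v: "v > 0"
  shows "complex_of_real (normal_density 0 (sqrt v) y) = complex_of_real (1 / sqrt (2 * pi * v)) * (\<integral>z. iexp (y * z) \<partial>gauss (1 / v))"
  using v gauss_char[of "1 / v" y] by (simp add: normal_density_def)

lemma normal_density_le: "v > 0 \<Longrightarrow> normal_density 0 (sqrt v) y \<le> 1 / sqrt (2 * pi * v)"
  by (simp add: normal_density_def divide_right_mono)

text \<open>Fourier inversion for the law of \<open>Y\<close> smoothed by a Gaussian. Written with the law of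
  variance \<open>1 / v\<close> instead of Lebesgue measure, the exchange of integrals concerns a bounded function on a
  product of probability spaces.\<close>

lemma (in prob_space) expectation_normal_density:
  assumes [measurable]: "Y \<in> borel_measurable M" and v: "v > 0"
  shows "complex_of_real (\<integral>\<omega>. normal_density 0 (sqrt v) (Y \<omega>) \<partial>M) =
    complex_of_real (1 / (2 * pi)) * (\<integral>z. exp (- (v * z\<^sup>2 / 2)) *\<^sub>R (\<integral>\<omega>. iexp (z * Y \<omega>) \<partial>M) \<partial>lborel)"
proof -
  interpret G: prob_space "gauss (1 / v)" by (rule prob_space_gauss)
  interpret MG: pair_prob_space M "gauss (1 / v)" ..
  define c where "c = 1 / sqrt (2 * pi * v)"
  define \<phi> where "\<phi> z = (\<integral>\<omega>. iexp (z * Y \<omega>) \<partial>M)" for z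
  have [measurable]: "\<phi> \<in> borel_measurable borel" unfolding \<phi>_def by measurable
  have "complex_of_real (\<integral>\<omega>. normal_density 0 (sqrt v) (Y \<omega>) \<partial>M) =
      (\<integral>\<omega>. complex_of_real (normal_density 0 (sqrt v) (Y \<omega>)) \<partial>M)" by simp
  also have "\<dots> = complex_of_real c * (\<integral>\<omega>. (\<integral>z. iexp (Y \<omega> * z) \<partial>gauss (1 / v)) \<partial>M)"
    unfolding normal_density_fourier[OF v] c_def by simp
  also have "(\<integral>\<omega>. (\<integral>z. iexp (Y \<omega> * z) \<partial>gauss (1 / v)) \<partial>M) = (\<integral>z. (\<integral>\<omega>. iexp (Y \<omega> * z) \<partial>M) \<partial>gauss (1 / v))"
  proof (rule MG.Fubini_integral[symmetric], unfold case_prod_beta, rule MG.P.integrable_cmod_le_1)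
    show "(\<lambda>p. iexp (Y (fst p) * snd p)) \<in> borel_measurable (M \<Otimes>\<^sub>M gauss (1 / v))" by measurable
  qed (simp only: norm_exp_i_times order_refl)
  also have "\<dots> = (\<integral>z. \<phi> z \<partial>gauss (1 / v))" by (simp only: \<phi>_def mult.commute)
  also have "\<dots> = (\<integral>z. normal_density 0 (sqrt (1 / v)) z *\<^sub>R \<phi> z \<partial>lborel)"
    using v by (subst gauss_density) (auto intro!: integral_density)
  also have "complex_of_real c * \<dots> = c *\<^sub>R (\<integral>z. normal_density 0 (sqrt (1 / v)) z *\<^sub>R \<phi> z \<partial>lborel)"
    by (rule scaleR_conv_of_real[symmetric])
  also have "\<dots> = (\<integral>z. c *\<^sub>R normal_density 0 (sqrt (1 / v)) z *\<^sub>R \<phi> z \<partial>lborel)"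
    by (rule integral_scaleR_right[symmetric])
  also have "\<dots> = (\<integral>z. (1 / (2 * pi)) *\<^sub>R exp (- (v * z\<^sup>2 / 2)) *\<^sub>R \<phi> z \<partial>lborel)"
  proof (intro Bochner_Integration.integral_cong refl)
    fix z
    have "sqrt (2 * pi * v) * sqrt (2 * pi * (1 / v)) = sqrt ((2 * pi)\<^sup>2)"
      unfolding real_sqrt_mult[symmetric] using v by (simp add: power2_eq_square)
    also have "\<dots> = 2 * pi" by (intro real_sqrt_unique) auto
    finally have "c * (1 / sqrt (2 * pi * (1 / v))) = 1 / (2 * pi)"
      unfolding c_def times_divide_times_eq by simp
    moreover have "normal_density 0 (sqrt (1 / v)) z = 1 / sqrt (2 * pi * (1 / v)) * exp (- (v * z\<^sup>2 / 2))"
      using v by (simp add: normal_density_def mult.commute)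
    ultimately have "c * normal_density 0 (sqrt (1 / v)) z = 1 / (2 * pi) * exp (- (v * z\<^sup>2 / 2))"
      by (simp only: mult.assoc[symmetric])
    then show "c *\<^sub>R normal_density 0 (sqrt (1 / v)) z *\<^sub>R \<phi> z = (1 / (2 * pi)) *\<^sub>R exp (- (v * z\<^sup>2 / 2)) *\<^sub>R \<phi> z"
      by (simp only: scaleR_scaleR)
  qed
  also have "\<dots> = (1 / (2 * pi)) *\<^sub>R (\<integral>z. exp (- (v * z\<^sup>2 / 2)) *\<^sub>R \<phi> z \<partial>lborel)"
    by (rule integral_scaleR_right)
  also have "\<dots> = complex_of_real (1 / (2 * pi)) * (\<integral>z. exp (- (v * z\<^sup>2 / 2)) *\<^sub>R \<phi> z \<partial>lborel)"
    by (rule scaleR_conv_of_real)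
  finally show ?thesis by (simp only: \<phi>_def)
qed

text \<open>For \<open>a = 1\<close> the integrand is at most one on \<open>[-1, 1]\<close> and at most \<open>\<bar>z\<bar> powr (-3/2)\<close> outside, which gives
  \<open>2 + 2 + 2\<close>; the general case is a rescaling.\<close>

lemma nn_integral_char_decay:
  assumes a: "a > 0"
  shows "(\<integral>\<^sup>+z. ennreal ((1 + (z * a)\<^sup>2) powr (- (3 / 4))) \<partial>lborel) \<le> ennreal (6 / a)"
proof -
  define u where "u z = (1 + z\<^sup>2) powr (- (3 / 4))" for z :: real
  have [measurable]: "u \<in> borel_measurable borel" unfolding u_def by measurable
  define w where "w = (\<lambda>z. ennreal (z powr (- (3 / 2))) * indicator {1..} (z :: real))"
  have [measurable]: "w \<in> borel_measurable borel" unfolding w_def by measurable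
  have "(\<integral>\<^sup>+z. ennreal (u z) \<partial>lborel) \<le> (\<integral>\<^sup>+z. indicator {-1..1} z + (w z + w (- z)) \<partial>lborel)"
  proof (intro nn_integral_mono)
    fix z :: real
    have 1: "u z \<le> 1"
    proof -
      have "u z \<le> 1 powr (- (3 / 4))" unfolding u_def by (intro powr_antimono) auto
      then show ?thesis by simp
    qed
    have 2: "u z \<le> \<bar>z\<bar> powr (- (3 / 2))" if "\<bar>z\<bar> \<ge> 1"
    proof -
      have e: "\<bar>z\<bar> powr 2 = z\<^sup>2" using that by (simp add: powr_numeral)
      have "u z \<le> (\<bar>z\<bar> powr 2) powr (- (3 / 4))"
        unfolding u_def e using that by (intro powr_antimono) auto
      also have "\<dots> = \<bar>z\<bar> powr (- (3 / 2))" by (simp only: powr_powr) simp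
      finally show ?thesis .
    qed
    show "ennreal (u z) \<le> indicator {-1..1} z + (w z + w (- z))"
    proof (cases "\<bar>z\<bar> \<le> 1")
      case True
      then have "ennreal (u z) \<le> indicator {-1..1} z" using ennreal_leI[OF 1] by (auto simp: abs_le_iff)
      then show ?thesis by (simp add: add_increasing2)
    next
      case False
      then have "ennreal (u z) \<le> w z + w (- z)"
        using ennreal_leI[OF 2] by (cases "z \<ge> 0") (auto simp: w_def abs_if)
      then show ?thesis by (simp add: add_increasing)
    qed
  qed
  also have "\<dots> = 2 + ((\<integral>\<^sup>+z. w z \<partial>lborel) + (\<integral>\<^sup>+z. w (- z) \<partial>lborel))"
    by (simp add: nn_integral_add)
  also have "(\<integral>\<^sup>+z. w (- z) \<partial>lborel) = (\<integral>\<^sup>+z. w z \<partial>lborel)"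
    by (subst nn_integral_real_affine[where c="-1" and t=0]) auto
  also have "(\<integral>\<^sup>+z. w z \<partial>lborel) = 2"
    unfolding w_def by (subst nn_integral_powr_inf) auto
  finally have 6: "(\<integral>\<^sup>+z. ennreal (u z) \<partial>lborel) \<le> 6" by simp
  have "(\<integral>\<^sup>+z. ennreal (u (z * a)) \<partial>lborel) = ennreal (1 / a) * (\<integral>\<^sup>+z. ennreal (u z) \<partial>lborel)"
    using a by (subst nn_integral_real_affine[where c="1 / a" and t=0]) auto
  also have "\<dots> \<le> ennreal (1 / a) * 6" by (intro mult_left_mono 6) auto
  also have "\<dots> = ennreal (6 / a)" using a by (simp add: ennreal_mult[symmetric] flip: ennreal_numeral)
  finally show ?thesis by (simp add: u_def)
qed

text \<open>The expectations of \<open>p\<^sub>v(Y)\<close> are Fourier integrals with a common integrable bound. The second part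
  states the existence of a limit as \<open>v\<close> tends to zero from the right through sequences, as it is used
  under a dominated integral.\<close>

lemma (in prob_space) char_decay_consequences:
  assumes [measurable]: "Y \<in> borel_measurable M" and a: "a > 0"
    and bd: "\<And>z. (cmod (\<integral>\<omega>. iexp (z * Y \<omega>) \<partial>M))\<^sup>2 \<le> (1 + (z * a)\<^sup>2) powr (- (3 / 2))"
  shows "v > 0 \<Longrightarrow> (\<integral>\<omega>. normal_density 0 (sqrt v) (Y \<omega>) \<partial>M) \<le> 1 / a"
    and "\<exists>l. \<forall>V. (\<forall>n. V n > 0) \<longrightarrow> V \<longlonglongrightarrow> 0 \<longrightarrow> (\<lambda>n. \<integral>\<omega>. normal_density 0 (sqrt (V n)) (Y \<omega>) \<partial>M) \<longlonglongrightarrow> l"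
proof -
  define \<phi> where "\<phi> z = (\<integral>\<omega>. iexp (z * Y \<omega>) \<partial>M)" for z
  have [measurable]: "\<phi> \<in> borel_measurable borel" unfolding \<phi>_def by measurable
  define u where "u z = (1 + (z * a)\<^sup>2) powr (- (3 / 4))" for z
  have [measurable]: "u \<in> borel_measurable borel" unfolding u_def by measurable
  have u0: "u z \<ge> 0" for z by (simp add: u_def)
  have \<phi>u: "cmod (\<phi> z) \<le> u z" for z
  proof (rule power2_le_imp_le)
    have "(1 + (z * a)\<^sup>2) powr (- (3 / 2)) = (u z)\<^sup>2"
      by (simp add: u_def power2_eq_square powr_add[symmetric])
    then show "(cmod (\<phi> z))\<^sup>2 \<le> (u z)\<^sup>2" using bd[of z] by (simp add: \<phi>_def)
  qed (rule u0)
  have un: "(\<integral>\<^sup>+z. ennreal (u z) \<partial>lborel) \<le> ennreal (6 / a)"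
    unfolding u_def by (rule nn_integral_char_decay[OF a])
  have ui: "integrable lborel u"
    using un by (intro integrableI_nonneg) (auto simp: u0 intro: le_less_trans)
  have uI: "(\<integral>z. u z \<partial>lborel) \<le> 6 / a"
    using un a by (subst integral_eq_nn_integral) (auto simp: u0 intro!: enn2real_leI)
  define e where "e v z = exp (- (v * z\<^sup>2 / 2)) *\<^sub>R \<phi> z" for v z
  have [measurable]: "e v \<in> borel_measurable borel" for v unfolding e_def by measurable
  have eu: "cmod (e v z) \<le> u z" if "v \<ge> 0" for v z
  proof -
    have "exp (- (v * z\<^sup>2 / 2)) \<le> 1" using that by simp
    then have "exp (- (v * z\<^sup>2 / 2)) * cmod (\<phi> z) \<le> 1 * u z" by (intro mult_mono \<phi>u) auto
    then show ?thesis by (simp add: e_def)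
  qed
  have eq: "complex_of_real (\<integral>\<omega>. normal_density 0 (sqrt v) (Y \<omega>) \<partial>M) = complex_of_real (1 / (2 * pi)) * (\<integral>z. e v z \<partial>lborel)"
    if "v > 0" for v
    using expectation_normal_density[OF assms(1) that] by (simp add: e_def \<phi>_def)
  show "(\<integral>\<omega>. normal_density 0 (sqrt v) (Y \<omega>) \<partial>M) \<le> 1 / a" if v: "v > 0"
  proof -
    have "(\<integral>\<omega>. normal_density 0 (sqrt v) (Y \<omega>) \<partial>M) \<le> cmod (complex_of_real (\<integral>\<omega>. normal_density 0 (sqrt v) (Y \<omega>) \<partial>M))"
      by simp
    also have "\<dots> = 1 / (2 * pi) * cmod (\<integral>z. e v z \<partial>lborel)" unfolding eq[OF v] norm_mult norm_of_real by simp
    also have "\<dots> \<le> 1 / (2 * pi) * (6 / a)"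
    proof (intro mult_left_mono)
      have i: "integrable lborel (e v)"
        using v eu[of v] by (intro Bochner_Integration.integrable_bound[OF ui]) (auto simp: u0)
      have "cmod (\<integral>z. e v z \<partial>lborel) \<le> (\<integral>z. cmod (e v z) \<partial>lborel)" by simp
      also have "\<dots> \<le> (\<integral>z. u z \<partial>lborel)" using v i by (intro integral_mono ui eu integrable_norm) auto
      also have "\<dots> \<le> 6 / a" by (rule uI)
      finally show "cmod (\<integral>z. e v z \<partial>lborel) \<le> 6 / a" .
    qed simp
    also have "1 / (2 * pi) * (6 / a) \<le> 1 / a" using a pi_gt3 by (simp add: field_simps)
    finally show ?thesis .
  qed
  show "\<exists>l. \<forall>V. (\<forall>n. V n > 0) \<longrightarrow> V \<longlonglongrightarrow> 0 \<longrightarrow> (\<lambda>n. \<integral>\<omega>. normal_density 0 (sqrt (V n)) (Y \<omega>) \<partial>M) \<longlonglongrightarrow> l"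
  proof (intro exI allI impI)
    fix V :: "nat \<Rightarrow> real" assume V: "\<forall>n. V n > 0" "V \<longlonglongrightarrow> 0"
    have "(\<lambda>n. \<integral>z. e (V n) z \<partial>lborel) \<longlonglongrightarrow> (\<integral>z. \<phi> z \<partial>lborel)"
    proof (rule integral_dominated_convergence[OF _ _ ui])
      show "AE z in lborel. (\<lambda>n. e (V n) z) \<longlonglongrightarrow> \<phi> z"
      proof (rule AE_I2)
        fix z
        have "(\<lambda>n. exp (- (V n * z\<^sup>2 / 2)) *\<^sub>R \<phi> z) \<longlonglongrightarrow> exp (- (0 * z\<^sup>2 / 2)) *\<^sub>R \<phi> z"
          by (rule tendsto_scaleR[OF tendsto_exp tendsto_const], rule tendsto_minus, rule tendsto_divide[OF tendsto_mult[OF V(2) tendsto_const] tendsto_const]) simp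
        then show "(\<lambda>n. e (V n) z) \<longlonglongrightarrow> \<phi> z" by (simp add: e_def)
      qed
      show "AE z in lborel. cmod (e (V n) z) \<le> u z" for n
        using V(1) eu[of "V n"] by (auto simp: less_imp_le)
    qed auto
    then have "(\<lambda>n. complex_of_real (1 / (2 * pi)) * (\<integral>z. e (V n) z \<partial>lborel)) \<longlonglongrightarrow> complex_of_real (1 / (2 * pi)) * (\<integral>z. \<phi> z \<partial>lborel)"
      by (intro tendsto_intros)
    then have "(\<lambda>n. complex_of_real (\<integral>\<omega>. normal_density 0 (sqrt (V n)) (Y \<omega>) \<partial>M)) \<longlonglongrightarrow> complex_of_real (1 / (2 * pi)) * (\<integral>z. \<phi> z \<partial>lborel)"
      using V(1) by (simp only: eq)
    then have "(\<lambda>n. Re (complex_of_real (\<integral>\<omega>. normal_density 0 (sqrt (V n)) (Y \<omega>) \<partial>M))) \<longlonglongrightarrow> Re (complex_of_real (1 / (2 * pi)) * (\<integral>z. \<phi> z \<partial>lborel))"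
      by (rule tendsto_Re)
    then show "(\<lambda>n. \<integral>\<omega>. normal_density 0 (sqrt (V n)) (Y \<omega>) \<partial>M) \<longlonglongrightarrow> Re (complex_of_real (1 / (2 * pi)) * (\<integral>z. \<phi> z \<partial>lborel))"
      by simp
  qed
qed

section \<open>Densities of occupation measures\<close>

text \<open>The integral of the smoothed measure over \<open>[a, b]\<close> is the measure of the pairs \<open>(t, \<xi>)\<close> with
  \<open>a \<le> z t + sqrt (V n) * \<xi> \<le> b\<close>, where \<open>\<xi>\<close> is standard Gaussian. The indicator of this set converges at every
  point \<open>(t, \<xi>)\<close>; at the end points of the interval the limit depends on the sign of \<open>\<xi>\<close>, which is why
  the limit is only located between the open and the closed interval.\<close>

lemma smoothing_limit:
  fixes z :: "'t \<Rightarrow> real" and V :: "nat \<Rightarrow> real"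
  assumes "finite_measure N" and [measurable]: "z \<in> borel_measurable N"
    and V: "\<And>n. V n > 0" "V \<longlonglongrightarrow> 0" and ab: "a < b"
  shows "\<exists>J. (\<lambda>n. \<integral>x. indicator {a..b} x * (\<integral>t. normal_density 0 (sqrt (V n)) (x - z t) \<partial>N) \<partial>lborel) \<longlonglongrightarrow> J \<and>
    measure (distr N borel z) {a<..<b} \<le> J \<and> J \<le> measure (distr N borel z) {a..b}"
proof -
  let ?S = "std_normal_distribution"
  interpret N: finite_measure N by fact
  interpret S: prob_space ?S by (rule prob_space_normal_density) simp
  interpret NS: pair_sigma_finite N ?S ..
  interpret NSf: finite_measure "N \<Otimes>\<^sub>M ?S"
    by (rule finite_measure_pair_measure) unfold_locales
  define I where "I n p = indicat_real {a..b} (z (fst p) + sqrt (V n) * snd p)" for n p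
  have [measurable]: "I n \<in> borel_measurable (N \<Otimes>\<^sub>M ?S)" for n unfolding I_def by measurable
  \<comment> \<open>the pointwise limit of the indicators\<close>
  define X where "X p = (if a < z (fst p) \<and> z (fst p) < b then 1 else
      if z (fst p) = a then indicat_real {0..} (snd p) else
      if z (fst p) = b then indicat_real {..0} (snd p) else 0)" for p :: "'t \<times> real"
  have [measurable]: "X \<in> borel_measurable (N \<Otimes>\<^sub>M ?S)" unfolding X_def by measurable
  have shift: "(\<integral>\<^sup>+x. ennreal (normal_density 0 (sqrt v) (x - y)) * indicator {a..b} x \<partial>lborel)
      = (\<integral>\<^sup>+\<xi>. indicator {a..b} (y + sqrt v * \<xi>) \<partial>?S)" if v: "v > 0" for v y
  proof -
    have "(\<integral>\<^sup>+\<xi>. indicator {a..b} (y + sqrt v * \<xi>) \<partial>?S) = (\<integral>\<^sup>+w. indicator {a..b} (y + w) \<partial>gauss v)"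
      unfolding gauss_def by (subst nn_integral_distr) auto
    also have "\<dots> = (\<integral>\<^sup>+w. ennreal (normal_density 0 (sqrt v) w) * indicator {a..b} (y + w) \<partial>lborel)"
      unfolding gauss_density[OF v] by (subst nn_integral_density) auto
    also have "\<dots> = (\<integral>\<^sup>+x. ennreal (normal_density 0 (sqrt v) (x - y)) * indicator {a..b} x \<partial>lborel)"
      by (subst (2) nn_integral_real_affine[where c=1 and t=y]) auto
    finally show ?thesis by simp
  qed
  have eq: "(\<integral>x. indicator {a..b} x * (\<integral>t. normal_density 0 (sqrt (V n)) (x - z t) \<partial>N) \<partial>lborel) = (\<integral>p. I n p \<partial>(N \<Otimes>\<^sub>M ?S))" for n
  proof -
    have i: "integrable N (\<lambda>t. normal_density 0 (sqrt (V n)) (x - z t))" for x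
      using normal_density_le[OF V(1)[of n]]
      by (intro N.integrable_const_bound[where B="1 / sqrt (2 * pi * V n)"]) auto
    interpret LN: pair_sigma_finite lborel N ..
    have "(\<integral>\<^sup>+x. ennreal (indicator {a..b} x * (\<integral>t. normal_density 0 (sqrt (V n)) (x - z t) \<partial>N)) \<partial>lborel)
        = (\<integral>\<^sup>+x. \<integral>\<^sup>+t. ennreal (normal_density 0 (sqrt (V n)) (x - z t)) * indicator {a..b} x \<partial>N \<partial>lborel)"
    proof (intro nn_integral_cong)
      fix x :: real
      have "ennreal (\<integral>t. normal_density 0 (sqrt (V n)) (x - z t) \<partial>N) = (\<integral>\<^sup>+t. ennreal (normal_density 0 (sqrt (V n)) (x - z t)) \<partial>N)"
        by (intro nn_integral_eq_integral[symmetric] i) auto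
      then show "ennreal (indicator {a..b} x * (\<integral>t. normal_density 0 (sqrt (V n)) (x - z t) \<partial>N)) =
          (\<integral>\<^sup>+t. ennreal (normal_density 0 (sqrt (V n)) (x - z t)) * indicator {a..b} x \<partial>N)"
        by (auto simp: nn_integral_multc split: split_indicator)
    qed
    also have "\<dots> = (\<integral>\<^sup>+t. \<integral>\<^sup>+x. ennreal (normal_density 0 (sqrt (V n)) (x - z t)) * indicator {a..b} x \<partial>lborel \<partial>N)"
      by (intro LN.Fubini'[symmetric]) measurable
    also have "\<dots> = (\<integral>\<^sup>+t. \<integral>\<^sup>+\<xi>. ennreal (I n (t, \<xi>)) \<partial>?S \<partial>N)"
      unfolding shift[OF V(1)] I_def by (simp add: ennreal_indicator)
    also have "\<dots> = (\<integral>\<^sup>+p. ennreal (I n p) \<partial>(N \<Otimes>\<^sub>M ?S))"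
      by (subst S.nn_integral_fst[symmetric]) auto
    finally have "(\<integral>\<^sup>+x. ennreal (indicator {a..b} x * (\<integral>t. normal_density 0 (sqrt (V n)) (x - z t) \<partial>N)) \<partial>lborel) =
        (\<integral>\<^sup>+p. ennreal (I n p) \<partial>(N \<Otimes>\<^sub>M ?S))" .
    then show ?thesis
      by (subst (1 2) integral_eq_nn_integral) (auto simp: I_def intro!: Bochner_Integration.integral_nonneg)
  qed
  have "(\<lambda>n. \<integral>p. I n p \<partial>(N \<Otimes>\<^sub>M ?S)) \<longlonglongrightarrow> (\<integral>p. X p \<partial>(N \<Otimes>\<^sub>M ?S))"
  proof (rule integral_dominated_convergence[where w="\<lambda>_. 1"])
    show "AE p in N \<Otimes>\<^sub>M ?S. (\<lambda>n. I n p) \<longlonglongrightarrow> X p"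
    proof (rule AE_I2)
      fix p :: "'t \<times> real"
      let ?y = "z (fst p)" and ?\<xi> = "snd p"
      have "(\<lambda>n. ?y + sqrt (V n) * ?\<xi>) \<longlonglongrightarrow> ?y + sqrt 0 * ?\<xi>" by (intro tendsto_intros V(2))
      then have lim: "(\<lambda>n. ?y + sqrt (V n) * ?\<xi>) \<longlonglongrightarrow> ?y" by simp
      have lower: "\<forall>\<^sub>F n in sequentially. a < ?y + sqrt (V n) * ?\<xi>" if "a < ?y"
        using lim that by (rule order_tendstoD)
      have lower': "\<forall>\<^sub>F n in sequentially. ?y + sqrt (V n) * ?\<xi> < a" if "?y < a"
        using lim that by (rule order_tendstoD)
      have upper: "\<forall>\<^sub>F n in sequentially. ?y + sqrt (V n) * ?\<xi> < b" if "?y < b"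
        using lim that by (rule order_tendstoD)
      have upper': "\<forall>\<^sub>F n in sequentially. b < ?y + sqrt (V n) * ?\<xi>" if "b < ?y"
        using lim that by (rule order_tendstoD)
      have pos: "sqrt (V n) * ?\<xi> \<ge> 0 \<longleftrightarrow> ?\<xi> \<ge> 0" "sqrt (V n) * ?\<xi> \<le> 0 \<longleftrightarrow> ?\<xi> \<le> 0" for n
        using V(1)[of n] by (auto simp: zero_le_mult_iff mult_le_0_iff)
      consider "?y < a" | "b < ?y" | "a < ?y" "?y < b" | "?y = a" | "?y = b" by linarith
      then have "\<forall>\<^sub>F n in sequentially. I n p = X p"
      proof cases
        case 1
        show ?thesis using lower'[OF 1] by eventually_elim (use 1 ab in \<open>auto simp: I_def X_def\<close>)
      next
        case 2
        show ?thesis using upper'[OF 2] by eventually_elim (use 2 ab in \<open>auto simp: I_def X_def\<close>)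
      next
        case 3
        show ?thesis using lower[OF 3(1)] upper[OF 3(2)] by eventually_elim (use 3 in \<open>auto simp: I_def X_def\<close>)
      next
        case 4
        then have "?y < b" using ab by simp
        show ?thesis using upper[OF \<open>?y < b\<close>]
          by eventually_elim (use 4 ab pos in \<open>auto simp: I_def X_def split: split_indicator\<close>)
      next
        case 5
        then have "a < ?y" using ab by simp
        show ?thesis using lower[OF \<open>a < ?y\<close>]
          by eventually_elim (use 5 ab pos in \<open>auto simp: I_def X_def split: split_indicator\<close>)
      qed
      then show "(\<lambda>n. I n p) \<longlonglongrightarrow> X p" by (rule tendsto_eventually)
    qed
  qed (auto simp: I_def)
  then have conv: "(\<lambda>n. \<integral>x. indicator {a..b} x * (\<integral>t. normal_density 0 (sqrt (V n)) (x - z t) \<partial>N) \<partial>lborel) \<longlonglongrightarrow> (\<integral>p. X p \<partial>(N \<Otimes>\<^sub>M ?S))"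
    unfolding eq .
  have iX: "integrable (N \<Otimes>\<^sub>M ?S) X"
    by (intro NSf.integrable_const_bound[where B=1]) (auto simp: X_def)
  have meas: "(\<integral>p. indicat_real B (z (fst p)) \<partial>(N \<Otimes>\<^sub>M ?S)) = measure (distr N borel z) B"
    and iB: "integrable (N \<Otimes>\<^sub>M ?S) (\<lambda>p. indicat_real B (z (fst p)))"
    if [measurable]: "B \<in> sets borel" for B
  proof -
    show i: "integrable (N \<Otimes>\<^sub>M ?S) (\<lambda>p. indicat_real B (z (fst p)))"
      by (intro NSf.integrable_const_bound[where B=1]) auto
    have "(\<integral>p. indicat_real B (z (fst p)) \<partial>(N \<Otimes>\<^sub>M ?S)) = (\<integral>t. \<integral>\<xi>. indicat_real B (z t) \<partial>?S \<partial>N)"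
      using NS.integral_fst'[of "\<lambda>p. indicat_real B (z (fst p))"] i by simp
    also have "\<dots> = (\<integral>t. indicat_real B (z t) \<partial>N)" using S.prob_space by simp
    also have "\<dots> = (\<integral>y. indicat_real B y \<partial>distr N borel z)" by (subst integral_distr) auto
    also have "\<dots> = measure (distr N borel z) B" by simp
    finally show "(\<integral>p. indicat_real B (z (fst p)) \<partial>(N \<Otimes>\<^sub>M ?S)) = measure (distr N borel z) B" .
  qed
  have "measure (distr N borel z) {a<..<b} \<le> (\<integral>p. X p \<partial>(N \<Otimes>\<^sub>M ?S))"
    by (subst meas[symmetric], simp, intro integral_mono iB iX) (auto simp: X_def split: split_indicator)
  moreover have "(\<integral>p. X p \<partial>(N \<Otimes>\<^sub>M ?S)) \<le> measure (distr N borel z) {a..b}"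
    using ab by (subst meas[symmetric], simp, intro integral_mono iB iX) (auto simp: X_def split: split_indicator)
  ultimately show ?thesis using conv by blast
qed

text \<open>On bounded intervals the \<open>L\<^sup>2\<close> convergence of the smoothed densities implies the convergence of
  integrals, so that the integral of \<open>l\<close> over \<open>[a, b]\<close> lies between the measures of the open and the
  closed interval. It is at most a multiple of \<open>sqrt (b - a)\<close>, so there are no atoms, and then the two measures
  agree on intervals.\<close>

lemma occupation_density:
  fixes z :: "'t \<Rightarrow> real" and V :: "nat \<Rightarrow> real"
  assumes N: "finite_measure N" and [measurable]: "z \<in> borel_measurable N"
    and V: "\<And>n. V n > 0" "V \<longlonglongrightarrow> 0"
    and [measurable]: "l \<in> borel_measurable borel" and l0: "\<And>x. l x \<ge> 0"
    and l2: "(\<integral>\<^sup>+x. ennreal ((l x)\<^sup>2) \<partial>lborel) < \<infinity>"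
    and conv: "(\<lambda>n. \<integral>\<^sup>+x. ennreal (((\<integral>t. normal_density 0 (sqrt (V n)) (x - z t) \<partial>N) - l x)\<^sup>2) \<partial>lborel) \<longlonglongrightarrow> 0"
  shows "distr N borel z = density lborel (\<lambda>x. ennreal (l x))"
proof -
  interpret N: finite_measure N by fact
  define D where "D = distr N borel z"
  interpret D: finite_measure D unfolding D_def by (rule N.finite_measure_distr) measurable
  have setsD[simp]: "sets D = sets borel" by (simp add: D_def)
  define \<Lambda> where "\<Lambda> n x = (\<integral>t. normal_density 0 (sqrt (V n)) (x - z t) \<partial>N)" for n x
  have [measurable]: "\<Lambda> n \<in> borel_measurable borel" for n unfolding \<Lambda>_def by measurable
  define I where "I a b = (\<integral>x. indicator {a..b} x * l x \<partial>lborel)" for a b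
  define K where "K = sqrt (enn2real (\<integral>\<^sup>+x. ennreal ((l x)\<^sup>2) \<partial>lborel))"
  have il: "integrable lborel (\<lambda>x. indicator {a..b} x * l x)" if "a < b" for a b
    using that by (intro L2_indicator_pairing(1)[where m="b - a"] l2) auto
  have Ile: "I a b \<le> sqrt (b - a) * K" if "a < b" for a b
  proof -
    have "\<bar>I a b\<bar> \<le> sqrt (b - a) * K"
      unfolding I_def K_def using that by (intro L2_indicator_pairing(2) l2) auto
    then show ?thesis by linarith
  qed
  have bounds: "measure D {a<..<b} \<le> I a b \<and> I a b \<le> measure D {a..b}" if ab: "a < b" for a b
  proof -
    obtain J where J: "(\<lambda>n. \<integral>x. indicator {a..b} x * \<Lambda> n x \<partial>lborel) \<longlonglongrightarrow> J"
      "measure D {a<..<b} \<le> J" "J \<le> measure D {a..b}"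
      using smoothing_limit[OF N assms(2) V ab] unfolding \<Lambda>_def D_def by blast
    have "(\<lambda>n. \<integral>x. indicator {a..b} x * \<Lambda> n x \<partial>lborel) \<longlonglongrightarrow> I a b"
    proof (rule LIM_zero_cancel, rule tendsto_rabs_zero_cancel, rule tendsto_sandwich[OF _ _ tendsto_const])
      have fin: "\<forall>\<^sub>F n in sequentially. (\<integral>\<^sup>+x. ennreal ((\<Lambda> n x - l x)\<^sup>2) \<partial>lborel) < \<infinity>"
        using conv unfolding \<Lambda>_def by (rule order_tendstoD) auto
      then show "\<forall>\<^sub>F n in sequentially. \<bar>(\<integral>x. indicator {a..b} x * \<Lambda> n x \<partial>lborel) - I a b\<bar> \<le>
          sqrt (b - a) * sqrt (enn2real (\<integral>\<^sup>+x. ennreal ((\<Lambda> n x - l x)\<^sup>2) \<partial>lborel))"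
      proof eventually_elim
        case (elim n)
        have i: "integrable lborel (\<lambda>x. indicator {a..b} x * (\<Lambda> n x - l x))"
          using ab by (intro L2_indicator_pairing(1)[where m="b - a"] elim) auto
        have "(\<lambda>x. indicator {a..b} x * \<Lambda> n x) = (\<lambda>x. indicator {a..b} x * (\<Lambda> n x - l x) + indicator {a..b} x * l x)"
          by (simp add: algebra_simps)
        then have "(\<integral>x. indicator {a..b} x * \<Lambda> n x \<partial>lborel) = (\<integral>x. indicator {a..b} x * (\<Lambda> n x - l x) \<partial>lborel) + I a b"
          using i il[OF ab] unfolding I_def by (simp only: Bochner_Integration.integral_add)
        then show ?case using ab L2_indicator_pairing(2)[OF _ _ elim, of "{a..b}" "b - a"] by simp
      qed
      have "(\<lambda>n. sqrt (b - a) * sqrt (enn2real (\<integral>\<^sup>+x. ennreal ((\<Lambda> n x - l x)\<^sup>2) \<partial>lborel))) \<longlonglongrightarrow> sqrt (b - a) * sqrt (enn2real 0)"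
        using conv unfolding \<Lambda>_def by (intro tendsto_mult tendsto_const tendsto_real_sqrt tendsto_enn2real) auto
      then show "(\<lambda>n. sqrt (b - a) * sqrt (enn2real (\<integral>\<^sup>+x. ennreal ((\<Lambda> n x - l x)\<^sup>2) \<partial>lborel))) \<longlonglongrightarrow> 0" by simp
    qed simp
    then have "J = I a b" using J(1) by (rule LIMSEQ_unique[rotated])
    then show ?thesis using J by simp
  qed
  have atom: "measure D {a} = 0" for a
  proof -
    have "measure D {a} \<le> sqrt (2 / real (Suc n)) * K" for n
    proof -
      have h: "a - 1 / real (Suc n) < a + 1 / real (Suc n)" by simp
      have "measure D {a} \<le> measure D {a - 1 / real (Suc n)<..<a + 1 / real (Suc n)}"
        by (intro D.finite_measure_mono) auto
      also have "\<dots> \<le> sqrt (a + 1 / real (Suc n) - (a - 1 / real (Suc n))) * K"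
        using bounds[OF h] Ile[OF h] by linarith
      also have "a + 1 / real (Suc n) - (a - 1 / real (Suc n)) = 2 / real (Suc n)" by simp
      finally show ?thesis .
    qed
    moreover have "(\<lambda>n. sqrt (2 / real (Suc n)) * K) \<longlonglongrightarrow> sqrt 0 * K"
      by (intro tendsto_intros LIMSEQ_Suc[OF lim_const_over_n])
    ultimately have "measure D {a} \<le> sqrt 0 * K" by (intro LIMSEQ_le_const) auto
    then show ?thesis by (simp add: measure_le_0_iff)
  qed
  have Ioc: "emeasure D {a<..b} = emeasure (density lborel (\<lambda>x. ennreal (l x))) {a<..b}" if ab: "a < b" for a b
  proof -
    have "measure D {a<..b} = measure D {a<..<b} + measure D {b}"
      using ab by (subst D.finite_measure_Union[symmetric]) (auto intro!: arg_cong[where f="measure D"])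
    moreover have "measure D {a..b} = measure D {a<..b} + measure D {a}"
      using ab by (subst D.finite_measure_Union[symmetric]) (auto intro!: arg_cong[where f="measure D"])
    ultimately have "measure D {a<..b} = I a b" using bounds[OF ab] atom by simp
    then have "emeasure D {a<..b} = ennreal (I a b)" by (simp add: D.emeasure_eq_measure)
    also have "\<dots> = (\<integral>\<^sup>+x. ennreal (indicator {a..b} x * l x) \<partial>lborel)"
      unfolding I_def by (intro nn_integral_eq_integral[symmetric] il ab) (auto simp: l0)
    also have "\<dots> = (\<integral>\<^sup>+x. ennreal (l x) * indicator {a<..b} x \<partial>lborel)"
      using AE_lborel_singleton[of a]
      by (intro nn_integral_cong_AE) (auto elim!: eventually_mono split: split_indicator)
    also have "\<dots> = emeasure (density lborel (\<lambda>x. ennreal (l x))) {a<..b}"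
      by (subst emeasure_density) auto
    finally show ?thesis .
  qed
  have "D = density lborel (\<lambda>x. ennreal (l x))"
  proof (rule measure_eqI_lessThan)
    fix a :: real
    have U: "(\<Union>n. {a<..a + real (Suc n)}) = {a<..}"
    proof (intro equalityI subsetI)
      fix x assume "x \<in> {a<..}"
      moreover obtain n where "x - a \<le> real n" using real_arch_simple by blast
      ultimately have "x \<in> {a<..a + real (Suc n)}" by auto
      then show "x \<in> (\<Union>n. {a<..a + real (Suc n)})" by blast
    qed auto
    have inc: "incseq (\<lambda>n. {a<..a + real (Suc n)})" by (auto simp: incseq_def)
    have "emeasure D {a<..} = (SUP n. emeasure D {a<..a + real (Suc n)})"
      using inc unfolding U[symmetric] by (intro SUP_emeasure_incseq[symmetric]) auto
    also have "\<dots> = (SUP n. emeasure (density lborel (\<lambda>x. ennreal (l x))) {a<..a + real (Suc n)})"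
      by (simp add: Ioc)
    also have "\<dots> = emeasure (density lborel (\<lambda>x. ennreal (l x))) {a<..}"
      using inc unfolding U[symmetric] by (intro SUP_emeasure_incseq) auto
    finally show "emeasure D {a<..} = emeasure (density lborel (\<lambda>x. ennreal (l x))) {a<..}" .
    show "emeasure D {a<..} < \<infinity>" by (simp add: D.emeasure_eq_measure)
  qed auto
  then show ?thesis by (simp add: D_def)
qed

section \<open>A criterion for square integrable local times\<close>

lemma normal_density_convolution:
  assumes "\<epsilon> > 0" "\<epsilon>' > 0"
  shows "(\<integral>\<^sup>+x. ennreal (normal_density 0 (sqrt \<epsilon>) (x - u) * normal_density 0 (sqrt \<epsilon>') (x - w)) \<partial>lborel)
    = ennreal (normal_density 0 (sqrt (\<epsilon> + \<epsilon>')) (u - w))"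
proof -
  have sym: "normal_density 0 s (- r) = normal_density 0 s r" for s r :: real by (simp add: normal_density_def)
  have "(\<integral>\<^sup>+x. ennreal (normal_density 0 (sqrt \<epsilon>) (x - u) * normal_density 0 (sqrt \<epsilon>') (x - w)) \<partial>lborel)
      = (\<integral>\<^sup>+y. ennreal (normal_density 0 (sqrt \<epsilon>) (w + y - u) * normal_density 0 (sqrt \<epsilon>') y) \<partial>lborel)"
    by (subst nn_integral_real_affine[where c=1 and t=w]) auto
  also have "\<dots> = (\<integral>\<^sup>+y. ennreal (normal_density 0 (sqrt \<epsilon>) ((u - w) - y) * normal_density 0 (sqrt \<epsilon>') y) \<partial>lborel)"
  proof (intro nn_integral_cong)
    fix y
    have "normal_density 0 (sqrt \<epsilon>) (w + y - u) = normal_density 0 (sqrt \<epsilon>) ((u - w) - y)"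
      using sym[of "sqrt \<epsilon>" "w + y - u"] by (simp add: algebra_simps)
    then show "ennreal (normal_density 0 (sqrt \<epsilon>) (w + y - u) * normal_density 0 (sqrt \<epsilon>') y) =
      ennreal (normal_density 0 (sqrt \<epsilon>) ((u - w) - y) * normal_density 0 (sqrt \<epsilon>') y)" by simp
  qed
  also have "\<dots> = ennreal (normal_density 0 (sqrt ((sqrt \<epsilon>)\<^sup>2 + (sqrt \<epsilon>')\<^sup>2)) (u - w))"
    using conv_normal_density_zero_mean[of "sqrt \<epsilon>" "sqrt \<epsilon>'"] assms by (auto dest: fun_cong)
  finally show ?thesis using assms by simp
qed

text \<open>Needed for sums \<open>e + d\<close> of two small parameters, which do not form a sequence.\<close>

lemma tendsto_0_from_right_dist:
  fixes \<Phi> :: "real \<Rightarrow> real"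
  assumes "\<And>V. (\<And>n. V n > 0) \<Longrightarrow> V \<longlonglongrightarrow> 0 \<Longrightarrow> (\<lambda>n. \<Phi> (V n)) \<longlonglongrightarrow> c" and "e > 0"
  obtains d where "d > 0" "\<And>v. 0 < v \<Longrightarrow> v < d \<Longrightarrow> \<bar>\<Phi> v - c\<bar> < e"
proof -
  have "(\<Phi> \<longlongrightarrow> c) (at 0 within {0<..})"
    unfolding tendsto_at_iff_sequentially using assms(1) by (auto simp: comp_def)
  then have "\<forall>\<^sub>F v in at 0 within {0<..}. dist (\<Phi> v) c < e" using assms(2) by (rule tendstoD)
  then obtain d where "d > 0" "\<And>v. v \<in> {0<..} \<Longrightarrow> v \<noteq> 0 \<Longrightarrow> dist v 0 < d \<Longrightarrow> dist (\<Phi> v) c < e"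
    by (auto simp: eventually_at)
  then show ?thesis using that[of d] by (auto simp: dist_real_def)
qed

lemma nn_integral_interval_powr:
  assumes "c > -1" "T \<ge> 0"
  shows "(\<integral>\<^sup>+p. ennreal (\<bar>fst p - snd p\<bar> powr c) \<partial>(restrict_space lborel {0..T} \<Otimes>\<^sub>M restrict_space lborel {0..T})) < \<infinity>"
proof -
  let ?N = "restrict_space lborel {0..T} :: real measure"
  interpret N: sigma_finite_measure ?N
    by (intro sigma_finite_measure_restrict_space lborel.sigma_finite_measure_axioms) auto
  have [measurable]: "(\<lambda>x. x) \<in> borel_measurable ?N" by (intro measurable_restrict_space1) simp
  have [measurable]: "(\<lambda>p. \<bar>fst p - snd p\<bar>) \<in> borel_measurable (?N \<Otimes>\<^sub>M ?N)"
    by measurable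
  have "(\<integral>\<^sup>+p. ennreal (\<bar>fst p - snd p\<bar> powr c) \<partial>(?N \<Otimes>\<^sub>M ?N)) = (\<integral>\<^sup>+s. \<integral>\<^sup>+t. ennreal (\<bar>s - t\<bar> powr c) \<partial>?N \<partial>?N)"
    by (subst N.nn_integral_fst[symmetric]) auto
  also have "\<dots> = (\<integral>\<^sup>+s. (\<integral>\<^sup>+t. ennreal (\<bar>s - t\<bar> powr c) * indicator {0..T} t \<partial>lborel) * indicator {0..T} s \<partial>lborel)"
    by (simp add: nn_integral_restrict_space)
  also have "\<dots> \<le> (\<integral>\<^sup>+s. ennreal (2 * (T powr (c + 1) / (c + 1))) * indicator {0..T} s \<partial>lborel)"
    using nn_integral_abs_powr[OF assms(1), of _ T]
    by (intro nn_integral_mono) (auto split: split_indicator)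
  also have "\<dots> < \<infinity>" using assms(2) by (simp add: nn_integral_cmult_indicator ennreal_mult_less_top)
  finally show ?thesis .
qed

text \<open>Here \<open>g v (s, t)\<close> is the expectation of \<open>p\<^sub>v(X\<^sub>s - X\<^sub>t)\<close>, dominated by the integrable function \<open>w\<close>, and
  \<open>\<Lambda> n\<close> is the occupation measure smoothed with variance \<open>\<epsilon> n\<close>. The fact \<open>prod\<close> is the identity for inner
  products that makes \<open>\<Lambda>\<close> a Cauchy sequence.\<close>

lemma (in prob_space) local_time_of_char_decay:
  assumes T: "T > 0" and X: "jointly_measurable_on M {0..T} X"
    and \<kappa>: "\<kappa> > 0" and h: "h < 1"
    and decay: "\<And>s t z. 0 \<le> s \<Longrightarrow> s < t \<Longrightarrow> t \<le> T \<Longrightarrow>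
      (cmod (\<integral>\<omega>. iexp (z * (X t \<omega> - X s \<omega>)) \<partial>M))\<^sup>2 \<le> (1 + (z * (\<kappa> * (t - s) powr h))\<^sup>2) powr (- (3 / 2))"
  shows "has_square_integrable_local_time M {0..T} X"
proof -
  define N where "N = (restrict_space lborel {0..T} :: real measure)"
  have spN: "space N = {0..T}" by (simp add: N_def space_restrict_space)
  have idN[measurable]: "(\<lambda>x. x) \<in> borel_measurable N" unfolding N_def by (intro measurable_restrict_space1) simp
  interpret N: finite_measure N
  proof
    have "emeasure N (space N) = emeasure lborel {0..T}"
      unfolding spN unfolding N_def by (intro emeasure_restrict_space) auto
    then show "emeasure N (space N) \<noteq> \<infinity>" using T by simp
  qed
  define p where "p v = normal_density 0 (sqrt v)" for v
  have [measurable]: "p v \<in> borel_measurable borel" for v unfolding p_def by measurable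
  have p0: "p v y \<ge> 0" for v y by (simp add: p_def)
  have p_le: "v > 0 \<Longrightarrow> p v y \<le> 1 / sqrt (2 * pi * v)" for v y unfolding p_def by (rule normal_density_le)
  have "(\<lambda>q. X (fst q) (snd q)) \<in> borel_measurable (restrict_space borel {0..T} \<Otimes>\<^sub>M M)"
    using X unfolding jointly_measurable_on_def by (simp add: case_prod_beta')
  also have "sets (restrict_space borel {0..T} \<Otimes>\<^sub>M M) = sets (N \<Otimes>\<^sub>M M)"
    unfolding N_def by (intro sets_pair_measure_cong sets_restrict_space_cong) auto
  then have "borel_measurable (restrict_space borel {0..T} \<Otimes>\<^sub>M M) = (borel_measurable (N \<Otimes>\<^sub>M M) :: (real \<times> 'a \<Rightarrow> real) set)"
    by (intro measurable_cong_sets) auto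
  finally have XM[measurable]: "(\<lambda>q. X (fst q) (snd q)) \<in> borel_measurable (N \<Otimes>\<^sub>M M)" .
  have X1: "(\<lambda>\<omega>. X t \<omega>) \<in> borel_measurable M" if "t \<in> {0..T}" for t
    using measurable_Pair2[OF XM, of t] that by (simp add: spN)
  have X2: "(\<lambda>t. X t \<omega>) \<in> borel_measurable N" if "\<omega> \<in> space M" for \<omega>
    using measurable_Pair1[OF XM that] by simp
  interpret NN: pair_sigma_finite N N ..
  interpret NM: pair_sigma_finite N M ..
  interpret LM: pair_sigma_finite lborel M ..
  have XX[measurable]: "(\<lambda>q. X (fst (fst q)) (snd q)) \<in> borel_measurable ((N \<Otimes>\<^sub>M N) \<Otimes>\<^sub>M M)"
    "(\<lambda>q. X (snd (fst q)) (snd q)) \<in> borel_measurable ((N \<Otimes>\<^sub>M N) \<Otimes>\<^sub>M M)"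
  proof -
    have "(\<lambda>q. (fst (fst q), snd q)) \<in> (N \<Otimes>\<^sub>M N) \<Otimes>\<^sub>M M \<rightarrow>\<^sub>M N \<Otimes>\<^sub>M M"
      "(\<lambda>q. (snd (fst q), snd q)) \<in> (N \<Otimes>\<^sub>M N) \<Otimes>\<^sub>M M \<rightarrow>\<^sub>M N \<Otimes>\<^sub>M M" by measurable
    from measurable_compose[OF this(1) XM] measurable_compose[OF this(2) XM]
    show "(\<lambda>q. X (fst (fst q)) (snd q)) \<in> borel_measurable ((N \<Otimes>\<^sub>M N) \<Otimes>\<^sub>M M)"
      "(\<lambda>q. X (snd (fst q)) (snd q)) \<in> borel_measurable ((N \<Otimes>\<^sub>M N) \<Otimes>\<^sub>M M)" by simp_all
  qed
  define g where "g v r = (\<integral>\<omega>. p v (X (fst r) \<omega> - X (snd r) \<omega>) \<partial>M)" for v r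
  have [measurable]: "g v \<in> borel_measurable (N \<Otimes>\<^sub>M N)" for v unfolding g_def by measurable
  have g0: "g v r \<ge> 0" for v r unfolding g_def by (intro Bochner_Integration.integral_nonneg p0)
  have p_sym: "p v (- y) = p v y" for v y by (simp add: p_def normal_density_def)
  have g_bd: "v > 0 \<Longrightarrow> g v (s, t) \<le> 1 / \<kappa> * \<bar>s - t\<bar> powr (- h)"
    and g_lim: "\<exists>l. \<forall>V. (\<forall>n. V n > 0) \<longrightarrow> V \<longlonglongrightarrow> 0 \<longrightarrow> (\<lambda>n. g (V n) (s, t)) \<longlonglongrightarrow> l"
    if st: "s \<in> {0..T}" "t \<in> {0..T}" "s \<noteq> t" for s t v
  proof -
    define lo where "lo = min s t"
    define hi where "hi = max s t"
    have lh: "0 \<le> lo" "lo < hi" "hi \<le> T" using st by (auto simp: lo_def hi_def)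
    have ab: "\<bar>s - t\<bar> = hi - lo" by (auto simp: lo_def hi_def)
    have gs: "g v (s, t) = (\<integral>\<omega>. normal_density 0 (sqrt v) (X hi \<omega> - X lo \<omega>) \<partial>M)" for v
    proof (cases "s < t")
      case True
      have "p v (X s \<omega> - X t \<omega>) = p v (X t \<omega> - X s \<omega>)" for \<omega>
        using p_sym[of v "X t \<omega> - X s \<omega>"] by simp
      then show ?thesis using True by (simp add: g_def lo_def hi_def p_def)
    next
      case False
      then show ?thesis by (simp add: g_def lo_def hi_def p_def)
    qed
    have Y: "(\<lambda>\<omega>. X hi \<omega> - X lo \<omega>) \<in> borel_measurable M"
      using X1[of hi] X1[of lo] lh by (intro borel_measurable_diff) auto
    have a: "\<kappa> * (hi - lo) powr h > 0" using \<kappa> lh by simp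
    note c = char_decay_consequences[OF Y a decay[OF lh]]
    have "1 / (\<kappa> * (hi - lo) powr h) = 1 / \<kappa> * \<bar>s - t\<bar> powr (- h)"
      by (simp add: ab powr_minus divide_inverse)
    then show "v > 0 \<Longrightarrow> g v (s, t) \<le> 1 / \<kappa> * \<bar>s - t\<bar> powr (- h)"
      using c(1)[of v] by (simp only: gs)
    show "\<exists>l. \<forall>V. (\<forall>n. V n > 0) \<longrightarrow> V \<longlonglongrightarrow> 0 \<longrightarrow> (\<lambda>n. g (V n) (s, t)) \<longlonglongrightarrow> l"
      using c(2) by (simp only: gs)
  qed
  have off: "AE r in N \<Otimes>\<^sub>M N. fst r \<noteq> snd r"
  proof (rule NN.AE_pair_measure)
    have "fst \<in> borel_measurable (N \<Otimes>\<^sub>M N)" "snd \<in> borel_measurable (N \<Otimes>\<^sub>M N)"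
      using measurable_compose[OF measurable_fst idN] measurable_compose[OF measurable_snd idN] by auto
    then show "{r \<in> space (N \<Otimes>\<^sub>M N). fst r \<noteq> snd r} \<in> sets (N \<Otimes>\<^sub>M N)"
      by (rule borel_measurable_neq)
    have "AE t in N. s \<noteq> t" for s
      unfolding N_def using AE_lborel_singleton[of s] by (subst AE_restrict_space_iff) (auto elim!: eventually_mono)
    then show "AE s in N. AE t in N. fst (s, t) \<noteq> snd (s, t)" by simp
  qed
  define w where "w r = 1 / \<kappa> * \<bar>fst r - snd r\<bar> powr (- h)" for r :: "real \<times> real"
  have [measurable]: "(\<lambda>r. \<bar>fst r - snd r\<bar>) \<in> borel_measurable (N \<Otimes>\<^sub>M N)" by measurable
  have [measurable]: "w \<in> borel_measurable (N \<Otimes>\<^sub>M N)" unfolding w_def by measurable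
  have wi: "integrable (N \<Otimes>\<^sub>M N) w"
  proof -
    have "(\<integral>\<^sup>+r. ennreal (\<bar>fst r - snd r\<bar> powr (- h)) \<partial>(N \<Otimes>\<^sub>M N)) < \<infinity>"
      unfolding N_def using h T by (intro nn_integral_interval_powr) auto
    then have "integrable (N \<Otimes>\<^sub>M N) (\<lambda>r. \<bar>fst r - snd r\<bar> powr (- h))" by (intro integrableI_nonneg) auto
    then show ?thesis unfolding w_def by (intro integrable_mult_right)
  qed
  have gw: "AE r in N \<Otimes>\<^sub>M N. norm (g v r) \<le> w r" if "v > 0" for v
    using off AE_space
  proof eventually_elim
    case (elim r)
    then show ?case using g_bd[of "fst r" "snd r" v] that g0[of v r]
      by (auto simp: w_def space_pair_measure spN)
  qed
  have gi: "integrable (N \<Otimes>\<^sub>M N) (g v)" if "v > 0" for v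
    by (rule Bochner_Integration.integrable_bound[OF wi])
      (use gw[OF that] in \<open>auto elim!: eventually_mono\<close>)
  define \<Phi> where "\<Phi> v = (\<integral>r. g v r \<partial>(N \<Otimes>\<^sub>M N))" for v
  define G where "G r = lim (\<lambda>n. g (1 / real (Suc n)) r)" for r
  have [measurable]: "G \<in> borel_measurable (N \<Otimes>\<^sub>M N)" unfolding G_def by measurable
  have inv: "(\<lambda>n. 1 / real (Suc n)) \<longlonglongrightarrow> 0" by (rule LIMSEQ_Suc[OF lim_const_over_n])
  have \<Phi>_lim: "(\<lambda>n. \<Phi> (V n)) \<longlonglongrightarrow> (\<integral>r. G r \<partial>(N \<Otimes>\<^sub>M N))" if V: "\<And>n. V n > 0" "V \<longlonglongrightarrow> 0" for V
    unfolding \<Phi>_def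
  proof (rule integral_dominated_convergence[OF _ _ wi])
    show "AE r in N \<Otimes>\<^sub>M N. (\<lambda>n. g (V n) r) \<longlonglongrightarrow> G r"
      using off AE_space
    proof eventually_elim
      case (elim r)
      have "\<exists>l. \<forall>V. (\<forall>n. V n > 0) \<longrightarrow> V \<longlonglongrightarrow> 0 \<longrightarrow> (\<lambda>n. g (V n) r) \<longlonglongrightarrow> l"
        using g_lim[of "fst r" "snd r"] elim by (auto simp: space_pair_measure spN)
      then obtain l where l: "\<And>V. (\<forall>n. V n > 0) \<Longrightarrow> V \<longlonglongrightarrow> 0 \<Longrightarrow> (\<lambda>n. g (V n) r) \<longlonglongrightarrow> l"
        by blast
      have "(\<lambda>n. g (1 / real (Suc n)) r) \<longlonglongrightarrow> l" by (rule l[OF _ inv]) simp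
      then have "G r = l" unfolding G_def by (rule limI)
      then show ?case using l[of V] V by simp
    qed
  qed (use gw V in auto)
  define \<epsilon> where "\<epsilon> n = 1 / real (Suc n)" for n
  have \<epsilon>: "\<epsilon> n > 0" "\<epsilon> \<longlonglongrightarrow> 0" for n using inv by (auto simp: \<epsilon>_def[abs_def])
  define \<Lambda> where "\<Lambda> n q = (\<integral>t. p (\<epsilon> n) (fst q - X t (snd q)) \<partial>N)" for n q
  have XQ[measurable]: "(\<lambda>r. X (snd r) (snd (fst r))) \<in> borel_measurable ((lborel \<Otimes>\<^sub>M M) \<Otimes>\<^sub>M N)"
  proof -
    have "(\<lambda>r. (snd r, snd (fst r))) \<in> (lborel \<Otimes>\<^sub>M M) \<Otimes>\<^sub>M N \<rightarrow>\<^sub>M N \<Otimes>\<^sub>M M" by measurable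
    from measurable_compose[OF this XM] show ?thesis by simp
  qed
  have [measurable]: "\<Lambda> n \<in> borel_measurable (lborel \<Otimes>\<^sub>M M)" for n unfolding \<Lambda>_def by measurable
  have \<Lambda>0: "\<Lambda> n q \<ge> 0" for n q unfolding \<Lambda>_def by (intro Bochner_Integration.integral_nonneg p0)
  have prod: "(\<integral>\<^sup>+q. ennreal (\<Lambda> m q * \<Lambda> n q) \<partial>(lborel \<Otimes>\<^sub>M M)) = ennreal (\<Phi> (\<epsilon> m + \<epsilon> n))" for m n
  proof -
    have nnL: "ennreal (\<Lambda> n (x, \<omega>)) = (\<integral>\<^sup>+t. ennreal (p (\<epsilon> n) (x - X t \<omega>)) \<partial>N)" if "\<omega> \<in> space M" for n x \<omega>
    proof -
      have [measurable]: "(\<lambda>t. X t \<omega>) \<in> borel_measurable N" by (rule X2[OF that])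
      have "integrable N (\<lambda>t. p (\<epsilon> n) (x - X t \<omega>))"
        using p_le[OF \<epsilon>(1)[of n]] p0
        by (intro N.integrable_const_bound[where B="1 / sqrt (2 * pi * \<epsilon> n)"]) auto
      then show ?thesis unfolding \<Lambda>_def fst_conv snd_conv by (intro nn_integral_eq_integral[symmetric]) (auto simp: p0)
    qed
    have "(\<integral>\<^sup>+q. ennreal (\<Lambda> m q * \<Lambda> n q) \<partial>(lborel \<Otimes>\<^sub>M M)) = (\<integral>\<^sup>+\<omega>. \<integral>\<^sup>+x. ennreal (\<Lambda> m (x, \<omega>) * \<Lambda> n (x, \<omega>)) \<partial>lborel \<partial>M)"
      by (subst LM.nn_integral_snd[symmetric]) auto
    also have "\<dots> = (\<integral>\<^sup>+\<omega>. \<integral>\<^sup>+r. ennreal (p (\<epsilon> m + \<epsilon> n) (X (fst r) \<omega> - X (snd r) \<omega>)) \<partial>(N \<Otimes>\<^sub>M N) \<partial>M)"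
    proof (intro nn_integral_cong)
      fix \<omega> assume \<omega>: "\<omega> \<in> space M"
      have [measurable]: "(\<lambda>t. X t \<omega>) \<in> borel_measurable N" by (rule X2[OF \<omega>])
      have [measurable]: "(\<lambda>r. X (fst r) \<omega>) \<in> borel_measurable (N \<Otimes>\<^sub>M N)" "(\<lambda>r. X (snd r) \<omega>) \<in> borel_measurable (N \<Otimes>\<^sub>M N)"
        using measurable_compose[OF measurable_fst X2[OF \<omega>]] measurable_compose[OF measurable_snd X2[OF \<omega>]] by auto
      interpret LNN: pair_sigma_finite lborel "N \<Otimes>\<^sub>M N"
        by (intro pair_sigma_finite.intro lborel.sigma_finite_measure_axioms sigma_finite_pair_measure N.sigma_finite_measure_axioms)
      have "(\<integral>\<^sup>+x. ennreal (\<Lambda> m (x, \<omega>) * \<Lambda> n (x, \<omega>)) \<partial>lborel) =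
         (\<integral>\<^sup>+x. \<integral>\<^sup>+r. ennreal (p (\<epsilon> m) (x - X (fst r) \<omega>) * p (\<epsilon> n) (x - X (snd r) \<omega>)) \<partial>(N \<Otimes>\<^sub>M N) \<partial>lborel)"
      proof (intro nn_integral_cong)
        fix x
        have "(\<integral>\<^sup>+r. ennreal (p (\<epsilon> m) (x - X (fst r) \<omega>) * p (\<epsilon> n) (x - X (snd r) \<omega>)) \<partial>(N \<Otimes>\<^sub>M N)) =
           (\<integral>\<^sup>+s. \<integral>\<^sup>+t. ennreal (p (\<epsilon> m) (x - X s \<omega>)) * ennreal (p (\<epsilon> n) (x - X t \<omega>)) \<partial>N \<partial>N)"
          by (subst N.nn_integral_fst[symmetric]) (auto simp: ennreal_mult p0)
        also have "\<dots> = ennreal (\<Lambda> m (x, \<omega>)) * ennreal (\<Lambda> n (x, \<omega>))"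
          unfolding nnL[OF \<omega>] by (simp add: nn_integral_cmult nn_integral_multc)
        finally show "ennreal (\<Lambda> m (x, \<omega>) * \<Lambda> n (x, \<omega>)) = (\<integral>\<^sup>+r. ennreal (p (\<epsilon> m) (x - X (fst r) \<omega>) * p (\<epsilon> n) (x - X (snd r) \<omega>)) \<partial>(N \<Otimes>\<^sub>M N))"
          by (simp add: ennreal_mult \<Lambda>0)
      qed
      also have "\<dots> = (\<integral>\<^sup>+r. \<integral>\<^sup>+x. ennreal (p (\<epsilon> m) (x - X (fst r) \<omega>) * p (\<epsilon> n) (x - X (snd r) \<omega>)) \<partial>lborel \<partial>(N \<Otimes>\<^sub>M N))"
        by (intro LNN.Fubini'[symmetric]) measurable
      also have "\<dots> = (\<integral>\<^sup>+r. ennreal (p (\<epsilon> m + \<epsilon> n) (X (fst r) \<omega> - X (snd r) \<omega>)) \<partial>(N \<Otimes>\<^sub>M N))"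
        unfolding p_def using \<epsilon>(1) by (simp add: normal_density_convolution)
      finally show "(\<integral>\<^sup>+x. ennreal (\<Lambda> m (x, \<omega>) * \<Lambda> n (x, \<omega>)) \<partial>lborel) =
        (\<integral>\<^sup>+r. ennreal (p (\<epsilon> m + \<epsilon> n) (X (fst r) \<omega> - X (snd r) \<omega>)) \<partial>(N \<Otimes>\<^sub>M N))" .
    qed
    also have "\<dots> = (\<integral>\<^sup>+r. \<integral>\<^sup>+\<omega>. ennreal (p (\<epsilon> m + \<epsilon> n) (X (fst r) \<omega> - X (snd r) \<omega>)) \<partial>M \<partial>(N \<Otimes>\<^sub>M N))"
    proof -
      interpret NNM: pair_sigma_finite "N \<Otimes>\<^sub>M N" M
        by (intro pair_sigma_finite.intro sigma_finite_measure_axioms sigma_finite_pair_measure N.sigma_finite_measure_axioms)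
      show ?thesis by (intro NNM.Fubini') measurable
    qed
    also have "\<dots> = (\<integral>\<^sup>+r. ennreal (g (\<epsilon> m + \<epsilon> n) r) \<partial>(N \<Otimes>\<^sub>M N))"
    proof (intro nn_integral_cong)
      fix r assume r: "r \<in> space (N \<Otimes>\<^sub>M N)"
      have [measurable]: "(\<lambda>\<omega>. X (fst r) \<omega>) \<in> borel_measurable M" "(\<lambda>\<omega>. X (snd r) \<omega>) \<in> borel_measurable M"
        using r by (auto intro!: X1 simp: space_pair_measure spN)
      have v: "\<epsilon> m + \<epsilon> n > 0" by (intro add_pos_pos \<epsilon>(1))
      have "integrable M (\<lambda>\<omega>. p (\<epsilon> m + \<epsilon> n) (X (fst r) \<omega> - X (snd r) \<omega>))"
        using p_le[OF v] p0
        by (intro integrable_const_bound[where B="1 / sqrt (2 * pi * (\<epsilon> m + \<epsilon> n))"]) auto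
      then show "(\<integral>\<^sup>+\<omega>. ennreal (p (\<epsilon> m + \<epsilon> n) (X (fst r) \<omega> - X (snd r) \<omega>)) \<partial>M) = ennreal (g (\<epsilon> m + \<epsilon> n) r)"
        unfolding g_def by (intro nn_integral_eq_integral) (auto simp: p0)
    qed
    also have "\<dots> = ennreal (\<Phi> (\<epsilon> m + \<epsilon> n))"
      unfolding \<Phi>_def using \<epsilon>(1) by (intro nn_integral_eq_integral gi) (auto simp: g0 add_pos_pos)
    finally show ?thesis .
  qed
  have \<Phi>0: "\<Phi> v \<ge> 0" for v unfolding \<Phi>_def by (intro Bochner_Integration.integral_nonneg g0)
  have prodi: "has_bochner_integral (lborel \<Otimes>\<^sub>M M) (\<lambda>q. \<Lambda> m q * \<Lambda> n q) (\<Phi> (\<epsilon> m + \<epsilon> n))" for m n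
    by (rule has_bochner_integral_nn_integral) (auto simp: prod \<Lambda>0 \<Phi>0)
  have diff: "(\<integral>\<^sup>+q. ennreal ((\<Lambda> m q - \<Lambda> n q)\<^sup>2) \<partial>(lborel \<Otimes>\<^sub>M M)) =
      ennreal (\<Phi> (\<epsilon> m + \<epsilon> m) + \<Phi> (\<epsilon> n + \<epsilon> n) - 2 * \<Phi> (\<epsilon> m + \<epsilon> n))" for m n
  proof -
    have "has_bochner_integral (lborel \<Otimes>\<^sub>M M) (\<lambda>q. \<Lambda> m q * \<Lambda> m q + \<Lambda> n q * \<Lambda> n q - 2 * (\<Lambda> m q * \<Lambda> n q))
      (\<Phi> (\<epsilon> m + \<epsilon> m) + \<Phi> (\<epsilon> n + \<epsilon> n) - 2 * \<Phi> (\<epsilon> m + \<epsilon> n))"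
      by (intro has_bochner_integral_diff has_bochner_integral_add has_bochner_integral_mult_right prodi)
    also have "(\<lambda>q. \<Lambda> m q * \<Lambda> m q + \<Lambda> n q * \<Lambda> n q - 2 * (\<Lambda> m q * \<Lambda> n q)) = (\<lambda>q. (\<Lambda> m q - \<Lambda> n q)\<^sup>2)"
      by (simp add: power2_eq_square algebra_simps)
    finally show ?thesis
      by (subst nn_integral_eq_integral) (auto simp: has_bochner_integral_iff)
  qed
  obtain L where [measurable]: "L \<in> borel_measurable (lborel \<Otimes>\<^sub>M M)"
    and L: "(\<lambda>n. \<integral>\<^sup>+q. ennreal ((\<Lambda> n q - L q)\<^sup>2) \<partial>(lborel \<Otimes>\<^sub>M M)) \<longlonglongrightarrow> 0"
  proof (rule L2_complete[of \<Lambda> "lborel \<Otimes>\<^sub>M M"])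
    fix e :: real assume e: "e > 0"
    obtain d where d: "d > 0" "\<And>v. 0 < v \<Longrightarrow> v < d \<Longrightarrow> \<bar>\<Phi> v - (\<integral>r. G r \<partial>(N \<Otimes>\<^sub>M N))\<bar> < e / 4"
      using e by (auto intro: tendsto_0_from_right_dist[OF \<Phi>_lim, where e="e / 4"])
    have "\<forall>\<^sub>F n in sequentially. \<epsilon> n < d / 2" using d(1) by (intro order_tendstoD[OF \<epsilon>(2)]) simp
    then obtain n0 where n0: "\<And>n. n \<ge> n0 \<Longrightarrow> \<epsilon> n < d / 2" unfolding eventually_sequentially by auto
    have "(\<integral>\<^sup>+q. ennreal ((\<Lambda> m q - \<Lambda> n q)\<^sup>2) \<partial>(lborel \<Otimes>\<^sub>M M)) \<le> ennreal e" if "m \<ge> n0" "n \<ge> n0" for m n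
      unfolding diff
    proof (rule ennreal_leI)
      have s: "\<bar>\<Phi> (\<epsilon> i + \<epsilon> j) - (\<integral>r. G r \<partial>(N \<Otimes>\<^sub>M N))\<bar> < e / 4" if "i \<ge> n0" "j \<ge> n0" for i j
        using n0[OF that(1)] n0[OF that(2)] \<epsilon>(1)[of i] \<epsilon>(1)[of j] by (intro d(2)) linarith+
      show "\<Phi> (\<epsilon> m + \<epsilon> m) + \<Phi> (\<epsilon> n + \<epsilon> n) - 2 * \<Phi> (\<epsilon> m + \<epsilon> n) \<le> e"
        using s[of m m] s[of n n] s[of m n] that by linarith
    qed
    then show "\<exists>n0. \<forall>m\<ge>n0. \<forall>n\<ge>n0. (\<integral>\<^sup>+q. ennreal ((\<Lambda> m q - \<Lambda> n q)\<^sup>2) \<partial>(lborel \<Otimes>\<^sub>M M)) \<le> ennreal e"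
      by blast
  qed (auto intro: that)
  \<comment> \<open>A version of the limit that is nonnegative everywhere; as the approximations are nonnegative, it
    is at least as close to them.\<close>
  define L' where "L' q = max 0 (L q)" for q
  have [measurable]: "L' \<in> borel_measurable (lborel \<Otimes>\<^sub>M M)" unfolding L'_def by measurable
  have L'0: "L' q \<ge> 0" for q by (simp add: L'_def)
  have L': "(\<lambda>n. \<integral>\<^sup>+q. ennreal ((\<Lambda> n q - L' q)\<^sup>2) \<partial>(lborel \<Otimes>\<^sub>M M)) \<longlonglongrightarrow> 0"
  proof (rule tendsto_sandwich[OF _ _ tendsto_const L])
    have "(\<Lambda> n q - L' q)\<^sup>2 \<le> (\<Lambda> n q - L q)\<^sup>2" for n q
      unfolding abs_le_square_iff[symmetric] using \<Lambda>0[of n q] by (auto simp: L'_def)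
    then show "\<forall>\<^sub>F n in sequentially. (\<integral>\<^sup>+q. ennreal ((\<Lambda> n q - L' q)\<^sup>2) \<partial>(lborel \<Otimes>\<^sub>M M)) \<le> (\<integral>\<^sup>+q. ennreal ((\<Lambda> n q - L q)\<^sup>2) \<partial>(lborel \<Otimes>\<^sub>M M))"
      by (intro always_eventually allI nn_integral_mono ennreal_leI)
  qed simp
  have L'2: "(\<integral>\<^sup>+q. ennreal ((L' q)\<^sup>2) \<partial>(lborel \<Otimes>\<^sub>M M)) < \<infinity>"
  proof -
    have "\<forall>\<^sub>F n in sequentially. (\<integral>\<^sup>+q. ennreal ((\<Lambda> n q - L' q)\<^sup>2) \<partial>(lborel \<Otimes>\<^sub>M M)) < 1"
      by (intro order_tendstoD[OF L']) auto
    then obtain n where n: "(\<integral>\<^sup>+q. ennreal ((\<Lambda> n q - L' q)\<^sup>2) \<partial>(lborel \<Otimes>\<^sub>M M)) < 1"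
      by (auto dest: eventually_happens)
    have "(\<integral>\<^sup>+q. ennreal ((L' q)\<^sup>2) \<partial>(lborel \<Otimes>\<^sub>M M)) \<le>
        2 * (\<integral>\<^sup>+q. ennreal ((\<Lambda> n q - L' q)\<^sup>2) \<partial>(lborel \<Otimes>\<^sub>M M)) + 2 * (\<integral>\<^sup>+q. ennreal ((\<Lambda> n q)\<^sup>2) \<partial>(lborel \<Otimes>\<^sub>M M))"
      using nn_integral_square_diff_le[of L' "lborel \<Otimes>\<^sub>M M" "\<lambda>_. 0" "\<Lambda> n"] by (simp add: power2_commute)
    also have "\<dots> < \<infinity>"
      using prod[of n n] n by (simp add: power2_eq_square[of "\<Lambda> n _"] ennreal_mult_less_top ennreal_add_less_top less_trans[OF n])
    finally show ?thesis .
  qed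
  \<comment> \<open>truncated at one in order to be real valued\<close>
  define u where "u n \<omega> = enn2real (min 1 (\<integral>\<^sup>+x. ennreal ((\<Lambda> n (x, \<omega>) - L' (x, \<omega>))\<^sup>2) \<partial>lborel))" for n \<omega>
  have [measurable]: "(\<lambda>\<omega>. \<integral>\<^sup>+x. ennreal ((\<Lambda> n (x, \<omega>) - L' (x, \<omega>))\<^sup>2) \<partial>lborel) \<in> borel_measurable M" for n
    by measurable
  have [measurable]: "u n \<in> borel_measurable M" for n unfolding u_def by measurable
  have eu: "ennreal (u n \<omega>) = min 1 (\<integral>\<^sup>+x. ennreal ((\<Lambda> n (x, \<omega>) - L' (x, \<omega>))\<^sup>2) \<partial>lborel)" for n \<omega>
    unfolding u_def by (intro ennreal_enn2real) (simp add: min_less_iff_disj)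
  have "(\<lambda>n. \<integral>\<^sup>+\<omega>. ennreal (u n \<omega>) \<partial>M) \<longlonglongrightarrow> 0"
  proof (rule tendsto_sandwich[OF _ _ tendsto_const L'])
    have "(\<integral>\<^sup>+\<omega>. ennreal (u n \<omega>) \<partial>M) \<le> (\<integral>\<^sup>+\<omega>. \<integral>\<^sup>+x. ennreal ((\<Lambda> n (x, \<omega>) - L' (x, \<omega>))\<^sup>2) \<partial>lborel \<partial>M)" for n
      unfolding eu by (intro nn_integral_mono) simp
    also have "\<dots> n = (\<integral>\<^sup>+q. ennreal ((\<Lambda> n q - L' q)\<^sup>2) \<partial>(lborel \<Otimes>\<^sub>M M))" for n
      by (subst LM.nn_integral_snd[symmetric]) auto
    finally show "\<forall>\<^sub>F n in sequentially. (\<integral>\<^sup>+\<omega>. ennreal (u n \<omega>) \<partial>M) \<le> (\<integral>\<^sup>+q. ennreal ((\<Lambda> n q - L' q)\<^sup>2) \<partial>(lborel \<Otimes>\<^sub>M M))"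
      by simp
  qed simp
  then obtain k where k: "strict_mono k" "AE \<omega> in M. (\<lambda>n. u (k n) \<omega>) \<longlonglongrightarrow> 0"
    by (rule AE_subseq_tendsto_0[rotated 2]) (auto simp: u_def)
  have "AE \<omega> in M. (\<integral>\<^sup>+x. ennreal ((L' (x, \<omega>))\<^sup>2) \<partial>lborel) \<noteq> \<infinity>"
  proof (intro nn_integral_noteq_infinite)
    have "(\<integral>\<^sup>+q. ennreal ((L' q)\<^sup>2) \<partial>(lborel \<Otimes>\<^sub>M M)) = (\<integral>\<^sup>+\<omega>. \<integral>\<^sup>+x. ennreal ((L' (x, \<omega>))\<^sup>2) \<partial>lborel \<partial>M)"
      by (subst LM.nn_integral_snd[symmetric]) auto
    then show "(\<integral>\<^sup>+\<omega>. \<integral>\<^sup>+x. ennreal ((L' (x, \<omega>))\<^sup>2) \<partial>lborel \<partial>M) \<noteq> \<infinity>" using L'2 by simp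
  qed measurable
  with k(2) AE_space have key: "AE \<omega> in M. distr N borel (\<lambda>s. X s \<omega>) = density lborel (\<lambda>x. ennreal (L' (x, \<omega>)))"
  proof eventually_elim
    case (elim \<omega>)
    have [measurable]: "(\<lambda>t. X t \<omega>) \<in> borel_measurable N" by (rule X2[OF elim(2)])
    have [measurable]: "(\<lambda>x. L' (x, \<omega>)) \<in> borel_measurable borel" using elim(2) by measurable
    have "(\<lambda>n. ennreal (u (k n) \<omega>)) \<longlonglongrightarrow> ennreal 0" by (intro tendsto_ennrealI elim(1))
    then have um: "(\<lambda>n. min 1 (\<integral>\<^sup>+x. ennreal ((\<Lambda> (k n) (x, \<omega>) - L' (x, \<omega>))\<^sup>2) \<partial>lborel)) \<longlonglongrightarrow> 0"
      by (simp add: eu)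
    have "(\<lambda>n. \<integral>\<^sup>+x. ennreal ((\<Lambda> (k n) (x, \<omega>) - L' (x, \<omega>))\<^sup>2) \<partial>lborel) \<longlonglongrightarrow> 0"
    proof (rule order_tendstoI)
      fix e :: ennreal assume "0 < e"
      then have "\<forall>\<^sub>F n in sequentially. min 1 (\<integral>\<^sup>+x. ennreal ((\<Lambda> (k n) (x, \<omega>) - L' (x, \<omega>))\<^sup>2) \<partial>lborel) < min 1 e"
        by (intro order_tendstoD[OF um]) (simp add: min_def)
      then show "\<forall>\<^sub>F n in sequentially. (\<integral>\<^sup>+x. ennreal ((\<Lambda> (k n) (x, \<omega>) - L' (x, \<omega>))\<^sup>2) \<partial>lborel) < e"
        by eventually_elim (auto simp: min_def split: if_splits)
    qed simp
    moreover have "(\<lambda>n. \<epsilon> (k n)) \<longlonglongrightarrow> 0" using LIMSEQ_subseq_LIMSEQ[OF \<epsilon>(2) k(1)] by (simp add: o_def)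
    ultimately show ?case
      using elim(3) L'0 \<epsilon>(1) N.finite_measure_axioms
      by (intro occupation_density[where V="\<lambda>n. \<epsilon> (k n)"]) (auto simp: \<Lambda>_def p_def less_top)
  qed
  show ?thesis
    unfolding has_square_integrable_local_time_def
  proof (intro conjI exI[of _ L'])
    show "AE \<omega> in M. absolutely_continuous lborel (occupation_measure {0..T} (\<lambda>s. X s \<omega>))"
      using key AE_space
    proof eventually_elim
      case (elim \<omega>)
      have [measurable]: "(\<lambda>x. L' (x, \<omega>)) \<in> borel_measurable borel" using elim(2) by measurable
      show ?case unfolding occupation_measure_def N_def[symmetric] elim(1)
        by (intro absolutely_continuousI_density) simp
    qed
    show "square_integrable (lborel \<Otimes>\<^sub>M M) L'"
      unfolding square_integrable_def using L'2 by (auto intro!: integrableI_bounded)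
    show "\<forall>q. 0 \<le> L' q" using L'0 by blast
    show "AE \<omega> in M. AE x in lborel. local_time {0..T} (\<lambda>s. X s \<omega>) x = ennreal (L' (x, \<omega>))"
      using key AE_space
    proof eventually_elim
      case (elim \<omega>)
      have [measurable]: "(\<lambda>x. L' (x, \<omega>)) \<in> borel_measurable borel" using elim(2) by measurable
      have "AE x in lborel. ennreal (L' (x, \<omega>)) = RN_deriv lborel (occupation_measure {0..T} (\<lambda>s. X s \<omega>)) x"
        unfolding occupation_measure_def N_def[symmetric] elim(1)
        by (intro sigma_finite_measure.RN_deriv_unique[OF lborel.sigma_finite_measure_axioms]) auto
      then show ?case unfolding local_time_def by eventually_elim simp
    qed
  qed
qed

section \<open>The multifractional process\<close>

theorem theorem3:
  fixes M :: "'w measure" and W :: "real set \<Rightarrow> 'w \<Rightarrow> real"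
    and T \<gamma> :: real and H1 H2 :: "real \<Rightarrow> real" and X :: "real \<Rightarrow> 'w \<Rightarrow> real"
  assumes "white_noise M W"
    and "T > 0"
    and "continuous_on {0..T} H1" and "continuous_on {0..T} H2"
    and "H1 ` {0..T} \<subseteq> {1/2<..<1}" and "H2 ` {0..T} \<subseteq> {1/2<..<1}"
    and "\<gamma> > ((SUP t\<in>{0..T}. H1 t) + (SUP t\<in>{0..T}. H2 t)) / 2"
    and "\<And>t s. t \<in> {0..T} \<Longrightarrow> s \<in> {0..T} \<Longrightarrow> \<bar>H1 t - H1 s\<bar> \<le> \<bar>t - s\<bar> powr \<gamma>"
    and "\<And>t s. t \<in> {0..T} \<Longrightarrow> s \<in> {0..T} \<Longrightarrow> \<bar>H2 t - H2 s\<bar> \<le> \<bar>t - s\<bar> powr \<gamma>"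
    and "version_on M {0..T} X (multifractional_rosenblatt M W H1 H2)"
    and "jointly_measurable_on M {0..T} X" and "separable_on M {0..T} X"
  shows "has_square_integrable_local_time M {0..T} X"
proof -
  interpret white_noise M W by fact
  define H where "H t = (H1 t + H2 t) / 2" for t
  have H12: "H1 t \<in> {1/2<..<1}" "H2 t \<in> {1/2<..<1}" if "t \<in> {0..T}" for t
    using assms(5,6) that by blast+
  have "continuous_on {0..T} H"
    unfolding H_def using assms(3,4) by (intro continuous_intros) auto
  then obtain t0 where t0: "t0 \<in> {0..T}" "\<And>t. t \<in> {0..T} \<Longrightarrow> H t \<le> H t0"
    using continuous_attains_sup[of "{0..T}" H] \<open>T > 0\<close> by auto
  define h where "h = H t0"
  have h: "1 / 2 < h" "h < 1" using H12[OF t0(1)] by (auto simp: h_def H_def)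
  have H: "1 / 2 < H t" "H t \<le> h" if "t \<in> {0..T}" for t
    using H12[OF that] t0(2)[OF that] by (auto simp: h_def H_def)
  \<comment> \<open>the value that \<open>\<theta> powr (h - 1)\<close> has to reach in order to apply \<open>rosenblatt_increment_char_bound\<close>\<close>
  define c where "c = 9 / 2 * (193 :: real)"
  define \<theta> where "\<theta> = min (1 / 40) (c powr (1 / (h - 1)))"
  have \<theta>: "0 < \<theta>" "\<theta> \<le> 1 / 40" by (auto simp: \<theta>_def c_def)
  have \<theta>_large: "193 \<le> 2 / 9 * \<theta> powr (H t - 1)" if t: "t \<in> {0..T}" for t
  proof -
    have "c = (c powr (1 / (h - 1))) powr (h - 1)"
      using h by (simp add: powr_powr c_def)
    also have "\<dots> \<le> \<theta> powr (h - 1)"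
      using h \<theta>(1) by (intro powr_antimono) (auto simp: \<theta>_def)
    also have "\<dots> \<le> \<theta> powr (H t - 1)"
      using \<theta> H[OF t] by (intro powr_mono') auto
    finally show ?thesis by (simp add: c_def)
  qed
  \<comment> \<open>The factor \<open>\<tau>\<close> allows to replace the exponent \<open>H t\<close> by its maximum \<open>h\<close>, as \<open>t - s \<le> \<tau>\<close> and \<open>h - H t \<le> 1\<close>.\<close>
  define \<tau> where "\<tau> = max 1 T"
  define \<kappa> where "\<kappa> = \<theta> / \<tau>"
  have \<tau>: "\<tau> \<ge> 1" "\<tau> \<ge> T" by (auto simp: \<tau>_def)
  have \<kappa>: "\<kappa> > 0" using \<theta> \<tau> by (simp add: \<kappa>_def)
  show ?thesis
  proof (rule local_time_of_char_decay[OF assms(2,11) \<kappa> h(2)])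
    fix s t z :: real assume st: "0 \<le> s" "s < t" "t \<le> T"
    then have in_T: "s \<in> {0..T}" "t \<in> {0..T}" by auto
    let ?Y = "\<lambda>t. gen_rosenblatt M W (H1 t) (H2 t) t"
    have Y_meas: "?Y t \<in> borel_measurable M" if "t \<in> {0..T}" for t
      using gen_rosenblatt_has_I2[OF H12[OF that], of t] by (auto simp: has_I2_def square_integrable_def)
    have ver: "AE \<omega> in M. X t \<omega> = ?Y t \<omega>" if "t \<in> {0..T}" for t
      using assms(10) that by (auto simp: version_on_def multifractional_rosenblatt_def)
    have X_meas: "X t \<in> borel_measurable M" if "t \<in> {0..T}" for t
    proof -
      have "(\<lambda>q. X (fst q) (snd q)) \<in> borel_measurable (restrict_space borel {0..T} \<Otimes>\<^sub>M M)"
        using assms(11) unfolding jointly_measurable_on_def by (simp add: case_prod_beta')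
      from measurable_Pair2[OF this, of t] that show ?thesis by (simp add: space_restrict_space)
    qed
    have "(\<integral>\<omega>. iexp (z * (X t \<omega> - X s \<omega>)) \<partial>M) = (\<integral>\<omega>. iexp (z * (?Y t \<omega> - ?Y s \<omega>)) \<partial>M)"
    proof (rule integral_cong_AE)
      note [measurable] = X_meas[OF in_T(1)] X_meas[OF in_T(2)] Y_meas[OF in_T(1)] Y_meas[OF in_T(2)]
      show "(\<lambda>\<omega>. iexp (z * (X t \<omega> - X s \<omega>))) \<in> borel_measurable M" by measurable
      show "(\<lambda>\<omega>. iexp (z * (?Y t \<omega> - ?Y s \<omega>))) \<in> borel_measurable M" by measurable
      show "AE \<omega> in M. iexp (z * (X t \<omega> - X s \<omega>)) = iexp (z * (?Y t \<omega> - ?Y s \<omega>))"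
        using ver[OF in_T(1)] ver[OF in_T(2)] by eventually_elim simp
    qed
    then have "(cmod (\<integral>\<omega>. iexp (z * (X t \<omega> - X s \<omega>)) \<partial>M))\<^sup>2 =
        (cmod (\<integral>\<omega>. iexp (z * (?Y t \<omega> - ?Y s \<omega>)) \<partial>M))\<^sup>2" by simp
    also have "\<dots> \<le> (1 + 8 * z\<^sup>2 * (\<theta> * (t - s) powr H t)\<^sup>2) powr (- (3 / 2))"
      unfolding H_def using \<theta>_large[OF in_T(2)]
      by (intro rosenblatt_increment_char_bound H12 in_T st(1,2) \<theta>) (simp add: H_def)
    also have "\<dots> \<le> (1 + (z * (\<kappa> * (t - s) powr h))\<^sup>2) powr (- (3 / 2))"
    proof (intro powr_antimono)
      have "(t - s) powr h = (t - s) powr (h - H t) * (t - s) powr H t" by (simp add: powr_add[symmetric])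
      also have "(t - s) powr (h - H t) \<le> \<tau> powr (h - H t)"
        using st \<tau> H[OF in_T(2)] by (intro powr_mono2) auto
      also have "\<tau> powr (h - H t) \<le> \<tau> powr 1" using \<tau> h H[OF in_T(2)] by (intro powr_mono) auto
      finally have "(t - s) powr h \<le> \<tau> * (t - s) powr H t" using \<tau> by (simp add: mult_right_mono)
      then have "\<kappa> * (t - s) powr h \<le> \<theta> * (t - s) powr H t"
        using mult_left_mono[of "(t - s) powr h" "\<tau> * (t - s) powr H t" \<kappa>] \<kappa> \<tau> by (simp add: \<kappa>_def)
      then have "(\<kappa> * (t - s) powr h)\<^sup>2 \<le> (\<theta> * (t - s) powr H t)\<^sup>2" using \<kappa> by (intro power_mono) auto
      then have "z\<^sup>2 * (\<kappa> * (t - s) powr h)\<^sup>2 \<le> z\<^sup>2 * (\<theta> * (t - s) powr H t)\<^sup>2" by (intro mult_left_mono) auto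
      moreover have "0 \<le> z\<^sup>2 * (\<theta> * (t - s) powr H t)\<^sup>2" by simp
      ultimately show "1 + (z * (\<kappa> * (t - s) powr h))\<^sup>2 \<le> 1 + 8 * z\<^sup>2 * (\<theta> * (t - s) powr H t)\<^sup>2"
        unfolding power_mult_distrib[of z] by linarith
      have "0 \<le> (z * (\<kappa> * (t - s) powr h))\<^sup>2" by simp
      then show "0 < 1 + (z * (\<kappa> * (t - s) powr h))\<^sup>2" by linarith
    qed simp
    finally show "(cmod (\<integral>\<omega>. iexp (z * (X t \<omega> - X s \<omega>)) \<partial>M))\<^sup>2 \<le>
      (1 + (z * (\<kappa> * (t - s) powr h))\<^sup>2) powr (- (3 / 2))" .
  qed
qed

end
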